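(* Let $\alpha,\beta>-1$. The operators $\mathbb{D}_{\alpha,\beta}^\circ$ and $\mathbb{D}_{0;\alpha,\beta}^\circ$ are self-adjoint and nonnegative extensions of $G^\circ_{\alpha,\beta}$. Moreover, $\mathbb{D}_{0;\alpha,\beta}^\circ$ is the Friedrichs extension of $G^\circ_{\alpha,\beta}$.
   Context: Notation: $\mathbb{R}^2_+=(0,\infty)\times(0,\infty)$; $L^2(\mathbb{R}^2_+)$ is taken with respect to Lebesgue measure $dr\,ds$, with inner product $\langle\cdot,\cdot\rangle$. For $\alpha,\beta\in\mathbb{R}$, $$G_{\alpha,\beta}^\circ=\Big(-\frac{\partial^2}{\partial r^2}+\frac{\alpha^2-1/4}{r^2}\Big)+r^2\Big(-\frac{\partial^2}{\partial s^2}+\frac{\beta^2-1/4}{s^2}\Big)$$ with domain $C^\infty_c(\mathbb{R}^2_+)\subset L^2(\mathbb{R}^2_+)$; it is symmetric and nonnegative. Define on $C^\infty_c(\mathbb{R}^2_+)$ the operators $$\mathfrak{d}_1^\circ=\frac{\partial}{\partial r}-\frac{\alpha+1/2}{r},\quad \mathfrak{d}_1^{\circ,\dagger}=-\frac{\partial}{\partial r}-\frac{\alpha+1/2}{r},\quad \mathfrak{d}_2^\circ=r\Big(\frac{\partial}{\partial s}-\frac{\beta+1/2}{s}\Big),\quad \mathfrak{d}_2^{\circ,\dagger}=r\Big(-\frac{\partial}{\partial s}-\frac{\beta+1/2}{s}\Big).$$ For $f\in L^1_{\rm loc}(\mathbb{R}^2_+)$ and $j\in\{1,2\}$, the weak $\mathfrak{d}_j^\circ$-derivative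 of $f$ exists and equals $\mathfrak{d}^\circ_{j,{\rm weak}}f:=g_j\in L^1_{\rm loc}(\mathbb{R}^2_+)$ if $\int_{\mathbb{R}^2_+}\mathfrak{d}_j^{\circ,\dagger}\varphi\,\overline{f}\,dr\,ds=\int_{\mathbb{R}^2_+}\varphi\,\overline{g_j}\,dr\,ds$ for all $\varphi\in C^\infty_c(\mathbb{R}^2_+)$. The delta-Sobolev space $W^\circ_{\alpha,\beta}(\mathbb{R}^2_+)$ is the set of $f\in L^2(\mathbb{R}^2_+)$ such that $\mathfrak{d}^\circ_{j,{\rm weak}}f$ exists and belongs to $L^2(\mathbb{R}^2_+)$ for $j=1,2$, with inner product $\langle f,g\rangle+\sum_{j=1}^2\langle\mathfrak{d}^\circ_{j,{\rm weak}}f,\mathfrak{d}^\circ_{j,{\rm weak}}g\rangle$. $W^\circ_{0;\alpha,\beta}(\mathbb{R}^2_+)$ is the closure of $C^\infty_c(\mathbb{R}^2_+)$ in $W^\circ_{\alpha,\beta}(\mathbb{R}^2_+)$. The form $\mathfrak{t}^\circ$ with domain $W^\circ_{\alpha,\beta}(\mathbb{R}^2_+)$ is $$\mathfrak{t}^\circ[f,g]=\int_{\mathbb{R}^2_+}\sum_{j=1}^2\mathfrak{d}^\circ_{j,{\rm weak}}f\,\overline{\mathfrak{d}^\circ_{j,{\rm weak}}g}\,dr\,ds,$$ and $\mathfrak{t}^\circ_0$ is its restriction to $W^\circ_{0;\alpha,\beta}(\mathbb{R}^2_+)$. For a densely defined sesquilinear form $\mathfrak{s}$ on a Hilbert space $H$,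 the associated operator $A_{\mathfrak{s}}$ has domain the set of $h\in\mathrm{Dom}\,\mathfrak{s}$ for which there is $u_h\in H$ with $\mathfrak{s}[h,h']=\langle u_h,h'\rangle_H$ for all $h'\in\mathrm{Dom}\,\mathfrak{s}$, and $A_{\mathfrak{s}}h=u_h$. $\mathbb{D}^\circ_{\alpha,\beta}$ and $\mathbb{D}^\circ_{0;\alpha,\beta}$ denote the operators associated with $\mathfrak{t}^\circ$ and $\mathfrak{t}^\circ_0$, respectively. The Friedrichs extension of a densely defined symmetric nonnegative operator $S$ is the operator associated with the closure of the form $(x,y)\mapsto\langle Sx,y\rangle_H$ on $\mathrm{Dom}\,S$. An operator $T$ is nonnegative if $\langle Tf,f\rangle\ge0$ for all $f\in\mathrm{Dom}\,T$. *)

theory Defs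
  imports "HOL-Analysis.Analysis"
begin

section \<open>Complex inner product spaces\<close>

text \<open>
  The complex inner product \<open>cinner\<close> is linear in its first argument and conjugate-linear in the
  second one; norm, metric and topology are those of the underlying real inner product space.
\<close>

class complex_inner = real_inner +
  fixes scaleC :: "complex \<Rightarrow> 'a \<Rightarrow> 'a" (infixr \<open>*\<^sub>C\<close> 75)
    and cinner :: "'a \<Rightarrow> 'a \<Rightarrow> complex"
  assumes scaleC_add_right: "c *\<^sub>C (x + y) = c *\<^sub>C x + c *\<^sub>C y"
    and scaleC_add_left: "(c + d) *\<^sub>C x = c *\<^sub>C x + d *\<^sub>C x"
    and scaleC_scaleC: "c *\<^sub>C d *\<^sub>C x = (c * d) *\<^sub>C x"
    and scaleR_scaleC: "a *\<^sub>R x = complex_of_real a *\<^sub>C x"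
    and cinner_commute: "cinner x y = cnj (cinner y x)"
    and cinner_add_left: "cinner (x + y) z = cinner x z + cinner y z"
    and cinner_scaleC_left: "cinner (c *\<^sub>C x) y = c * cinner x y"
    and inner_eq_Re_cinner: "inner x y = Re (cinner x y)"


section \<open>Unbounded operators and sesquilinear forms\<close>

text \<open>
  An unbounded operator is identified with its graph: \<open>(x, y) \<in> T\<close> means \<open>x \<in> Dom T\<close> and
  \<open>T x = y\<close>. Hence \<open>Domain T\<close> is its domain, and \<open>S \<subseteq> T\<close> says that \<open>T\<close> extends \<open>S\<close>.
\<close>

definition is_operator :: "('a::complex_inner \<times> 'a) set \<Rightarrow> bool" where
  "is_operator T \<longleftrightarrow>
     (0, 0) \<in> T \<and>
     (\<forall>x y x' y'. (x, y) \<in> T \<longrightarrow> (x', y') \<in> T \<longrightarrow> (x + x', y + y') \<in> T) \<and>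
     (\<forall>c x y. (x, y) \<in> T \<longrightarrow> (c *\<^sub>C x, c *\<^sub>C y) \<in> T) \<and>
     single_valued T"

definition op_apply :: "('a \<times> 'a) set \<Rightarrow> 'a \<Rightarrow> 'a" where
  "op_apply T x = (THE y. (x, y) \<in> T)"

definition densely_defined :: "('a::complex_inner \<times> 'a) set \<Rightarrow> bool" where
  "densely_defined T \<longleftrightarrow> closure (Domain T) = UNIV"

definition adjoint_op :: "('a::complex_inner \<times> 'a) set \<Rightarrow> ('a \<times> 'a) set" where
  "adjoint_op T = {(y, z). \<forall>(x, w) \<in> T. cinner w y = cinner x z}"

definition self_adjoint_op :: "('a::complex_inner \<times> 'a) set \<Rightarrow> bool" where
  "self_adjoint_op T \<longleftrightarrow> is_operator T \<and> densely_defined T \<and> adjoint_op T = T"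

definition symmetric_op :: "('a::complex_inner \<times> 'a) set \<Rightarrow> bool" where
  "symmetric_op T \<longleftrightarrow> (\<forall>(x, y) \<in> T. \<forall>(x', y') \<in> T. cinner y x' = cinner x y')"

definition nonnegative_op :: "('a::complex_inner \<times> 'a) set \<Rightarrow> bool" where
  "nonnegative_op T \<longleftrightarrow> (\<forall>(x, y) \<in> T. cinner y x \<in> \<real> \<and> 0 \<le> Re (cinner y x))"

text \<open>A sesquilinear form is given by its domain \<open>D\<close> and its values \<open>q x y\<close> for \<open>x, y \<in> D\<close>.\<close>

definition form_operator :: "'a::complex_inner set \<Rightarrow> ('a \<Rightarrow> 'a \<Rightarrow> complex) \<Rightarrow> ('a \<times> 'a) set" where
  "form_operator D q = {(h, u). h \<in> D \<and> (\<forall>h' \<in> D. q h h' = cinner u h')}"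

text \<open>
  The closure of a nonnegative (closable) form: its domain consists of the limits in \<open>H\<close> of
  sequences in \<open>D\<close> that are Cauchy with respect to the form, and its values are obtained by
  passing to the limit along any such sequences.
\<close>

definition form_converges ::
  "'a::complex_inner set \<Rightarrow> ('a \<Rightarrow> 'a \<Rightarrow> complex) \<Rightarrow> (nat \<Rightarrow> 'a) \<Rightarrow> 'a \<Rightarrow> bool" where
  "form_converges D q X h \<longleftrightarrow>
     (\<forall>n. X n \<in> D) \<and> X \<longlonglongrightarrow> h \<and>
     (\<forall>e>0. \<exists>N. \<forall>m\<ge>N. \<forall>n\<ge>N. cmod (q (X m - X n) (X m - X n)) < e)"

definition form_closure_dom ::
  "'a::complex_inner set \<Rightarrow> ('a \<Rightarrow> 'a \<Rightarrow> complex) \<Rightarrow> 'a set" where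
  "form_closure_dom D q = {h. \<exists>X. form_converges D q X h}"

definition form_closure ::
  "'a::complex_inner set \<Rightarrow> ('a \<Rightarrow> 'a \<Rightarrow> complex) \<Rightarrow> 'a \<Rightarrow> 'a \<Rightarrow> complex" where
  "form_closure D q h g =
     (THE l. \<forall>X Y. form_converges D q X h \<longrightarrow> form_converges D q Y g \<longrightarrow>
        (\<lambda>n. q (X n) (Y n)) \<longlonglongrightarrow> l)"

definition is_friedrichs_extension ::
  "('a::complex_inner \<times> 'a) set \<Rightarrow> ('a \<times> 'a) set \<Rightarrow> bool" where
  "is_friedrichs_extension S T \<longleftrightarrow>
     is_operator S \<and> densely_defined S \<and> symmetric_op S \<and> nonnegative_op S \<and>
     (let q = (\<lambda>x y. cinner (op_apply S x) y)
      in T = form_operator (form_closure_dom (Domain S) q) (form_closure (Domain S) q))"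


section \<open>The Hilbert space of square-integrable functions on the open quadrant\<close>

definition quadrant :: "(real \<times> real) set" where
  "quadrant = {0<..} \<times> {0<..}"

definition quadrant_measure :: "(real \<times> real) measure" where
  "quadrant_measure = restrict_space lborel quadrant"

definition square_integrable :: "(real \<times> real \<Rightarrow> complex) \<Rightarrow> bool" where
  "square_integrable f \<longleftrightarrow>
     f \<in> borel_measurable quadrant_measure \<and>
     integrable quadrant_measure (\<lambda>x. (cmod (f x))\<^sup>2)"

definition l2_rel :: "(real \<times> real \<Rightarrow> complex) \<Rightarrow> (real \<times> real \<Rightarrow> complex) \<Rightarrow> bool" where
  "l2_rel f g \<longleftrightarrow>
     square_integrable f \<and> square_integrable g \<and> (AE x in quadrant_measure. f x = g x)"

lemma square_integrable_zero: "square_integrable (\<lambda>x. 0)"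
  by (simp add: square_integrable_def)

lemma part_equivp_l2_rel: "part_equivp l2_rel"
proof (rule part_equivpI)
  show "\<exists>f. l2_rel f f"
    using square_integrable_zero by (auto simp: l2_rel_def)
  show "symp l2_rel"
    by (rule sympI) (auto simp: l2_rel_def)
  show "transp l2_rel"
    by (rule transpI) (auto simp: l2_rel_def)
qed

text \<open>
  Elements are classes of almost everywhere equal functions; only the values on the quadrant
  matter. Using Borel instead of Lebesgue measurable representatives gives the same space, since
  every class contains a Borel function. \<open>abs_l2\<close> maps a square-integrable function to its class, \<open>rep_l2\<close> selects a
  representative.
\<close>

quotient_type l2 = "real \<times> real \<Rightarrow> complex" / partial: l2_rel
  morphisms rep_l2 abs_l2
  by (rule part_equivp_l2_rel)

lemma square_integrable_mult_cnj:
  assumes "square_integrable f" "square_integrable g"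
  shows "integrable quadrant_measure (\<lambda>x. f x * cnj (g x))"
proof (rule Bochner_Integration.integrable_bound)
  show "integrable quadrant_measure (\<lambda>x. (cmod (f x))\<^sup>2 + (cmod (g x))\<^sup>2)"
    using assms by (simp add: square_integrable_def)
  have [measurable]: "f \<in> borel_measurable quadrant_measure"
    "g \<in> borel_measurable quadrant_measure"
    using assms by (simp_all add: square_integrable_def)
  have [measurable]: "cnj \<in> borel_measurable borel"
    by (intro borel_measurable_continuous_onI continuous_intros)
  show "(\<lambda>x. f x * cnj (g x)) \<in> borel_measurable quadrant_measure"
    by measurable
  show "AE x in quadrant_measure.
      norm (f x * cnj (g x)) \<le> norm ((cmod (f x))\<^sup>2 + (cmod (g x))\<^sup>2)"
  proof (rule AE_I2)
    fix x
    have "2 * (cmod (f x) * cmod (g x)) \<le> (cmod (f x))\<^sup>2 + (cmod (g x))\<^sup>2"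
      using sum_squares_bound[of "cmod (f x)" "cmod (g x)"] by (simp add: mult.assoc)
    moreover have "0 \<le> cmod (f x) * cmod (g x)"
      by simp
    ultimately have "cmod (f x) * cmod (g x) \<le> (cmod (f x))\<^sup>2 + (cmod (g x))\<^sup>2"
      by linarith
    then show "norm (f x * cnj (g x)) \<le> norm ((cmod (f x))\<^sup>2 + (cmod (g x))\<^sup>2)"
      by (simp add: norm_mult)
  qed
qed

lemma square_integrable_add:
  assumes "square_integrable f" "square_integrable g"
  shows "square_integrable (\<lambda>x. f x + g x)"
proof -
  have [measurable]: "f \<in> borel_measurable quadrant_measure"
    "g \<in> borel_measurable quadrant_measure"
    using assms by (simp_all add: square_integrable_def)
  have "integrable quadrant_measure (\<lambda>x. (cmod (f x + g x))\<^sup>2)"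
  proof (rule Bochner_Integration.integrable_bound)
    show "integrable quadrant_measure (\<lambda>x. 2 * (cmod (f x))\<^sup>2 + 2 * (cmod (g x))\<^sup>2)"
      using assms by (simp add: square_integrable_def)
    show "AE x in quadrant_measure.
        norm ((cmod (f x + g x))\<^sup>2) \<le> norm (2 * (cmod (f x))\<^sup>2 + 2 * (cmod (g x))\<^sup>2)"
    proof (rule AE_I2)
      fix x
      have "(cmod (f x + g x))\<^sup>2 \<le> (cmod (f x) + cmod (g x))\<^sup>2"
        by (intro power_mono norm_triangle_ineq) simp
      also have "\<dots> \<le> 2 * (cmod (f x))\<^sup>2 + 2 * (cmod (g x))\<^sup>2"
        using sum_squares_bound[of "cmod (f x)" "cmod (g x)"] by (simp add: power2_sum)
      finally show
        "norm ((cmod (f x + g x))\<^sup>2) \<le> norm (2 * (cmod (f x))\<^sup>2 + 2 * (cmod (g x))\<^sup>2)"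
        by simp
    qed
  qed simp
  then show ?thesis
    by (simp add: square_integrable_def)
qed

lemma square_integrable_scaleC:
  assumes "square_integrable f"
  shows "square_integrable (\<lambda>x. c * f x)"
  using assms by (auto simp: square_integrable_def norm_mult power_mult_distrib)

instantiation l2 :: complex_inner
begin

lift_definition zero_l2 :: l2 is "\<lambda>x. 0"
  by (simp add: l2_rel_def square_integrable_zero)

lift_definition plus_l2 :: "l2 \<Rightarrow> l2 \<Rightarrow> l2" is "\<lambda>f g x. f x + g x"
  by (auto simp: l2_rel_def intro: square_integrable_add)

lift_definition scaleC_l2 :: "complex \<Rightarrow> l2 \<Rightarrow> l2" is "\<lambda>c f x. c * f x"
  by (auto simp: l2_rel_def intro: square_integrable_scaleC)

lift_definition cinner_l2 :: "l2 \<Rightarrow> l2 \<Rightarrow> complex" is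
  "\<lambda>f g. \<integral>x. f x * cnj (g x) \<partial>quadrant_measure"
proof -
  fix f f' g g'
  assume r: "l2_rel f f'" "l2_rel g g'"
  then have s: "square_integrable f" "square_integrable f'"
    "square_integrable g" "square_integrable g'"
    by (auto simp: l2_rel_def)
  show "(\<integral>x. f x * cnj (g x) \<partial>quadrant_measure) = (\<integral>x. f' x * cnj (g' x) \<partial>quadrant_measure)"
  proof (rule integral_cong_AE)
    show "(\<lambda>x. f x * cnj (g x)) \<in> borel_measurable quadrant_measure"
      "(\<lambda>x. f' x * cnj (g' x)) \<in> borel_measurable quadrant_measure"
      using square_integrable_mult_cnj[OF s(1,3)] square_integrable_mult_cnj[OF s(2,4)]
      by (auto intro: borel_measurable_integrable)
    show "AE x in quadrant_measure. f x * cnj (g x) = f' x * cnj (g' x)"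
      using r by (auto simp: l2_rel_def)
  qed
qed

definition uminus_l2 :: "l2 \<Rightarrow> l2" where "uminus_l2 u = (-1) *\<^sub>C u"
definition minus_l2 :: "l2 \<Rightarrow> l2 \<Rightarrow> l2" where "minus_l2 u v = u + - v" for u v :: l2
definition scaleR_l2 :: "real \<Rightarrow> l2 \<Rightarrow> l2" where "scaleR_l2 a u = complex_of_real a *\<^sub>C u"
definition inner_l2 :: "l2 \<Rightarrow> l2 \<Rightarrow> real" where "inner_l2 u v = Re (cinner u v)"
definition norm_l2 :: "l2 \<Rightarrow> real" where "norm_l2 u = sqrt (inner u u)"
definition dist_l2 :: "l2 \<Rightarrow> l2 \<Rightarrow> real" where "dist_l2 u v = norm (u - v)"
definition sgn_l2 :: "l2 \<Rightarrow> l2" where "sgn_l2 u = inverse (norm u) *\<^sub>R u"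
definition uniformity_l2 :: "(l2 \<times> l2) filter" where
  "uniformity_l2 = (INF e\<in>{0<..}. principal {(u, v). dist u v < e})"
definition open_l2 :: "l2 set \<Rightarrow> bool" where
  "open_l2 U \<longleftrightarrow> (\<forall>u\<in>U. \<forall>\<^sub>F (u', v) in uniformity. u' = u \<longrightarrow> v \<in> U)"

instance
proof
  note l2_rel_def [simp] and square_integrable_add [simp] and square_integrable_scaleC [simp]
    and square_integrable_zero [simp]
  fix u v w :: l2 and a b :: real and c d :: complex and U :: "l2 set"
  show "u + v + w = u + (v + w)"
    by transfer (simp add: add.assoc)
  show comm: "u + v = v + u"
    by transfer (simp add: add.commute)
  show "0 + u = u"
    by transfer simp
  show "- u + u = 0"
    unfolding uminus_l2_def by transfer simp
  show "u - v = u + - v"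
    by (simp add: minus_l2_def)
  show C1: "c *\<^sub>C (u + v) = c *\<^sub>C u + c *\<^sub>C v" for c :: complex and u v :: l2
    by transfer (simp add: algebra_simps)
  show C2: "(c + d) *\<^sub>C u = c *\<^sub>C u + d *\<^sub>C u" for c d :: complex and u :: l2
    by transfer (simp add: algebra_simps)
  show C3: "c *\<^sub>C d *\<^sub>C u = (c * d) *\<^sub>C u" for c d :: complex and u :: l2
    by transfer (simp add: algebra_simps)
  show "a *\<^sub>R (u + v) = a *\<^sub>R u + a *\<^sub>R v"
    by (simp add: scaleR_l2_def C1)
  show "(a + b) *\<^sub>R u = a *\<^sub>R u + b *\<^sub>R u"
    by (simp add: scaleR_l2_def C2)
  show "a *\<^sub>R b *\<^sub>R u = (a * b) *\<^sub>R u"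
    by (simp add: scaleR_l2_def C3)
  show "1 *\<^sub>R u = u"
    unfolding scaleR_l2_def by transfer simp
  show "a *\<^sub>R u = complex_of_real a *\<^sub>C u"
    by (rule scaleR_l2_def)
  show "dist u v = norm (u - v)"
    by (rule dist_l2_def)
  show "sgn u = inverse (norm u) *\<^sub>R u"
    by (rule sgn_l2_def)
  show "uniformity = (INF e\<in>{0<..}. principal {(u, v). dist (u::l2) v < e})"
    by (rule uniformity_l2_def)
  show "open U \<longleftrightarrow> (\<forall>u\<in>U. \<forall>\<^sub>F (u', v) in uniformity. u' = u \<longrightarrow> v \<in> U)"
    by (rule open_l2_def)
  show D1: "cinner u v = cnj (cinner v u)" for u v :: l2
    by transfer (simp flip: Bochner_Integration.integral_cnj add: mult.commute)
  show D2: "cinner (u + v) w = cinner u w + cinner v w" for u v w :: l2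
    by transfer (simp add: distrib_right square_integrable_mult_cnj)
  show D3: "cinner (c *\<^sub>C u) v = c * cinner u v" for c :: complex and u v :: l2
    by transfer (simp add: mult.assoc)
  show "inner u v = Re (cinner u v)"
    by (rule inner_l2_def)
  show "inner u v = inner v u"
    unfolding inner_l2_def by (subst D1) simp
  show "inner (u + v) w = inner u w + inner v w"
    by (simp add: inner_l2_def D2)
  show "inner (a *\<^sub>R u) v = a * inner u v"
    by (simp add: inner_l2_def scaleR_l2_def D3)
  have *: "(\<integral>x. f x * cnj (f x) \<partial>quadrant_measure) =
      complex_of_real (\<integral>x. (cmod (f x))\<^sup>2 \<partial>quadrant_measure)" for f
    by (simp only: complex_norm_square[symmetric] integral_complex_of_real)
  show "0 \<le> inner u u"
    unfolding inner_l2_def by transfer (simp add: *)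
  show "inner u u = 0 \<longleftrightarrow> u = 0"
    unfolding inner_l2_def
  proof transfer
    fix f assume "l2_rel f f"
    then have f: "square_integrable f" by simp
    have "(\<integral>x. (cmod (f x))\<^sup>2 \<partial>quadrant_measure) = 0 \<longleftrightarrow>
        (AE x in quadrant_measure. (cmod (f x))\<^sup>2 = 0)"
      using f by (intro integral_nonneg_eq_0_iff_AE) (auto simp: square_integrable_def)
    then show "Re (\<integral>x. f x * cnj (f x) \<partial>quadrant_measure) = 0 \<longleftrightarrow> l2_rel f (\<lambda>x. 0)"
      using f by (simp add: *)
  qed
  show "norm u = sqrt (inner u u)"
    by (rule norm_l2_def)
qed

end


section \<open>Test functions\<close>

definition partial_r :: "(real \<times> real \<Rightarrow> complex) \<Rightarrow> real \<times> real \<Rightarrow> complex" where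
  "partial_r f = (\<lambda>(r, s). vector_derivative (\<lambda>t. f (t, s)) (at r))"

definition partial_s :: "(real \<times> real \<Rightarrow> complex) \<Rightarrow> real \<times> real \<Rightarrow> complex" where
  "partial_s f = (\<lambda>(r, s). vector_derivative (\<lambda>t. f (r, t)) (at s))"

primrec Ck :: "nat \<Rightarrow> (real \<times> real \<Rightarrow> complex) \<Rightarrow> bool" where
  "Ck 0 f \<longleftrightarrow> continuous_on UNIV f"
| "Ck (Suc k) f \<longleftrightarrow>
     continuous_on UNIV f \<and>
     (\<forall>r s. (\<lambda>t. f (t, s)) differentiable (at r) \<and> (\<lambda>t. f (r, t)) differentiable (at s)) \<and>
     Ck k (partial_r f) \<and> Ck k (partial_s f)"

text \<open>Functions on the quadrant with compact support are extended by zero to the whole plane.\<close>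

definition test_functions :: "(real \<times> real \<Rightarrow> complex) set" where
  "test_functions = {\<phi>. (\<forall>k. Ck k \<phi>) \<and>
     compact (closure {x. \<phi> x \<noteq> 0}) \<and> closure {x. \<phi> x \<noteq> 0} \<subseteq> quadrant}"


section \<open>The differential operators, the delta-Sobolev spaces and the forms\<close>

definition G_diff ::
  "real \<Rightarrow> real \<Rightarrow> (real \<times> real \<Rightarrow> complex) \<Rightarrow> real \<times> real \<Rightarrow> complex" where
  "G_diff \<alpha> \<beta> \<phi> = (\<lambda>(r, s).
     (- partial_r (partial_r \<phi>) (r, s) + of_real ((\<alpha>\<^sup>2 - 1/4) / r\<^sup>2) * \<phi> (r, s)) +
     of_real (r\<^sup>2) *
       (- partial_s (partial_s \<phi>) (r, s) + of_real ((\<beta>\<^sup>2 - 1/4) / s\<^sup>2) * \<phi> (r, s)))"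

definition G_op :: "real \<Rightarrow> real \<Rightarrow> (l2 \<times> l2) set" where
  "G_op \<alpha> \<beta> = {(abs_l2 \<phi>, abs_l2 (G_diff \<alpha> \<beta> \<phi>)) | \<phi>. \<phi> \<in> test_functions}"

text \<open>
  The formal adjoints of \<open>\<partial>/\<partial>r - (\<alpha> + 1/2)/r\<close> (for \<open>j = 1\<close>) and of
  \<open>r (\<partial>/\<partial>s - (\<beta> + 1/2)/s)\<close> (for \<open>j = 2\<close>). Only these enter the definition of the weak
  derivatives. The index \<open>j\<close> always ranges over \<open>{1, 2}\<close>.
\<close>

definition delta_dagger ::
  "real \<Rightarrow> real \<Rightarrow> nat \<Rightarrow> (real \<times> real \<Rightarrow> complex) \<Rightarrow> real \<times> real \<Rightarrow> complex" where
  "delta_dagger \<alpha> \<beta> j \<phi> = (\<lambda>(r, s).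
     if j = 1 then - partial_r \<phi> (r, s) - of_real ((\<alpha> + 1/2) / r) * \<phi> (r, s)
     else of_real r * (- partial_s \<phi> (r, s) - of_real ((\<beta> + 1/2) / s) * \<phi> (r, s)))"

definition locally_integrable :: "(real \<times> real \<Rightarrow> complex) \<Rightarrow> bool" where
  "locally_integrable f \<longleftrightarrow>
     f \<in> borel_measurable quadrant_measure \<and>
     (\<forall>K. compact K \<and> K \<subseteq> quadrant \<longrightarrow> set_integrable quadrant_measure K f)"

definition has_weak_delta ::
  "real \<Rightarrow> real \<Rightarrow> nat \<Rightarrow> (real \<times> real \<Rightarrow> complex) \<Rightarrow> (real \<times> real \<Rightarrow> complex) \<Rightarrow> bool" where
  "has_weak_delta \<alpha> \<beta> j f g \<longleftrightarrow>
     locally_integrable f \<and> locally_integrable g \<and>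
     (\<forall>\<phi>\<in>test_functions.
        (\<integral>x. delta_dagger \<alpha> \<beta> j \<phi> x * cnj (f x) \<partial>quadrant_measure) =
        (\<integral>x. \<phi> x * cnj (g x) \<partial>quadrant_measure))"

definition Sobolev_W :: "real \<Rightarrow> real \<Rightarrow> l2 set" where
  "Sobolev_W \<alpha> \<beta> =
     {f. \<forall>j\<in>{1, 2}. \<exists>g. has_weak_delta \<alpha> \<beta> j (rep_l2 f) g \<and> square_integrable g}"

definition weak_delta :: "real \<Rightarrow> real \<Rightarrow> nat \<Rightarrow> l2 \<Rightarrow> l2" where
  "weak_delta \<alpha> \<beta> j f = (THE g. has_weak_delta \<alpha> \<beta> j (rep_l2 f) (rep_l2 g))"

definition W_inner :: "real \<Rightarrow> real \<Rightarrow> l2 \<Rightarrow> l2 \<Rightarrow> complex" where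
  "W_inner \<alpha> \<beta> f g =
     cinner f g + (\<Sum>j\<in>{1, 2}. cinner (weak_delta \<alpha> \<beta> j f) (weak_delta \<alpha> \<beta> j g))"

definition W_norm :: "real \<Rightarrow> real \<Rightarrow> l2 \<Rightarrow> real" where
  "W_norm \<alpha> \<beta> f = sqrt (Re (W_inner \<alpha> \<beta> f f))"

definition Sobolev_W0 :: "real \<Rightarrow> real \<Rightarrow> l2 set" where
  "Sobolev_W0 \<alpha> \<beta> =
     {f \<in> Sobolev_W \<alpha> \<beta>. \<forall>e>0. \<exists>\<phi>\<in>test_functions. W_norm \<alpha> \<beta> (f - abs_l2 \<phi>) < e}"

definition t_form :: "real \<Rightarrow> real \<Rightarrow> l2 \<Rightarrow> l2 \<Rightarrow> complex" where
  "t_form \<alpha> \<beta> f g =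
     (\<integral>x. (\<Sum>j\<in>{1, 2}. rep_l2 (weak_delta \<alpha> \<beta> j f) x * cnj (rep_l2 (weak_delta \<alpha> \<beta> j g) x))
        \<partial>quadrant_measure)"

definition D_op :: "real \<Rightarrow> real \<Rightarrow> (l2 \<times> l2) set" where
  "D_op \<alpha> \<beta> = form_operator (Sobolev_W \<alpha> \<beta>) (t_form \<alpha> \<beta>)"

definition D0_op :: "real \<Rightarrow> real \<Rightarrow> (l2 \<times> l2) set" where
  "D0_op \<alpha> \<beta> = form_operator (Sobolev_W0 \<alpha> \<beta>) (t_form \<alpha> \<beta>)"

end

theory Submission
  imports Defs
begin

text \<open>
  Write \<open>\<delta>\<^sub>j\<close> for the two first-order operators, \<open>\<delta>\<^sub>j\<^sup>\<dagger>\<close> for their formal adjoints and \<open>d\<^sub>j\<close> for the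
  weak \<open>\<delta>\<^sub>j\<close>-derivatives. Three observations carry the proof.

  First, testing against \<open>\<delta>\<^sub>j\<^sup>\<dagger> \<phi>\<close> says precisely that \<open>d\<^sub>j\<close> is the Hilbert space adjoint of
  \<open>\<delta>\<^sub>j\<^sup>\<dagger>\<close> on the test functions (\<open>has_weak_delta_iff\<close>). Adjoints are closed, so
  \<open>t[f, g] = \<Sum>\<^sub>j \<langle>d\<^sub>j f, d\<^sub>j g\<rangle>\<close> is a closed nonnegative form on the delta-Sobolev space, by
  completeness of \<open>L\<^sup>2\<close> (\<open>closed_form_t_form\<close>). It is densely defined because the test functions
  are dense (\<open>dense_test_functions\<close>): a function orthogonal to all of them has integral zero over
  every box, since rescaled products of \<open>exp (- 1 / t)\<close> converge to indicators of boxes.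

  Second, the operator of a densely defined closed nonnegative form is self-adjoint and nonnegative
  (\<open>self_adjoint_form_operator\<close>). Minimising \<open>\<parallel>g - h\<parallel>\<^sup>2 + q[g, g]\<close> over the form domain shows that
  \<open>A + 1\<close> is onto, and a symmetric operator with this property is self-adjoint. The restriction of a
  closed form to the closure of a subspace in the form norm is closed again, so that the same theorem
  applies on the closure of the test functions.

  Third, the second-order operator factorises as \<open>G = \<delta>\<^sub>1\<^sup>\<dagger> \<delta>\<^sub>1 + \<delta>\<^sub>2\<^sup>\<dagger> \<delta>\<^sub>2\<close>, and \<open>\<delta>\<^sub>j\<close> maps test
  functions to test functions. By integration by parts \<open>d\<^sub>j \<phi> = \<delta>\<^sub>j \<phi>\<close> for a test function \<open>\<phi>\<close>, and
  the definition of the weak derivative of \<open>g\<close>, applied to \<open>\<delta>\<^sub>j \<phi>\<close>, gives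
  \<open>t[\<phi>, g] = \<Sum>\<^sub>j \<langle>\<delta>\<^sub>j\<^sup>\<dagger> \<delta>\<^sub>j \<phi>, g\<rangle> = \<langle>G \<phi>, g\<rangle>\<close> for every \<open>g\<close> in the delta-Sobolev space
  (\<open>G_op_subset_D_op\<close>). Hence both form operators extend \<open>G\<close>. Moreover, the form of \<open>G\<close> is the
  restriction of \<open>t\<close> to the test functions, so its closure is \<open>t\<close> on their form-norm closure; this
  identifies the Friedrichs extension (\<open>friedrichs_extension_of_restriction\<close>).
\<close>

section \<open>Complex inner products\<close>

lemma cinner_add_right: "cinner x (y + z) = cinner x y + cinner x z"
  by (metis cinner_commute cinner_add_left complex_cnj_add)

lemma cinner_scaleC_right: "cinner x (c *\<^sub>C y) = cnj c * cinner x y"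
  by (metis cinner_commute cinner_scaleC_left complex_cnj_mult)

lemma uminus_eq_scaleC: "- x = (-1) *\<^sub>C (x::'a::complex_inner)"
  using scaleR_scaleC[of "-1" x] by simp

lemma cinner_minus_left: "cinner (- x) y = - cinner x y"
  by (simp add: uminus_eq_scaleC cinner_scaleC_left)

lemma cinner_diff_left: "cinner (x - y) z = cinner x z - cinner y z"
  using cinner_add_left[of x "- y" z] by (simp add: cinner_minus_left)

lemma cinner_diff_right: "cinner x (y - z) = cinner x y - cinner x z"
  by (metis cinner_commute cinner_diff_left complex_cnj_diff)

lemma cinner_zero_left [simp]: "cinner 0 x = 0"
  using cinner_diff_left[of 0 0 x] by simp

lemma cinner_zero_right [simp]: "cinner x 0 = 0"
  using cinner_diff_right[of x 0 0] by simp

lemma cinner_self: "cinner x x = of_real ((norm x)\<^sup>2)"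
proof (rule complex_eqI)
  show "Re (cinner x x) = Re (of_real ((norm x)\<^sup>2))"
    by (simp add: power2_norm_eq_inner inner_eq_Re_cinner)
  have "Im (cinner x x) = - Im (cinner x x)"
    by (subst cinner_commute) simp
  then show "Im (cinner x x) = Im (of_real ((norm x)\<^sup>2))"
    by simp
qed

lemma norm_scaleC: "norm (c *\<^sub>C x) = cmod c * norm (x::'a::complex_inner)"
proof -
  have "complex_of_real ((norm (c *\<^sub>C x))\<^sup>2) = of_real ((cmod c * norm x)\<^sup>2)"
    unfolding cinner_self[symmetric] power_mult_distrib of_real_mult complex_norm_square
    by (simp add: cinner_scaleC_left cinner_scaleC_right mult.assoc)
  then show ?thesis
    by (metis of_real_eq_iff norm_ge_zero mult_nonneg_nonneg power2_eq_imp_eq)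
qed

lemma norm_less_if_square_less: "(norm x)\<^sup>2 < e\<^sup>2 \<Longrightarrow> 0 < e \<Longrightarrow> norm x < e"
  by (meson less_eq_real_def power2_less_imp_less)

section \<open>Nonnegative sesquilinear forms\<close>

locale nonneg_form =
  fixes D :: "'a::complex_inner set" and q :: "'a \<Rightarrow> 'a \<Rightarrow> complex"
  assumes zero_mem: "0 \<in> D"
    and add_mem: "x \<in> D \<Longrightarrow> y \<in> D \<Longrightarrow> x + y \<in> D"
    and scaleC_mem: "x \<in> D \<Longrightarrow> c *\<^sub>C x \<in> D"
    and q_add_left: "x \<in> D \<Longrightarrow> y \<in> D \<Longrightarrow> z \<in> D \<Longrightarrow> q (x + y) z = q x z + q y z"
    and q_scaleC_left: "x \<in> D \<Longrightarrow> y \<in> D \<Longrightarrow> q (c *\<^sub>C x) y = c * q x y"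
    and q_commute: "x \<in> D \<Longrightarrow> y \<in> D \<Longrightarrow> q x y = cnj (q y x)"
    and q_nonneg: "x \<in> D \<Longrightarrow> 0 \<le> Re (q x x)"
begin

lemma diff_mem: "x \<in> D \<Longrightarrow> y \<in> D \<Longrightarrow> x - y \<in> D"
  using add_mem[of x "- y"] scaleC_mem[of y "-1"] by (simp add: uminus_eq_scaleC[symmetric])

lemma q_diff_left:
  assumes "x \<in> D" "y \<in> D" "z \<in> D" shows "q (x - y) z = q x z - q y z"
  using assms q_add_left[of "x - y" y z] by (simp add: diff_mem)

lemma q_add_right:
  assumes "x \<in> D" "y \<in> D" "z \<in> D" shows "q x (y + z) = q x y + q x z"
  using assms by (metis add_mem q_add_left q_commute complex_cnj_add)

lemma q_diff_right:
  assumes "x \<in> D" "y \<in> D" "z \<in> D" shows "q x (y - z) = q x y - q x z"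
  using assms by (metis diff_mem q_diff_left q_commute complex_cnj_diff)

lemma q_scaleC_right:
  assumes "x \<in> D" "y \<in> D" shows "q x (c *\<^sub>C y) = cnj c * q x y"
  using assms by (metis scaleC_mem q_scaleC_left q_commute complex_cnj_mult)

lemma q_self: "x \<in> D \<Longrightarrow> q x x = of_real (Re (q x x))"
  using q_commute[of x x] by (auto simp: complex_eq_iff)

lemma q_parallelogram:
  assumes "x \<in> D" "y \<in> D"
  shows "Re (q (x + y) (x + y)) + Re (q (x - y) (x - y)) = 2 * Re (q x x) + 2 * Re (q y y)"
  using assms
  by (simp add: q_add_left q_add_right q_diff_left q_diff_right add_mem diff_mem)

lemma q_triangle:
  assumes "x \<in> D" "y \<in> D" "z \<in> D"
  shows "Re (q (x - z) (x - z)) \<le> 2 * Re (q (x - y) (x - y)) + 2 * Re (q (y - z) (y - z))"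
  using q_parallelogram[of "x - y" "y - z"] q_nonneg[of "(x - y) - (y - z)"] assms
  by (simp add: diff_mem)

text \<open>
  The form may be degenerate, so the usual optimal multiplier \<open>q x y / q y y\<close> is not available:
  the discriminant of \<open>s \<mapsto> q (s c x - y) (s c x - y)\<close>, with \<open>c\<close> the phase that makes
  \<open>c q x y\<close> positive, is nonpositive instead.
\<close>

lemma q_Cauchy_Schwarz:
  assumes "x \<in> D" "y \<in> D"
  shows "(cmod (q x y))\<^sup>2 \<le> Re (q x x) * Re (q y y)"
proof (cases "q x y = 0")
  case True
  then show ?thesis using assms q_nonneg by simp
next
  case False
  define m where "m = cmod (q x y)"
  define c where "c = cnj (q x y) / of_real m"
  have m: "m > 0" using False by (simp add: m_def)
  have cc: "c * cnj c = 1"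
    using m False complex_norm_square[of "q x y"]
    by (simp add: c_def m_def[symmetric] field_simps power2_eq_square)
  have cq: "c * q x y = of_real m"
    using m False complex_norm_square[of "q x y"]
    by (simp add: c_def m_def[symmetric] field_simps power2_eq_square)
  have qyx: "q y x = cnj (q x y)" using assms q_commute by blast
  have "Re (q x x) * s\<^sup>2 + (- 2 * m) * s + Re (q y y) \<ge> 0" for s :: real
  proof -
    let ?z = "(of_real s * c) *\<^sub>C x"
    have z: "?z \<in> D" using assms scaleC_mem by blast
    have "q (?z - y) (?z - y) =
        of_real s * of_real s * (c * cnj c) * q x x - of_real s * (c * q x y)
          - of_real s * cnj (c * q x y) + q y y"
      using assms z
      by (simp add: q_diff_left q_diff_right diff_mem q_scaleC_left q_scaleC_right qyx
          algebra_simps)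
    then have "Re (q (?z - y) (?z - y)) = s\<^sup>2 * Re (q x x) - 2 * m * s + Re (q y y)"
      unfolding cc cq by (simp add: power2_eq_square)
    then show ?thesis
      using q_nonneg[of "?z - y"] z assms diff_mem by (simp add: algebra_simps)
  qed
  then have *: "\<And>s. Re (q x x) * s\<^sup>2 - 2 * m * s + Re (q y y) \<ge> 0"
    by (simp add: algebra_simps)
  show ?thesis
  proof (cases "Re (q x x) = 0")
    case True
    then have False
      using *[of "(Re (q y y) + 1) / (2 * m)"] m by simp
    then show ?thesis ..
  next
    case False
    then have p: "Re (q x x) > 0" using q_nonneg[OF assms(1)] by simp
    have "Re (q x x) * (Re (q x x) * (m / Re (q x x))\<^sup>2 - 2 * m * (m / Re (q x x)) + Re (q y y)) \<ge> 0"
      using *[of "m / Re (q x x)"] p by (simp del: diff_ge_0_iff_ge)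
    also have "Re (q x x) * (Re (q x x) * (m / Re (q x x))\<^sup>2 - 2 * m * (m / Re (q x x)) + Re (q y y))
       = Re (q x x) * Re (q y y) - m\<^sup>2"
      using p by (simp add: field_simps power2_eq_square)
    finally show ?thesis by (simp add: m_def)
  qed
qed

text \<open>
  The difference \<open>q (X n) (Y n) - q h g\<close> is the sum of \<open>q (X n - h) (Y n - g)\<close>, \<open>q (X n - h) g\<close> and
  \<open>q h (Y n - g)\<close>, each of which is controlled by the Cauchy-Schwarz inequality.
\<close>

lemma q_tendsto:
  assumes X: "\<And>n. X n \<in> D" "h \<in> D" "(\<lambda>n. Re (q (X n - h) (X n - h))) \<longlonglongrightarrow> 0"
    and Y: "\<And>n. Y n \<in> D" "g \<in> D" "(\<lambda>n. Re (q (Y n - g) (Y n - g))) \<longlonglongrightarrow> 0"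
  shows "(\<lambda>n. q (X n) (Y n)) \<longlonglongrightarrow> q h g"
proof -
  have small: "(\<lambda>n. q (U n) (V n)) \<longlonglongrightarrow> 0"
    if "\<And>n. U n \<in> D" "\<And>n. V n \<in> D"
      "(\<lambda>n. Re (q (U n) (U n)) * Re (q (V n) (V n))) \<longlonglongrightarrow> 0" for U V
  proof -
    have "(\<lambda>n. (cmod (q (U n) (V n)))\<^sup>2) \<longlonglongrightarrow> 0"
      by (rule real_tendsto_sandwich[OF _ _ tendsto_const that(3)])
        (auto intro!: always_eventually q_Cauchy_Schwarz that)
    then have "(\<lambda>n. sqrt ((cmod (q (U n) (V n)))\<^sup>2)) \<longlonglongrightarrow> sqrt 0"
      by (rule tendsto_real_sqrt)
    then show ?thesis by (simp add: tendsto_norm_zero_iff)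
  qed
  have "(\<lambda>n. q (X n - h) (Y n - g)) \<longlonglongrightarrow> 0"
    using tendsto_mult[OF X(3) Y(3)] X Y by (intro small) (auto intro: diff_mem)
  moreover have "(\<lambda>n. q (X n - h) g) \<longlonglongrightarrow> 0"
    using tendsto_mult_left_zero[OF X(3), of "Re (q g g)"] X Y
    by (intro small) (auto intro: diff_mem)
  moreover have "(\<lambda>n. q h (Y n - g)) \<longlonglongrightarrow> 0"
    using tendsto_mult_right_zero[OF Y(3), of "Re (q h h)"] X Y
    by (intro small) (auto intro: diff_mem)
  ultimately have "(\<lambda>n. q (X n - h) (Y n - g) + q (X n - h) g + q h (Y n - g) + q h g)
      \<longlonglongrightarrow> 0 + 0 + 0 + q h g"
    by (intro tendsto_intros)
  moreover have "q (X n - h) (Y n - g) + q (X n - h) g + q h (Y n - g) + q h g = q (X n) (Y n)" for n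
    using X Y by (simp add: q_diff_left q_diff_right diff_mem)
  ultimately show ?thesis by simp
qed

end

text \<open>
  The inner product is itself a nonnegative form, which transfers the inequalities above to it.
\<close>

lemma nonneg_form_cinner: "nonneg_form UNIV cinner"
  by unfold_locales
    (auto simp: cinner_add_left cinner_scaleC_left cinner_self intro: cinner_commute)

lemma tendsto_cinner:
  assumes "X \<longlonglongrightarrow> x" "Y \<longlonglongrightarrow> y"
  shows "(\<lambda>n. cinner (X n) (Y n)) \<longlonglongrightarrow> cinner x y"
proof (rule nonneg_form.q_tendsto[OF nonneg_form_cinner])
  have "(\<lambda>n. (norm (X n - x))\<^sup>2) \<longlonglongrightarrow> 0\<^sup>2" if "X \<longlonglongrightarrow> x" for X and x :: 'a
    using that by (intro tendsto_power) (simp add: tendsto_norm_zero LIM_zero)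
  then show "(\<lambda>n. Re (cinner (X n - x) (X n - x))) \<longlonglongrightarrow> 0"
    and "(\<lambda>n. Re (cinner (Y n - y) (Y n - y))) \<longlonglongrightarrow> 0"
    using assms by (simp_all add: cinner_self)
qed auto

lemma tendsto_scaleC: "X \<longlonglongrightarrow> x \<Longrightarrow> (\<lambda>n. c *\<^sub>C X n) \<longlonglongrightarrow> c *\<^sub>C (x::'a::complex_inner)"
proof -
  assume "X \<longlonglongrightarrow> x"
  then have "(\<lambda>n. cmod c * norm (X n - x)) \<longlonglongrightarrow> 0"
    by (intro tendsto_mult_right_zero) (simp add: tendsto_norm_zero LIM_zero)
  moreover have "cmod c * norm (X n - x) = norm (c *\<^sub>C X n - c *\<^sub>C x)" for n
    using norm_scaleC[of c "X n - x"] scaleC_add_right[of c "X n - x" x]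
    by (simp add: algebra_simps)
  ultimately show ?thesis
    by (simp add: LIM_zero_iff tendsto_norm_zero_iff)
qed

section \<open>Closed forms and their operators\<close>

locale closed_form = nonneg_form D q
  for D :: "'a::{complex_inner, complete_space} set" and q +
  assumes closed: "form_converges D q X h \<Longrightarrow>
    h \<in> D \<and> (\<lambda>n. Re (q (X n - h) (X n - h))) \<longlonglongrightarrow> 0"
begin

lemma cauchy_imp_form_converges:
  assumes X: "\<And>n. X n \<in> D"
    and c: "\<And>e. e > 0 \<Longrightarrow> \<exists>N. \<forall>m\<ge>N. \<forall>n\<ge>N. (norm (X m - X n))\<^sup>2 + Re (q (X m - X n) (X m - X n)) < e"
  shows "\<exists>h. form_converges D q X h"
proof -
  have "Cauchy X"
  proof (rule metric_CauchyI)
    fix e :: real assume e: "e > 0"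
    then obtain N where N: "\<forall>m\<ge>N. \<forall>n\<ge>N. (norm (X m - X n))\<^sup>2 + Re (q (X m - X n) (X m - X n)) < e\<^sup>2"
      using c[of "e\<^sup>2"] by auto
    have "dist (X m) (X n) < e" if "m \<ge> N" "n \<ge> N" for m n
    proof -
      have "(norm (X m - X n))\<^sup>2 < e\<^sup>2"
        using N that q_nonneg[of "X m - X n"] X diff_mem by (smt (verit) )
      then show ?thesis using e norm_less_if_square_less by (auto simp: dist_norm)
    qed
    then show "\<exists>M. \<forall>m\<ge>M. \<forall>n\<ge>M. dist (X m) (X n) < e" by blast
  qed
  then obtain h where h: "X \<longlonglongrightarrow> h"
    using Cauchy_convergent convergentD by blast
  have "\<exists>N. \<forall>m\<ge>N. \<forall>n\<ge>N. cmod (q (X m - X n) (X m - X n)) < e" if e: "e > 0" for e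
  proof -
    obtain N where N: "\<forall>m\<ge>N. \<forall>n\<ge>N. (norm (X m - X n))\<^sup>2 + Re (q (X m - X n) (X m - X n)) < e"
      using c[OF e] by auto
    have "cmod (q (X m - X n) (X m - X n)) < e" if "m \<ge> N" "n \<ge> N" for m n
    proof -
      have "cmod (q (X m - X n) (X m - X n)) = Re (q (X m - X n) (X m - X n))"
        using q_self[of "X m - X n"] q_nonneg[of "X m - X n"] X diff_mem
        by (metis norm_of_real abs_of_nonneg)
      then show ?thesis using N that by (smt (verit) zero_le_power2)
    qed
    then show ?thesis by blast
  qed
  then show ?thesis
    using X h by (auto simp: form_converges_def)
qed

text \<open>
  The functional \<open>J g = \<parallel>g - h\<parallel>\<^sup>2 + q g g\<close> is minimised: by the parallelogram law a minimising
  sequence is Cauchy for the form norm, so that closedness provides a minimiser, whose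
  Euler-Lagrange equation is the asserted identity.
\<close>

theorem exists_resolvent:
  "\<exists>f\<in>D. \<forall>g\<in>D. cinner f g + q f g = cinner h g"
proof -
  define J where "J g = (norm (g - h))\<^sup>2 + Re (q g g)" for g
  define d where "d = Inf (J ` D)"
  have bdd: "bdd_below (J ` D)"
    by (rule bdd_belowI[of _ 0]) (auto simp: J_def intro!: add_nonneg_nonneg q_nonneg)
  have d_le: "d \<le> J g" if "g \<in> D" for g
    unfolding d_def using that bdd by (intro cINF_lower) auto
  obtain \<delta> :: "nat \<Rightarrow> real" where \<delta>: "\<And>n. \<delta> n > 0" "\<delta> \<longlonglongrightarrow> 0"
    using LIMSEQ_inverse_real_of_nat by (metis inverse_positive_iff_positive of_nat_0_less_iff zero_less_Suc)
  have "\<exists>x\<in>D. J x < d + \<delta> n" for n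
  proof -
    have "\<exists>y\<in>J ` D. y < d + \<delta> n"
      unfolding d_def using zero_mem bdd \<delta>
      by (subst cInf_less_iff[symmetric]) auto
    then show ?thesis by auto
  qed
  then obtain X where X: "\<And>n. X n \<in> D" and JX: "\<And>n. J (X n) < d + \<delta> n"
    by metis
  have par: "(norm (x - y))\<^sup>2 + Re (q (x - y) (x - y)) \<le> 2 * (J x - d) + 2 * (J y - d)"
    if "x \<in> D" "y \<in> D" for x y
  proof -
    have half: "(1/2) *\<^sub>R (x + y) = complex_of_real (1/2) *\<^sub>C (x + y)"
      by (rule scaleR_scaleC)
    have in': "(1/2) *\<^sub>R (x + y) \<in> D"
      unfolding half using that by (intro scaleC_mem add_mem)
    have e1: "Re (q ((1/2) *\<^sub>R (x + y)) ((1/2) *\<^sub>R (x + y))) = Re (q (x + y) (x + y)) / 4"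
      unfolding half using that by (simp add: q_scaleC_left q_scaleC_right scaleC_mem add_mem)
    have "4 * (norm ((1/2) *\<^sub>R (x + y) - h))\<^sup>2 = (norm (2 *\<^sub>R ((1/2) *\<^sub>R (x + y) - h)))\<^sup>2"
      by (simp add: power_mult_distrib del: scaleR_right_diff_distrib)
    also have "2 *\<^sub>R ((1/2) *\<^sub>R (x + y) - h) = (x - h) + (y - h)"
      by (simp add: algebra_simps scaleR_2)
    finally have e2: "4 * (norm ((1/2) *\<^sub>R (x + y) - h))\<^sup>2 = (norm ((x - h) + (y - h)))\<^sup>2" .
    have e3: "(norm ((x - h) + (y - h)))\<^sup>2 + (norm (x - y))\<^sup>2
        = 2 * (norm (x - h))\<^sup>2 + 2 * (norm (y - h))\<^sup>2"
      by (simp add: power2_norm_eq_inner inner_diff_left inner_diff_right inner_add_left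
          inner_add_right inner_commute algebra_simps)
    have "4 * J ((1/2) *\<^sub>R (x + y)) =
        2 * J x + 2 * J y - ((norm (x - y))\<^sup>2 + Re (q (x - y) (x - y)))"
      unfolding J_def using e1 e2 e3 q_parallelogram[OF that] by simp
    then show ?thesis using d_le[OF in'] by simp
  qed
  have "\<exists>N. \<forall>m\<ge>N. \<forall>n\<ge>N. (norm (X m - X n))\<^sup>2 + Re (q (X m - X n) (X m - X n)) < e"
    if e: "e > 0" for e
  proof -
    obtain N where N: "\<And>n. n \<ge> N \<Longrightarrow> \<delta> n < e / 4"
      using order_tendstoD(2)[OF \<delta>(2), of "e / 4"] e by (auto simp: eventually_sequentially)
    have "(norm (X m - X n))\<^sup>2 + Re (q (X m - X n) (X m - X n)) < e" if "m \<ge> N" "n \<ge> N" for m n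
    proof -
      show ?thesis
        using par[OF X[of m] X[of n]] JX[of m] JX[of n] N[OF that(1)] N[OF that(2)] by argo
    qed
    then show ?thesis by blast
  qed
  then have "\<exists>f. form_converges D q X f"
    by (rule cauchy_imp_form_converges[OF X])
  then obtain f where f: "form_converges D q X f" by blast
  then have fD: "f \<in> D" and q0: "(\<lambda>n. Re (q (X n - f) (X n - f))) \<longlonglongrightarrow> 0"
    and Xf: "X \<longlonglongrightarrow> f"
    using closed by (auto simp: form_converges_def)
  have "(\<lambda>n. J (X n)) \<longlonglongrightarrow> J f"
    unfolding J_def
    by (intro tendsto_intros Xf q_tendsto X fD q0)
  moreover have "(\<lambda>n. d + \<delta> n) \<longlonglongrightarrow> d + 0"
    by (intro tendsto_intros \<delta>)
  ultimately have "J f \<le> d + 0"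
    using JX by (intro LIMSEQ_le[of "\<lambda>n. J (X n)"]) (auto intro: less_imp_le)
  then have Jf: "J f \<le> J g" if "g \<in> D" for g
    using d_le[OF that] by simp
  have "cinner f g + q f g = cinner h g" if g: "g \<in> D" for g
  proof -
    define c where "c = cinner f g + q f g - cinner h g"
    define P where "P = (norm g)\<^sup>2 + Re (q g g)"
    have P: "P \<ge> 0" using q_nonneg[OF g] by (simp add: P_def)
    \<comment> \<open>The functional decreases from \<open>f\<close> in the direction \<open>- c g\<close>; the step \<open>s\<close> is so short that the
      quadratic term \<open>s\<^sup>2 P\<close> stays below the linear gain \<open>2 s\<close>, both in units of \<open>\<bar>c\<bar>\<^sup>2\<close>.\<close>
    define s where "s = 1 / (1 + P)"
    have s: "s > 0" "s * P < 2" using P by (simp_all add: s_def field_simps)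
    define t where "t = - of_real s * c"
    have tg: "t *\<^sub>C g \<in> D" using g scaleC_mem by blast
    have N: "complex_of_real ((norm x)\<^sup>2) = cinner x x" for x :: 'a
      by (simp add: cinner_self)
    have "complex_of_real ((norm (f + t *\<^sub>C g - h))\<^sup>2) + q (f + t *\<^sub>C g) (f + t *\<^sub>C g)
        = complex_of_real ((norm (f - h))\<^sup>2) + q f f + (t * cnj t) * (cinner g g + q g g)
          + cnj t * c + t * cnj c"
      using fD g tg q_commute[OF fD g] cinner_commute[of g f] cinner_commute[of g h]
      unfolding N c_def
      by (simp add: q_add_left q_add_right add_mem q_scaleC_left q_scaleC_right
          cinner_add_left cinner_add_right cinner_diff_left cinner_diff_right
          cinner_scaleC_left cinner_scaleC_right algebra_simps)
    then have "J (f + t *\<^sub>C g) = J f + Re ((t * cnj t) * (cinner g g + q g g) + cnj t * c + t * cnj c)"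
      unfolding J_def by (metis (no_types, lifting) Re_complex_of_real plus_complex.sel(1) add.assoc)
    also have "(t * cnj t) * (cinner g g + q g g) + cnj t * c + t * cnj c
        = of_real ((cmod c)\<^sup>2 * (s\<^sup>2 * P - 2 * s))"
    proof -
      have "cinner g g + q g g = of_real P"
        using q_self[OF g] by (simp add: P_def cinner_self)
      moreover have "t * cnj t = of_real (s\<^sup>2 * (cmod c)\<^sup>2)"
        unfolding of_real_mult complex_norm_square by (simp add: t_def power2_eq_square)
      moreover have "cnj t * c + t * cnj c = of_real (- 2 * s * (cmod c)\<^sup>2)"
        unfolding of_real_mult complex_norm_square by (simp add: t_def)
      ultimately show ?thesis
        unfolding add.assoc by (simp only: of_real_add[symmetric] of_real_mult[symmetric])
          (simp add: algebra_simps)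
    qed
    finally have "0 \<le> (cmod c)\<^sup>2 * (s\<^sup>2 * P - 2 * s)"
      using Jf[of "f + t *\<^sub>C g"] add_mem[OF fD tg] by simp
    moreover have "s\<^sup>2 * P - 2 * s < 0"
      using s by (simp add: power2_eq_square mult.assoc)
    ultimately have "(cmod c)\<^sup>2 \<le> 0"
      by (simp add: zero_le_mult_iff)
    then show ?thesis by (simp add: c_def)
  qed
  then show ?thesis using fD by blast
qed

end

text \<open>Orthogonal projection is the case of the zero form on a closed subspace.\<close>

lemma dense_if_orthogonal_zero:
  fixes M :: "'a::{complex_inner, complete_space} set"
  assumes zero: "0 \<in> M" and add: "\<And>x y. x \<in> M \<Longrightarrow> y \<in> M \<Longrightarrow> x + y \<in> M"
    and scale: "\<And>c x. x \<in> M \<Longrightarrow> c *\<^sub>C x \<in> M"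
    and orth: "\<And>x. (\<And>m. m \<in> M \<Longrightarrow> cinner x m = 0) \<Longrightarrow> x = 0"
  shows "closure M = UNIV"
proof -
  interpret closed_form "closure M" "\<lambda>_ _. 0"
  proof
    show "0 \<in> closure M" using zero closure_subset by blast
    show "x + y \<in> closure M" if x: "x \<in> closure M" and y: "y \<in> closure M" for x y
    proof -
      obtain X where "\<And>n. X n \<in> M" "X \<longlonglongrightarrow> x"
        using x unfolding closure_sequential by blast
      moreover obtain Y where "\<And>n. Y n \<in> M" "Y \<longlonglongrightarrow> y"
        using y unfolding closure_sequential by blast
      ultimately have "(\<lambda>n. X n + Y n) \<longlonglongrightarrow> x + y" "\<And>n. X n + Y n \<in> M"
        by (auto intro: tendsto_add add)
      then show ?thesis
        unfolding closure_sequential by (intro exI[of _ "\<lambda>n. X n + Y n"]) simp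
    qed
    show "c *\<^sub>C x \<in> closure M" if x: "x \<in> closure M" for c x
    proof -
      obtain X where "\<And>n. X n \<in> M" "X \<longlonglongrightarrow> x"
        using x unfolding closure_sequential by blast
      then have "(\<lambda>n. c *\<^sub>C X n) \<longlonglongrightarrow> c *\<^sub>C x" "\<And>n. c *\<^sub>C X n \<in> M"
        by (auto intro: tendsto_scaleC scale)
      then show ?thesis
        unfolding closure_sequential by (intro exI[of _ "\<lambda>n. c *\<^sub>C X n"]) simp
    qed
    show "h \<in> closure M \<and> (\<lambda>n. Re 0) \<longlonglongrightarrow> 0"
      if "form_converges (closure M) (\<lambda>_ _. 0) X h" for X h
      using that closed_sequential_limits[of "closure M"] by (auto simp: form_converges_def)
  qed auto
  have "h \<in> closure M" for h
  proof -
    obtain f where f: "f \<in> closure M" "\<forall>g\<in>closure M. cinner f g + 0 = cinner h g"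
      using exists_resolvent by blast
    have "cinner (h - f) m = 0" if "m \<in> M" for m
      using f that closure_subset[of M] by (auto simp: cinner_diff_left)
    then have "h - f = 0" by (rule orth)
    then show ?thesis using f by simp
  qed
  then show ?thesis by blast
qed

lemma orthogonal_dense_zero:
  assumes "closure M = UNIV" and "\<And>m. m \<in> M \<Longrightarrow> cinner x m = 0"
  shows "x = 0"
proof -
  have "x \<in> closure M" using assms by simp
  then obtain X where "\<And>n. X n \<in> M" "X \<longlonglongrightarrow> x"
    by (auto simp: closure_sequential)
  then have "(\<lambda>n. 0) \<longlonglongrightarrow> cinner x x"
    using tendsto_cinner[OF tendsto_const, of X x x] assms(2) by simp
  then have "cinner x x = 0" by (simp add: LIMSEQ_const_iff)
  then show ?thesis by (simp add: cinner_self)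
qed

context closed_form
begin

lemma form_operator_symmetric:
  assumes "(x, y) \<in> form_operator D q" "(x', y') \<in> form_operator D q"
  shows "cinner y x' = cinner x y'"
proof -
  have "cinner y x' = q x x'" "cinner y' x = q x' x" "x \<in> D" "x' \<in> D"
    using assms by (auto simp: form_operator_def)
  then show ?thesis
    using q_commute[of x x'] cinner_commute[of x y'] by simp
qed

lemma form_operator_resolvent: "\<exists>f. (f, h - f) \<in> form_operator D q"
proof -
  obtain f where "f \<in> D" "\<forall>g\<in>D. cinner f g + q f g = cinner h g"
    using exists_resolvent by blast
  then have "(f, h - f) \<in> form_operator D q"
    by (auto simp: form_operator_def cinner_diff_left algebra_simps)
  then show ?thesis ..
qed

lemma nonnegative_form_operator: "nonnegative_op (form_operator D q)"
  unfolding nonnegative_op_def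
proof clarify
  fix x y assume "(x, y) \<in> form_operator D q"
  then have "cinner y x = q x x" "x \<in> D" by (auto simp: form_operator_def)
  then show "cinner y x \<in> \<real> \<and> 0 \<le> Re (cinner y x)"
    using q_nonneg q_self by (metis Reals_of_real)
qed

lemma q_zero_left: "g \<in> D \<Longrightarrow> q 0 g = 0"
  using q_add_left[OF zero_mem zero_mem, of g] by simp

lemma form_operator_zero: "(0, 0) \<in> form_operator D q"
  by (auto simp: form_operator_def zero_mem q_zero_left)

lemma form_operator_add:
  assumes "(x, y) \<in> form_operator D q" "(x', y') \<in> form_operator D q"
  shows "(x + x', y + y') \<in> form_operator D q"
  using assms by (auto simp: form_operator_def add_mem q_add_left cinner_add_left)

lemma form_operator_scaleC:
  assumes "(x, y) \<in> form_operator D q"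
  shows "(c *\<^sub>C x, c *\<^sub>C y) \<in> form_operator D q"
  using assms by (auto simp: form_operator_def scaleC_mem q_scaleC_left cinner_scaleC_left)

text \<open>
  Let \<open>x\<close> be orthogonal to the domain and \<open>f\<close> solve \<open>(A + 1) f = x\<close>. Then \<open>0 = \<langle>x, f\<rangle> =
  \<parallel>f\<parallel>\<^sup>2 + q f f\<close> forces \<open>f = 0\<close>, so that \<open>x\<close> is orthogonal to the whole form domain.
\<close>

lemma dense_Domain_form_operator:
  assumes dense: "closure D = UNIV"
  shows "closure (Domain (form_operator D q)) = UNIV"
proof (rule dense_if_orthogonal_zero)
  show "0 \<in> Domain (form_operator D q)"
    using form_operator_zero by blast
  show "x + y \<in> Domain (form_operator D q)"
    if "x \<in> Domain (form_operator D q)" "y \<in> Domain (form_operator D q)" for x y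
    using that form_operator_add by blast
  show "c *\<^sub>C x \<in> Domain (form_operator D q)" if "x \<in> Domain (form_operator D q)" for c x
    using that form_operator_scaleC by blast
  fix x assume orth: "\<And>m. m \<in> Domain (form_operator D q) \<Longrightarrow> cinner x m = 0"
  obtain f where f: "(f, x - f) \<in> form_operator D q"
    using form_operator_resolvent by blast
  then have fD: "f \<in> D" and "q f f = cinner (x - f) f" by (auto simp: form_operator_def)
  moreover have "cinner x f = 0" using orth f by blast
  ultimately have "(norm f)\<^sup>2 \<le> 0"
    using q_nonneg[of f] by (simp add: cinner_diff_left cinner_self)
  then have "f = 0" by simp
  then have "cinner x g = 0" if "g \<in> D" for g
  proof -
    have "q f g = cinner (x - f) g"
      using f that unfolding form_operator_def by blast
    then show ?thesis using that \<open>f = 0\<close> q_zero_left by simp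
  qed
  then show "x = 0" by (rule orthogonal_dense_zero[OF dense])
qed

text \<open>
  A symmetric operator \<open>A\<close> for which \<open>A + 1\<close> is onto is self-adjoint: if \<open>(y, z)\<close> belongs to the
  adjoint and \<open>f\<close> solves \<open>(A + 1) f = y + z\<close>, then \<open>y - f\<close> is orthogonal to the range of \<open>A + 1\<close>.
\<close>

theorem self_adjoint_form_operator:
  assumes dense: "closure D = UNIV"
  shows "self_adjoint_op (form_operator D q)"
  unfolding self_adjoint_op_def
proof (intro conjI equalityI)
  have "single_valued (form_operator D q)"
  proof (rule single_valuedI)
    fix x y z assume "(x, y) \<in> form_operator D q" "(x, z) \<in> form_operator D q"
    then have "q x g = cinner y g" "q x g = cinner z g" if "g \<in> D" for g
      using that unfolding form_operator_def by blast+
    then have "\<And>g. g \<in> D \<Longrightarrow> cinner (y - z) g = 0"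
      by (metis cinner_diff_left right_minus_eq)
    then show "y = z" using orthogonal_dense_zero[OF dense] by fastforce
  qed
  then show "is_operator (form_operator D q)"
    unfolding is_operator_def
    using form_operator_zero form_operator_add form_operator_scaleC by auto
  show "densely_defined (form_operator D q)"
    using dense_Domain_form_operator[OF dense] by (simp add: densely_defined_def)
  show "form_operator D q \<subseteq> adjoint_op (form_operator D q)"
    unfolding adjoint_op_def using form_operator_symmetric by blast
  show "adjoint_op (form_operator D q) \<subseteq> form_operator D q"
  proof clarify
    fix y z assume yz: "(y, z) \<in> adjoint_op (form_operator D q)"
    obtain f where f: "(f, (y + z) - f) \<in> form_operator D q"
      using form_operator_resolvent by blast
    have "cinner k (y - f) = 0" for k
    proof -
      obtain x where x: "(x, k - x) \<in> form_operator D q"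
        using form_operator_resolvent by blast
      have "cinner (k - x) y = cinner x z"
        using yz x by (auto simp: adjoint_op_def)
      moreover have "cinner (k - x) f = cinner x ((y + z) - f)"
        using form_operator_symmetric[OF x f] .
      ultimately show ?thesis
        by (simp add: cinner_diff_left cinner_diff_right cinner_add_right algebra_simps)
    qed
    from this[of "y - f"] have "y = f" by (simp add: cinner_self)
    then show "(y, z) \<in> form_operator D q" using f by simp
  qed
qed

section \<open>Closures in the form norm and the Friedrichs extension\<close>

text \<open>
  Approximation is measured by the square of the form norm, which describes the same closure and
  keeps square roots out of the estimates.
\<close>

definition form_norm_closure :: "'a set \<Rightarrow> 'a set" where
  "form_norm_closure C =
     {h\<in>D. \<forall>e>0. \<exists>c\<in>C. (norm (h - c))\<^sup>2 + Re (q (h - c) (h - c)) < e}"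

lemma form_norm_closureD:
  assumes "h \<in> form_norm_closure C" and "e > 0"
  obtains c where "c \<in> C" and "(norm (h - c))\<^sup>2 + Re (q (h - c) (h - c)) < e"
  using assms unfolding form_norm_closure_def by blast

lemma form_converges_mono:
  assumes "C \<subseteq> D" and "form_converges C q X h"
  shows "form_converges D q X h"
  using assms by (auto simp: form_converges_def)

lemma form_norm_closure_sequence:
  assumes "C \<subseteq> D" and "h \<in> form_norm_closure C"
  shows "\<exists>X. form_converges C q X h"
proof -
  have hD: "h \<in> D" using assms by (simp add: form_norm_closure_def)
  obtain \<delta> :: "nat \<Rightarrow> real" where \<delta>: "\<And>n. \<delta> n > 0" and lim: "\<delta> \<longlonglongrightarrow> 0"
    using LIMSEQ_inverse_real_of_nat by (metis inverse_positive_iff_positive of_nat_0_less_iff zero_less_Suc)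
  have "\<exists>c\<in>C. (norm (h - c))\<^sup>2 + Re (q (h - c) (h - c)) < \<delta> n" for n
    using assms \<delta> by (simp add: form_norm_closure_def)
  then obtain X where X: "\<And>n. X n \<in> C"
    and lt: "\<And>n. (norm (h - X n))\<^sup>2 + Re (q (h - X n) (h - X n)) < \<delta> n"
    by metis
  have XD: "X n \<in> D" for n using X assms by blast
  have qlt: "0 \<le> Re (q (h - X n) (h - X n))" for n
    using hD XD diff_mem q_nonneg by blast
  have "(norm (h - X n))\<^sup>2 \<le> \<delta> n" for n
    using lt[of n] qlt[of n] by linarith
  then have "(\<lambda>n. (norm (h - X n))\<^sup>2) \<longlonglongrightarrow> 0"
    by (intro real_tendsto_sandwich[OF _ _ tendsto_const lim]) auto
  then have "(\<lambda>n. sqrt ((norm (h - X n))\<^sup>2)) \<longlonglongrightarrow> sqrt 0"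
    by (rule tendsto_real_sqrt)
  then have "(\<lambda>n. h - X n) \<longlonglongrightarrow> 0"
    by (simp add: tendsto_norm_zero_iff)
  then have "(\<lambda>n. h - (h - X n)) \<longlonglongrightarrow> h - 0"
    by (intro tendsto_intros)
  then have 1: "X \<longlonglongrightarrow> h" by simp
  have 2: "\<exists>N. \<forall>m\<ge>N. \<forall>n\<ge>N. cmod (q (X m - X n) (X m - X n)) < e" if e: "e > 0" for e
  proof -
    obtain N where N: "\<And>n. n \<ge> N \<Longrightarrow> \<delta> n < e / 4"
      using order_tendstoD(2)[OF lim, of "e / 4"] e by (auto simp: eventually_sequentially)
    have "cmod (q (X m - X n) (X m - X n)) < e" if "m \<ge> N" "n \<ge> N" for m n
    proof -
      have sm: "Re (q (h - X m) (h - X m)) < e / 4" "Re (q (h - X n) (h - X n)) < e / 4"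
        using lt[of m] lt[of n] N[OF that(1)] N[OF that(2)] zero_le_power2[of "norm (h - X m)"]
          zero_le_power2[of "norm (h - X n)"] by linarith+
      have "h - X m \<in> D" "h - X n \<in> D" using hD XD diff_mem by auto
      moreover have "X m - X n = (h - X n) - (h - X m)" by simp
      ultimately have "Re (q (X m - X n) (X m - X n)) \<le>
           2 * Re (q (h - X n) (h - X n)) + 2 * Re (q (h - X m) (h - X m))"
        using q_parallelogram[of "h - X n" "h - X m"] q_nonneg[of "(h - X n) + (h - X m)"]
        by (metis add_mem add_increasing order_refl)
      moreover have "cmod (q (X m - X n) (X m - X n)) = Re (q (X m - X n) (X m - X n))"
        using q_self[of "X m - X n"] q_nonneg[of "X m - X n"] XD diff_mem
        by (metis norm_of_real abs_of_nonneg)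
      ultimately show ?thesis using sm by linarith
    qed
    then show ?thesis by blast
  qed
  show ?thesis using X 1 2 by (auto simp: form_converges_def)
qed

lemma form_converges_norm_tendsto:
  assumes "form_converges D q X h"
  shows "(\<lambda>n. (norm (h - X n))\<^sup>2 + Re (q (h - X n) (h - X n))) \<longlonglongrightarrow> 0"
proof -
  have X: "\<And>n. X n \<in> D" "h \<in> D" "X \<longlonglongrightarrow> h"
    using assms closed by (auto simp: form_converges_def)
  have "(\<lambda>n. h - X n) \<longlonglongrightarrow> h - h" using X by (intro tendsto_intros)
  then have "(\<lambda>n. (norm (h - X n))\<^sup>2) \<longlonglongrightarrow> (norm (0::'a))\<^sup>2"
    by (intro tendsto_intros) simp
  moreover have "Re (q (h - X n) (h - X n)) = Re (q (X n - h) (X n - h))" for n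
    using X by (simp add: q_diff_left q_diff_right diff_mem)
  then have "(\<lambda>n. Re (q (h - X n) (h - X n))) \<longlonglongrightarrow> 0"
    using closed assms by simp
  ultimately show ?thesis using tendsto_add by fastforce
qed

lemma form_norm_closure_limit:
  assumes "C \<subseteq> D" and "form_converges (form_norm_closure C) q X h"
  shows "h \<in> form_norm_closure C"
proof -
  have sub: "form_norm_closure C \<subseteq> D" by (auto simp: form_norm_closure_def)
  have conv: "form_converges D q X h" using form_converges_mono[OF sub assms(2)] .
  then have hD: "h \<in> D" using closed by blast
  have XC: "X n \<in> form_norm_closure C" for n using assms(2) by (simp add: form_converges_def)
  have "\<exists>c\<in>C. (norm (h - c))\<^sup>2 + Re (q (h - c) (h - c)) < e" if e: "e > 0" for e
  proof -
    have "\<forall>\<^sub>F n in sequentially. (norm (h - X n))\<^sup>2 + Re (q (h - X n) (h - X n)) < e / 4"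
      using order_tendstoD(2)[OF form_converges_norm_tendsto[OF conv], of "e / 4"] e by simp
    then obtain n where n: "(norm (h - X n))\<^sup>2 + Re (q (h - X n) (h - X n)) < e / 4"
      using eventually_happens trivial_limit_sequentially by blast
    obtain c where c: "c \<in> C" "(norm (X n - c))\<^sup>2 + Re (q (X n - c) (X n - c)) < e / 4"
      using form_norm_closureD[OF XC[of n], of "e / 4"] e by auto
    have "X n \<in> D" "c \<in> D" using XC sub c assms by auto
    moreover have "(norm (h - c))\<^sup>2 \<le> 2 * (norm (h - X n))\<^sup>2 + 2 * (norm (X n - c))\<^sup>2"
      using nonneg_form.q_triangle[OF nonneg_form_cinner, of h "X n" c]
      by (simp add: cinner_self)
    ultimately show ?thesis
      using q_triangle[of h "X n" c] hD n c by (intro bexI[of _ c]) auto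
  qed
  then show ?thesis using hD by (simp add: form_norm_closure_def)
qed

context
  fixes C
  assumes C_sub: "C \<subseteq> D" and C_zero: "0 \<in> C"
    and C_add: "\<And>x y. x \<in> C \<Longrightarrow> y \<in> C \<Longrightarrow> x + y \<in> C"
    and C_scale: "\<And>c x. x \<in> C \<Longrightarrow> c *\<^sub>C x \<in> C"
begin

lemma C_diff: "x \<in> C \<Longrightarrow> y \<in> C \<Longrightarrow> x - y \<in> C"
  using C_add[of x "- y"] C_scale[of y "-1"] by (simp add: uminus_eq_scaleC[symmetric])

lemma subset_form_norm_closure: "C \<subseteq> form_norm_closure C"
proof
  fix x assume "x \<in> C"
  then show "x \<in> form_norm_closure C"
    using C_sub q_zero_left[OF zero_mem] by (auto simp: form_norm_closure_def intro!: bexI[of _ x])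
qed

lemma closed_form_form_norm_closure: "closed_form (form_norm_closure C) q"
proof -
  have sub: "form_norm_closure C \<subseteq> D" by (auto simp: form_norm_closure_def)
  have lim: "h \<in> form_norm_closure C" if "form_converges C q X h" for X h
    using form_norm_closure_limit[OF C_sub] that subset_form_norm_closure
    by (auto simp: form_converges_def)
  have add: "x + y \<in> form_norm_closure C"
    if xy: "x \<in> form_norm_closure C" "y \<in> form_norm_closure C" for x y
  proof -
    have xyD: "x \<in> D" "y \<in> D" using sub xy by auto
    have "\<exists>c\<in>C. (norm (x + y - c))\<^sup>2 + Re (q (x + y - c) (x + y - c)) < e" if e: "e > 0" for e
    proof -
      obtain c d where c: "c \<in> C" "(norm (x - c))\<^sup>2 + Re (q (x - c) (x - c)) < e / 4"
        and d: "d \<in> C" "(norm (y - d))\<^sup>2 + Re (q (y - d) (y - d)) < e / 4"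
        using form_norm_closureD[OF xy(1), of "e / 4"] form_norm_closureD[OF xy(2), of "e / 4"] e
        by (metis divide_pos_pos zero_less_numeral)
      have D: "x - c \<in> D" "y - d \<in> D" using xyD c d C_sub diff_mem by auto
      have eq: "x + y - (c + d) = (x - c) + (y - d)" by simp
      have "(norm (x + y - (c + d)))\<^sup>2 \<le> 2 * (norm (x - c))\<^sup>2 + 2 * (norm (y - d))\<^sup>2"
        using nonneg_form.q_parallelogram[OF nonneg_form_cinner UNIV_I UNIV_I, of "x - c" "y - d"]
          zero_le_power2[of "norm ((x - c) - (y - d))"]
        unfolding eq cinner_self Re_complex_of_real by linarith
      moreover have "Re (q (x + y - (c + d)) (x + y - (c + d)))
          \<le> 2 * Re (q (x - c) (x - c)) + 2 * Re (q (y - d) (y - d))"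
        using q_parallelogram[OF D] q_nonneg[OF diff_mem[OF D]] unfolding eq by linarith
      ultimately show ?thesis
        using c d C_add by (intro bexI[of _ "c + d"]) auto
    qed
    then show ?thesis using xyD add_mem by (simp add: form_norm_closure_def)
  qed
  have scale: "c *\<^sub>C x \<in> form_norm_closure C" if x: "x \<in> form_norm_closure C" for c x
  proof -
    have xD: "x \<in> D" using sub x by auto
    have "\<exists>d\<in>C. (norm (c *\<^sub>C x - d))\<^sup>2 + Re (q (c *\<^sub>C x - d) (c *\<^sub>C x - d)) < e" if e: "e > 0" for e
    proof -
      define k where "k = (cmod c)\<^sup>2 + 1"
      have k: "k > 0" by (simp add: k_def add_nonneg_pos)
      then obtain d where d: "d \<in> C" "(norm (x - d))\<^sup>2 + Re (q (x - d) (x - d)) < e / k"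
        using form_norm_closureD[OF x, of "e / k"] e by auto
      have D: "x - d \<in> D" using xD d C_sub diff_mem by auto
      have eq: "c *\<^sub>C x - c *\<^sub>C d = c *\<^sub>C (x - d)"
        using scaleC_add_right[of c "x - d" d] by (simp add: algebra_simps)
      have "q (c *\<^sub>C (x - d)) (c *\<^sub>C (x - d)) = of_real ((cmod c)\<^sup>2) * q (x - d) (x - d)"
        unfolding complex_norm_square
        using D by (simp add: q_scaleC_left q_scaleC_right scaleC_mem)
      then have "(norm (c *\<^sub>C x - c *\<^sub>C d))\<^sup>2 + Re (q (c *\<^sub>C x - c *\<^sub>C d) (c *\<^sub>C x - c *\<^sub>C d))
          = (cmod c)\<^sup>2 * ((norm (x - d))\<^sup>2 + Re (q (x - d) (x - d)))"
        unfolding eq by (simp add: norm_scaleC power_mult_distrib distrib_left flip: of_real_power)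
      also have "\<dots> \<le> k * ((norm (x - d))\<^sup>2 + Re (q (x - d) (x - d)))"
        using q_nonneg[OF D] by (intro mult_right_mono) (auto simp: k_def)
      also have "\<dots> < e" using d k by (simp add: field_simps)
      finally show ?thesis using d C_scale by blast
    qed
    then show ?thesis using xD scaleC_mem by (simp add: form_norm_closure_def)
  qed
  show ?thesis
  proof
    show "0 \<in> form_norm_closure C" using C_zero subset_form_norm_closure by blast
    show "h \<in> form_norm_closure C \<and> (\<lambda>n. Re (q (X n - h) (X n - h))) \<longlonglongrightarrow> 0"
      if "form_converges (form_norm_closure C) q X h" for X h
      using form_norm_closure_limit[OF C_sub that] closed[OF form_converges_mono[OF sub that]]
      by blast
    fix x y z c
    assume x: "x \<in> form_norm_closure C"
    then have xD: "x \<in> D" using sub by blast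
    show "c *\<^sub>C x \<in> form_norm_closure C" using x by (rule scale)
    show "0 \<le> Re (q x x)" using xD by (rule q_nonneg)
    assume y: "y \<in> form_norm_closure C"
    then have yD: "y \<in> D" using sub by blast
    show "x + y \<in> form_norm_closure C" using x y by (rule add)
    show "q (c *\<^sub>C x) y = c * q x y" using xD yD by (rule q_scaleC_left)
    show "q x y = cnj (q y x)" using xD yD by (rule q_commute)
    assume "z \<in> form_norm_closure C"
    then show "q (x + y) z = q x z + q y z" using xD yD sub by (intro q_add_left) auto
  qed
qed

lemma form_closure_dom_eq: "form_closure_dom C q = form_norm_closure C"
proof (intro equalityI subsetI)
  fix h assume "h \<in> form_norm_closure C"
  then show "h \<in> form_closure_dom C q"
    using form_norm_closure_sequence[OF C_sub] by (simp add: form_closure_dom_def)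
next
  fix h assume "h \<in> form_closure_dom C q"
  then obtain X where "form_converges C q X h" by (auto simp: form_closure_dom_def)
  then have "form_converges (form_norm_closure C) q X h"
    using subset_form_norm_closure by (auto simp: form_converges_def)
  then show "h \<in> form_norm_closure C" by (rule form_norm_closure_limit[OF C_sub])
qed

text \<open>
  The definite description in \<open>form_closure\<close> ranges over approximating sequences. They exist for
  both arguments, and by closedness of \<open>q\<close> every choice of them leads to the limit \<open>q h g\<close>.
\<close>

lemma form_closure_eq:
  assumes h: "h \<in> form_norm_closure C" and g: "g \<in> form_norm_closure C"
  shows "form_closure C q h g = q h g"
  unfolding form_closure_def
proof (rule the_equality)
  show lim: "\<forall>X Y. form_converges C q X h \<longrightarrow> form_converges C q Y g \<longrightarrow>
      (\<lambda>n. q (X n) (Y n)) \<longlonglongrightarrow> q h g"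
  proof (intro allI impI)
    fix X Y assume "form_converges C q X h" "form_converges C q Y g"
    then have X: "form_converges D q X h" and Y: "form_converges D q Y g"
      using form_converges_mono[OF C_sub] by auto
    show "(\<lambda>n. q (X n) (Y n)) \<longlonglongrightarrow> q h g"
      using X Y closed[OF X] closed[OF Y] by (intro q_tendsto) (auto simp: form_converges_def)
  qed
  fix l assume l: "\<forall>X Y. form_converges C q X h \<longrightarrow> form_converges C q Y g \<longrightarrow>
      (\<lambda>n. q (X n) (Y n)) \<longlonglongrightarrow> l"
  obtain X Y where "form_converges C q X h" "form_converges C q Y g"
    using form_norm_closure_sequence[OF C_sub] h g by blast
  then show "l = q h g" using l lim LIMSEQ_unique by blast
qed

end

end

context closed_form
begin

text \<open>
  An operator that is contained in the operator of a closed form \<open>q\<close> has \<open>q\<close>, restricted to its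
  domain, as its own form \<open>(x, y) \<mapsto> \<langle>S x, y\<rangle>\<close>; its Friedrichs extension is therefore the operator
  of \<open>q\<close> on the closure of this domain in the form norm.
\<close>

theorem friedrichs_extension_of_restriction:
  assumes S: "is_operator S" "densely_defined S" "S \<subseteq> form_operator D q"
  shows "is_friedrichs_extension S (form_operator (form_norm_closure (Domain S)) q)"
proof -
  let ?C = "Domain S"
  let ?p = "\<lambda>x y. cinner (op_apply S x) y"
  have sub: "?C \<subseteq> D" using S(3) by (auto simp: form_operator_def)
  have zero: "0 \<in> ?C" using S(1) unfolding is_operator_def by blast
  have add: "x + y \<in> ?C" if "x \<in> ?C" "y \<in> ?C" for x y
    using S(1) that unfolding is_operator_def by blast
  have scale: "c *\<^sub>C x \<in> ?C" if "x \<in> ?C" for c x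
    using S(1) that unfolding is_operator_def by blast
  have p: "?p x y = q x y" if x: "x \<in> ?C" and y: "y \<in> D" for x y
  proof -
    obtain z where z: "(x, z) \<in> S" using x by blast
    then have "op_apply S x = z"
      using S(1) unfolding op_apply_def is_operator_def
      by (intro the_equality) (auto dest: single_valuedD)
    moreover have "(x, z) \<in> form_operator D q" using z S(3) by blast
    ultimately show ?thesis using y unfolding form_operator_def by simp
  qed
  have conv: "form_converges ?C ?p X h \<longleftrightarrow> form_converges ?C q X h" for X h
  proof -
    have "?p (X m - X n) (X m - X n) = q (X m - X n) (X m - X n)" if "\<And>n. X n \<in> ?C" for m n
      using C_diff[OF sub zero add scale that that] sub by (intro p) blast+
    then show ?thesis unfolding form_converges_def by metis
  qed
  have dom: "form_closure_dom ?C ?p = form_norm_closure ?C"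
    using form_closure_dom_eq[OF sub zero add scale] by (simp add: form_closure_dom_def conv)
  have "form_closure ?C ?p h g = form_closure ?C q h g" for h g
  proof -
    have "(\<lambda>n. ?p (X n) (Y n)) = (\<lambda>n. q (X n) (Y n))"
      if "form_converges ?C q X h" "form_converges ?C q Y g" for X Y
    proof
      fix n
      have "X n \<in> ?C" "Y n \<in> ?C" using that unfolding form_converges_def by auto
      then show "?p (X n) (Y n) = q (X n) (Y n)" using sub by (intro p) blast+
    qed
    then have "(\<forall>X Y. form_converges ?C ?p X h \<longrightarrow> form_converges ?C ?p Y g \<longrightarrow>
          (\<lambda>n. ?p (X n) (Y n)) \<longlonglongrightarrow> l) \<longleftrightarrow>
        (\<forall>X Y. form_converges ?C q X h \<longrightarrow> form_converges ?C q Y g \<longrightarrow>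
          (\<lambda>n. q (X n) (Y n)) \<longlonglongrightarrow> l)" for l
      unfolding conv by metis
    then show ?thesis unfolding form_closure_def by presburger
  qed
  then have vals: "form_closure ?C ?p h g = q h g"
    if "h \<in> form_norm_closure ?C" "g \<in> form_norm_closure ?C" for h g
    using form_closure_eq[OF sub zero add scale that] by simp
  have "form_operator (form_closure_dom ?C ?p) (form_closure ?C ?p) =
      form_operator (form_norm_closure ?C) q"
    unfolding form_operator_def dom by (auto simp: vals)
  moreover have "symmetric_op S"
    unfolding symmetric_op_def using form_operator_symmetric S(3) by blast
  moreover have "nonnegative_op S"
    using nonnegative_form_operator S(3) unfolding nonnegative_op_def by blast
  ultimately show ?thesis
    unfolding is_friedrichs_extension_def Let_def using S(1,2) by metis
qed

end

section \<open>Completeness of the space of square-integrable functions\<close>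

lemma l2_rel_refl: "l2_rel f f \<longleftrightarrow> square_integrable f"
  by (simp add: l2_rel_def)

lemma square_integrable_rep [simp]: "square_integrable (rep_l2 u)"
  using Quotient3_rep_reflp[OF Quotient3_l2, of u] by (simp add: l2_rel_refl)

lemma abs_rep_l2 [simp]: "abs_l2 (rep_l2 u) = u"
  using Quotient3_abs_rep[OF Quotient3_l2] .

lemma abs_l2_eqI:
  assumes "square_integrable f" "square_integrable g" "AE x in quadrant_measure. f x = g x"
  shows "abs_l2 f = abs_l2 g"
  using Quotient3_rel_abs[OF Quotient3_l2, of f g] assms by (simp add: l2_rel_def)

lemma cinner_abs_l2:
  assumes "square_integrable f" "square_integrable g"
  shows "cinner (abs_l2 f) (abs_l2 g) = (\<integral>x. f x * cnj (g x) \<partial>quadrant_measure)"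
  using assms cinner_l2.abs_eq[of f g] by (simp add: l2_rel_refl)

lemma cinner_rep_l2: "cinner u v = (\<integral>x. rep_l2 u x * cnj (rep_l2 v x) \<partial>quadrant_measure)"
  using cinner_abs_l2[of "rep_l2 u" "rep_l2 v"] by simp

lemma abs_l2_add:
  assumes "square_integrable f" "square_integrable g"
  shows "abs_l2 f + abs_l2 g = abs_l2 (\<lambda>x. f x + g x)"
  using assms plus_l2.abs_eq[of f g] by (simp add: l2_rel_refl)

lemma abs_l2_scaleC:
  assumes "square_integrable f"
  shows "c *\<^sub>C abs_l2 f = abs_l2 (\<lambda>x. c * f x)"
  using assms scaleC_l2.abs_eq[of f] by (simp add: l2_rel_refl)

lemma square_integrable_diff:
  assumes "square_integrable f" "square_integrable g"
  shows "square_integrable (\<lambda>x. f x - g x)"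
  using square_integrable_add[OF assms(1) square_integrable_scaleC[OF assms(2), of "-1"]] by simp

lemma abs_l2_diff:
  assumes "square_integrable f" "square_integrable g"
  shows "abs_l2 f - abs_l2 g = abs_l2 (\<lambda>x. f x - g x)"
  unfolding minus_l2_def uminus_l2_def
  using assms square_integrable_scaleC[OF assms(2), of "-1"]
  by (simp add: abs_l2_scaleC abs_l2_add)

lemma square_integrable_measurable [measurable_dest]:
  "square_integrable f \<Longrightarrow> f \<in> borel_measurable quadrant_measure"
  by (simp add: square_integrable_def)

lemma square_integrable_iff_nn:
  "square_integrable f \<longleftrightarrow> f \<in> borel_measurable quadrant_measure \<and>
     (\<integral>\<^sup>+x. ennreal ((cmod (f x))\<^sup>2) \<partial>quadrant_measure) < \<infinity>"
  unfolding square_integrable_def by (auto simp: integrable_iff_bounded)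

lemma norm_abs_l2:
  assumes "square_integrable f"
  shows "(\<integral>\<^sup>+x. ennreal ((cmod (f x))\<^sup>2) \<partial>quadrant_measure) = ennreal ((norm (abs_l2 f))\<^sup>2)"
proof -
  have "complex_of_real ((norm (abs_l2 f))\<^sup>2) =
      (\<integral>x. complex_of_real ((cmod (f x))\<^sup>2) \<partial>quadrant_measure)"
    using assms
    by (simp only: cinner_self[symmetric] cinner_abs_l2 complex_norm_square[symmetric])
  then have "(norm (abs_l2 f))\<^sup>2 = (\<integral>x. (cmod (f x))\<^sup>2 \<partial>quadrant_measure)"
    by (simp only: integral_complex_of_real of_real_eq_iff)
  then show ?thesis
    using assms by (simp add: nn_integral_eq_integral square_integrable_def)
qed

lemma norm_diff_abs_rep:
  assumes "square_integrable f"
  shows "(\<integral>\<^sup>+x. ennreal ((cmod (f x - rep_l2 u x))\<^sup>2) \<partial>quadrant_measure)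
    = ennreal ((norm (abs_l2 f - u))\<^sup>2)"
  using norm_abs_l2[OF square_integrable_diff[OF assms square_integrable_rep, of u]]
    abs_l2_diff[OF assms square_integrable_rep, of u] by simp

lemma Cauchy_rapid_subsequence:
  assumes "Cauchy (X :: nat \<Rightarrow> 'a::metric_space)"
  obtains r :: "nat \<Rightarrow> nat" where "\<And>n. n \<le> r n" "\<And>n. dist (X (r (Suc n))) (X (r n)) < (1/2) ^ n"
proof -
  have "\<exists>N. \<forall>m\<ge>N. \<forall>k\<ge>N. dist (X m) (X k) < (1/2) ^ n" for n
    using metric_CauchyD[OF assms, of "(1/2) ^ n"] by simp
  then obtain N where N: "\<And>n m k. m \<ge> N n \<Longrightarrow> k \<ge> N n \<Longrightarrow> dist (X m) (X k) < (1/2) ^ n"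
    by metis
  \<comment> \<open>The sum makes \<open>r\<close> monotone and at least \<open>N n\<close>, so that \<open>r n\<close> and \<open>r (Suc n)\<close> both lie
    beyond \<open>N n\<close>.\<close>
  define r where "r n = n + (\<Sum>i\<le>n. N i)" for n
  show ?thesis
  proof (rule that[of r])
    show "n \<le> r n" for n by (simp add: r_def)
    have "N n \<le> r n" for n unfolding r_def
      by (intro trans_le_add2 member_le_sum) auto
    moreover have "r n \<le> r (Suc n)" for n by (simp add: r_def)
    ultimately show "dist (X (r (Suc n))) (X (r n)) < (1/2) ^ n" for n
      using N le_trans by blast
  qed
qed

text \<open>
  The weights \<open>2\<^sup>n\<close> replace Minkowski's inequality: \<open>a \<le> (1/2)\<^sup>n + 2\<^sup>n a\<^sup>2\<close>, so that a square bound
  with a weight controls the sum of the increments.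
\<close>

lemma summable_if_weighted_squares:
  fixes a :: "nat \<Rightarrow> real"
  assumes "\<And>n. a n \<ge> 0" and "summable (\<lambda>n. 2 ^ n * (a n)\<^sup>2)"
  shows "summable a"
proof (rule summable_comparison_test')
  show "summable (\<lambda>n. (1/2) ^ n + 2 ^ n * (a n)\<^sup>2)"
    using assms(2) by (intro summable_add) (auto intro: summable_geometric)
  show "norm (a n) \<le> (1/2) ^ n + 2 ^ n * (a n)\<^sup>2" for n
  proof (cases "a n \<le> (1/2) ^ n")
    case True
    then show ?thesis using assms(1)[of n] by (simp add: add_increasing2)
  next
    case False
    then have "1 \<le> 2 ^ n * a n" by (simp add: power_one_over field_simps)
    then have "a n * 1 \<le> a n * (2 ^ n * a n)" using assms(1)[of n] by (intro mult_left_mono)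
    then have "a n \<le> 2 ^ n * (a n)\<^sup>2" by (simp add: power2_eq_square ac_simps)
    then show ?thesis using assms(1)[of n] by (simp add: add_increasing)
  qed
qed

text \<open>
  Riesz-Fischer: a rapidly convergent subsequence converges almost everywhere, and Fatou's lemma
  turns the pointwise limit into a limit of the whole sequence in the norm.
\<close>

lemma l2_Cauchy_convergent:
  fixes X :: "nat \<Rightarrow> l2"
  assumes "Cauchy X"
  shows "convergent X"
proof -
  let ?M = quadrant_measure
  obtain r where r: "\<And>n. n \<le> r n" "\<And>n. dist (X (r (Suc n))) (X (r n)) < (1/2) ^ n"
    using Cauchy_rapid_subsequence[OF assms] by blast
  define u where "u n = rep_l2 (X (r n))" for n
  have [measurable]: "u n \<in> borel_measurable ?M" for n
    using square_integrable_rep by (simp add: u_def square_integrable_measurable)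
  define v where "v x = lim (\<lambda>n. u n x)" for x
  have [measurable]: "v \<in> borel_measurable ?M"
    unfolding v_def by measurable
  have sq: "(\<integral>\<^sup>+x. ennreal ((cmod (u (Suc n) x - u n x))\<^sup>2) \<partial>?M) \<le> ennreal (((1/2) ^ n)\<^sup>2)" for n
    unfolding u_def norm_diff_abs_rep[OF square_integrable_rep] abs_rep_l2
    using r(2)[of n] by (intro ennreal_leI power_mono) (auto simp: dist_norm less_imp_le)
  have "(\<integral>\<^sup>+x. (\<Sum>n. ennreal (2 ^ n * (cmod (u (Suc n) x - u n x))\<^sup>2)) \<partial>?M)
      = (\<Sum>n. \<integral>\<^sup>+x. ennreal (2 ^ n * (cmod (u (Suc n) x - u n x))\<^sup>2) \<partial>?M)"
    by (rule nn_integral_suminf) measurable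
  also have "\<dots> \<le> (\<Sum>n. ennreal ((1/2) ^ n))"
  proof (rule suminf_le)
    fix n
    have "(\<integral>\<^sup>+x. ennreal (2 ^ n * (cmod (u (Suc n) x - u n x))\<^sup>2) \<partial>?M)
        = ennreal (2 ^ n) * (\<integral>\<^sup>+x. ennreal ((cmod (u (Suc n) x - u n x))\<^sup>2) \<partial>?M)"
      by (subst nn_integral_cmult[symmetric]) (auto simp: ennreal_mult)
    also have "\<dots> \<le> ennreal (2 ^ n) * ennreal (((1/2) ^ n)\<^sup>2)"
      by (intro mult_left_mono sq) simp
    also have "\<dots> = ennreal ((1/2) ^ n)"
      by (simp add: ennreal_mult[symmetric] power2_eq_square power_one_over field_simps)
    finally show "(\<integral>\<^sup>+x. ennreal (2 ^ n * (cmod (u (Suc n) x - u n x))\<^sup>2) \<partial>?M)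
        \<le> ennreal ((1/2) ^ n)" .
  qed auto
  also have "\<dots> < \<infinity>"
    by (subst suminf_ennreal2) (auto intro: summable_geometric)
  finally have "AE x in ?M. (\<Sum>n. ennreal (2 ^ n * (cmod (u (Suc n) x - u n x))\<^sup>2)) \<noteq> \<infinity>"
    by (intro nn_integral_PInf_AE) auto
  then have lim: "AE x in ?M. (\<lambda>n. u n x) \<longlonglongrightarrow> v x"
  proof eventually_elim
    case (elim x)
    then have "summable (\<lambda>n. 2 ^ n * (cmod (u (Suc n) x - u n x))\<^sup>2)"
      by (intro summable_suminf_not_top) auto
    then have "summable (\<lambda>n. cmod (u (Suc n) x - u n x))"
      by (rule summable_if_weighted_squares[rotated]) simp
    then have "summable (\<lambda>n. u (Suc n) x - u n x)"
      by (rule summable_norm_cancel)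
    then have "convergent (\<lambda>n. \<Sum>i<n. u (Suc i) x - u i x)"
      by (simp add: summable_iff_convergent)
    then have "convergent (\<lambda>n. u n x - u 0 x)"
      by (simp only: sum_lessThan_telescope[of "\<lambda>n. u n x"])
    then have "convergent (\<lambda>n. (u n x - u 0 x) + u 0 x)"
      by (intro convergent_add convergent_const)
    then show ?case
      by (simp add: v_def convergent_LIMSEQ_iff)
  qed
  have fatou: "(\<integral>\<^sup>+x. ennreal ((cmod (v x - rep_l2 (X n) x))\<^sup>2) \<partial>?M) \<le> ennreal (e\<^sup>2)"
    if N: "\<And>m k. m \<ge> N \<Longrightarrow> k \<ge> N \<Longrightarrow> dist (X m) (X k) < e" and n: "n \<ge> N" for n N e
  proof -
    have [measurable]: "rep_l2 (X n) \<in> borel_measurable ?M"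
      by (simp add: square_integrable_measurable)
    have "(\<integral>\<^sup>+x. ennreal ((cmod (v x - rep_l2 (X n) x))\<^sup>2) \<partial>?M)
        = (\<integral>\<^sup>+x. liminf (\<lambda>k. ennreal ((cmod (u k x - rep_l2 (X n) x))\<^sup>2)) \<partial>?M)"
    proof (rule nn_integral_cong_AE, use lim in eventually_elim)
      case (elim x)
      then have "(\<lambda>k. ennreal ((cmod (u k x - rep_l2 (X n) x))\<^sup>2))
          \<longlonglongrightarrow> ennreal ((cmod (v x - rep_l2 (X n) x))\<^sup>2)"
        by (intro tendsto_ennrealI tendsto_intros)
      then show ?case by (rule lim_imp_Liminf[OF sequentially_bot, symmetric])
    qed
    also have "\<dots> \<le> liminf (\<lambda>k. \<integral>\<^sup>+x. ennreal ((cmod (u k x - rep_l2 (X n) x))\<^sup>2) \<partial>?M)"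
      by (rule nn_integral_liminf) measurable
    also have "\<dots> \<le> limsup (\<lambda>k. \<integral>\<^sup>+x. ennreal ((cmod (u k x - rep_l2 (X n) x))\<^sup>2) \<partial>?M)"
      by (rule Liminf_le_Limsup) simp
    also have "\<dots> \<le> ennreal (e\<^sup>2)"
    proof (rule Limsup_bounded)
      show "\<forall>\<^sub>F k in sequentially.
          (\<integral>\<^sup>+x. ennreal ((cmod (u k x - rep_l2 (X n) x))\<^sup>2) \<partial>?M) \<le> ennreal (e\<^sup>2)"
        using eventually_ge_at_top[of N]
      proof eventually_elim
        case (elim k)
        then have "dist (X (r k)) (X n) < e" using N n r(1)[of k] by auto
        then show ?case
          unfolding u_def norm_diff_abs_rep[OF square_integrable_rep] abs_rep_l2
          by (intro ennreal_leI power_mono) (auto simp: dist_norm)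
      qed
    qed
    finally show ?thesis .
  qed
  have v: "square_integrable v"
  proof -
    obtain N where N: "\<And>m k. m \<ge> N \<Longrightarrow> k \<ge> N \<Longrightarrow> dist (X m) (X k) < 1"
      using metric_CauchyD[OF assms, of 1] by auto
    have [measurable]: "rep_l2 (X N) \<in> borel_measurable ?M"
      by (simp add: square_integrable_measurable)
    have "(\<integral>\<^sup>+x. ennreal ((cmod (v x - rep_l2 (X N) x))\<^sup>2) \<partial>?M) < \<infinity>"
      by (rule order_le_less_trans[OF fatou[of N 1 N]]) (use N in auto)
    then have "square_integrable (\<lambda>x. v x - rep_l2 (X N) x)"
      by (simp add: square_integrable_iff_nn)
    from square_integrable_add[OF this square_integrable_rep[of "X N"]] show ?thesis by simp
  qed
  have "X \<longlonglongrightarrow> abs_l2 v"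
  proof (rule metric_LIMSEQ_I)
    fix e :: real assume e: "e > 0"
    then obtain N where N: "\<And>m k. m \<ge> N \<Longrightarrow> k \<ge> N \<Longrightarrow> dist (X m) (X k) < e / 2"
      using metric_CauchyD[OF assms, of "e / 2"] by auto
    have "dist (X n) (abs_l2 v) < e" if n: "n \<ge> N" for n
    proof -
      have "ennreal ((norm (abs_l2 v - X n))\<^sup>2) \<le> ennreal ((e / 2)\<^sup>2)"
        using fatou[OF N n] by (simp only: norm_diff_abs_rep[OF v])
      then have "(norm (abs_l2 v - X n))\<^sup>2 \<le> (e / 2)\<^sup>2"
        by (subst (asm) ennreal_le_iff) auto
      then have "norm (abs_l2 v - X n) \<le> e / 2"
        using e by (auto intro: power2_le_imp_le[rotated])
      then show ?thesis using e by (simp add: dist_norm norm_minus_commute)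
    qed
    then show "\<exists>N. \<forall>n\<ge>N. dist (X n) (abs_l2 v) < e" by blast
  qed
  then show ?thesis by (rule convergentI)
qed

instance l2 :: complete_space
  by standard (rule l2_Cauchy_convergent)

section \<open>Calculus of the classes \<open>C\<^sup>k\<close>\<close>

lemma Ck_SucI:
  assumes "continuous_on UNIV f"
    and r: "\<And>r s. ((\<lambda>t. f (t, s)) has_vector_derivative fr (r, s)) (at r)"
    and s: "\<And>r s. ((\<lambda>t. f (r, t)) has_vector_derivative fs (r, s)) (at s)"
    and "Ck k fr" "Ck k fs"
  shows "Ck (Suc k) f"
proof -
  have "(\<lambda>t. f (t, s)) differentiable (at r)" "(\<lambda>t. f (r, t)) differentiable (at s)" for r s
    using r[of s r] s[of r s] by (auto intro: differentiableI_vector)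
  moreover have "partial_r f = fr" "partial_s f = fs"
    using r s by (auto simp: partial_r_def partial_s_def fun_eq_iff vector_derivative_at)
  ultimately show ?thesis
    using assms(1,4,5) by simp
qed

lemma Ck_SucD:
  assumes "Ck (Suc k) f"
  shows "continuous_on UNIV f"
    and "((\<lambda>t. f (t, s)) has_vector_derivative partial_r f (r, s)) (at r)"
    and "((\<lambda>t. f (r, t)) has_vector_derivative partial_s f (r, s)) (at s)"
    and "Ck k (partial_r f)" and "Ck k (partial_s f)"
  using assms by (simp_all add: partial_r_def partial_s_def vector_derivative_works[symmetric])

lemma Ck_continuous: "Ck k f \<Longrightarrow> continuous_on UNIV f"
  by (cases k) auto

lemma Ck_Suc_imp_Ck: "Ck (Suc k) f \<Longrightarrow> Ck k f"
proof (induction k arbitrary: f)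
  case 0
  then show ?case using Ck_SucD(1) by (simp only: Ck.simps(1))
next
  case (Suc k)
  then show ?case
    using Ck.simps(2)[of "Suc k" f] Ck.simps(2)[of k f] by blast
qed

lemma Ck_const: "Ck k (\<lambda>x. c)"
proof (induction k arbitrary: c)
  case (Suc k)
  show ?case
    by (rule Ck_SucI[where fr = "\<lambda>x. 0" and fs = "\<lambda>x. 0"]) (use Suc in auto)
qed simp

lemma Ck_add: "Ck k f \<Longrightarrow> Ck k g \<Longrightarrow> Ck k (\<lambda>x. f x + g x)"
proof (induction k arbitrary: f g)
  case (Suc k)
  note f = Ck_SucD[OF Suc.prems(1)] and g = Ck_SucD[OF Suc.prems(2)]
  show ?case
    by (rule Ck_SucI[where fr = "\<lambda>x. partial_r f x + partial_r g x"
          and fs = "\<lambda>x. partial_s f x + partial_s g x"])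
      (intro continuous_intros derivative_intros Suc.IH f g)+
qed (simp add: continuous_on_add)

lemma Ck_mult: "Ck k f \<Longrightarrow> Ck k g \<Longrightarrow> Ck k (\<lambda>x. f x * g x)"
proof (induction k arbitrary: f g)
  case (Suc k)
  note f = Ck_SucD[OF Suc.prems(1)] and g = Ck_SucD[OF Suc.prems(2)]
  note f' = Ck_Suc_imp_Ck[OF Suc.prems(1)] and g' = Ck_Suc_imp_Ck[OF Suc.prems(2)]
  show ?case
  proof (rule Ck_SucI)
    show "continuous_on UNIV (\<lambda>x. f x * g x)" by (rule continuous_on_mult[OF f(1) g(1)])
    show "((\<lambda>t. f (t, s) * g (t, s)) has_vector_derivative
        f (r, s) * partial_r g (r, s) + partial_r f (r, s) * g (r, s)) (at r)" for r s
      by (rule has_vector_derivative_mult[OF f(2) g(2)])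
    show "((\<lambda>t. f (r, t) * g (r, t)) has_vector_derivative
        f (r, s) * partial_s g (r, s) + partial_s f (r, s) * g (r, s)) (at s)" for r s
      by (rule has_vector_derivative_mult[OF f(3) g(3)])
    show "Ck k (\<lambda>x. f x * partial_r g x + partial_r f x * g x)"
      by (rule Ck_add[OF Suc.IH[OF f' g(4)] Suc.IH[OF f(4) g']])
    show "Ck k (\<lambda>x. f x * partial_s g x + partial_s f x * g x)"
      by (rule Ck_add[OF Suc.IH[OF f' g(5)] Suc.IH[OF f(5) g']])
  qed
qed (simp add: continuous_on_mult)

lemma Ck_cnj: "Ck k f \<Longrightarrow> Ck k (\<lambda>x. cnj (f x))"
proof (induction k arbitrary: f)
  case 0
  then show ?case using continuous_on_cnj[of UNIV f] by (simp only: Ck.simps)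
next
  case (Suc k)
  note f = Ck_SucD[OF Suc.prems]
  show ?case
  proof (rule Ck_SucI)
    show "continuous_on UNIV (\<lambda>x. cnj (f x))" by (rule continuous_on_cnj[OF f(1)])
    show "((\<lambda>t. cnj (f (t, s))) has_vector_derivative cnj (partial_r f (r, s))) (at r)" for r s
      by (rule has_vector_derivative_cnj[OF f(2)])
    show "((\<lambda>t. cnj (f (r, t))) has_vector_derivative cnj (partial_s f (r, s))) (at s)" for r s
      by (rule has_vector_derivative_cnj[OF f(3)])
  qed (rule Suc.IH f)+
qed

text \<open>
  Exchanging the coordinates reduces division by \<open>s\<close> to division by \<open>r\<close>.
\<close>

lemma Ck_swap: "Ck k f \<Longrightarrow> Ck k (\<lambda>x. f (prod.swap x))"
proof (induction k arbitrary: f)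
  case 0
  then show ?case
    by (auto intro!: continuous_on_compose2[of UNIV f] continuous_on_swap)
next
  case (Suc k)
  note f = Ck_SucD[OF Suc.prems]
  have c: "continuous_on UNIV (\<lambda>x. f (prod.swap x))"
    by (rule continuous_on_compose2[OF f(1) continuous_on_swap]) simp
  show ?case
    by (rule Ck_SucI[where fr = "\<lambda>x. partial_s f (prod.swap x)"
          and fs = "\<lambda>x. partial_r f (prod.swap x)"])
      (use c f Suc.IH in simp_all)
qed

lemma Ck_coordinate_r: "Ck k (\<lambda>x. of_real (fst x))"
proof (cases k)
  case (Suc n)
  show ?thesis unfolding Suc
    by (rule Ck_SucI[where fr = "\<lambda>x. 1" and fs = "\<lambda>x. 0"])
      (auto intro!: continuous_intros Ck_const derivative_eq_intros)
qed (auto intro!: continuous_intros)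

lemma partial_zero_off_closed:
  assumes "closed K" "\<And>x. x \<notin> K \<Longrightarrow> f x = 0" "x \<notin> K"
  shows "partial_r f x = 0" "partial_s f x = 0"
proof -
  obtain r s where x: "x = (r, s)" by fastforce
  have op: "open {t. (t, s) \<notin> K}" "open {t. (r, t) \<notin> K}"
    using assms(1) by (auto intro!: open_Collect_neg closed_Collect_const continuous_closed_vimage
        simp: closed_vimage_Int) (auto intro!: closed_vimage continuous_intros simp: vimage_def[symmetric])
  have "((\<lambda>t. f (t, s)) has_vector_derivative 0) (at r)"
    by (rule has_vector_derivative_transform_within_open[OF has_vector_derivative_const op(1)])
      (use assms x in auto)
  then show "partial_r f x = 0" by (simp add: partial_r_def x vector_derivative_at)
  have "((\<lambda>t. f (r, t)) has_vector_derivative 0) (at s)"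
    by (rule has_vector_derivative_transform_within_open[OF has_vector_derivative_const op(2)])
      (use assms x in auto)
  then show "partial_s f x = 0" by (simp add: partial_s_def x vector_derivative_at)
qed

text \<open>
  Where the coordinate \<open>r\<close> vanishes the function is locally zero, so that the quotient rule
  holds there as well, both sides being \<open>0\<close> by \<open>0 / 0 = 0\<close>.
\<close>

lemma Ck_div_r:
  assumes K: "closed K" "K \<subseteq> quadrant"
  shows "Ck k f \<Longrightarrow> (\<And>x. x \<notin> K \<Longrightarrow> f x = 0) \<Longrightarrow> Ck k (\<lambda>x. f x / of_real (fst x))"
proof (induction k arbitrary: f)
  have cont: "continuous_on UNIV (\<lambda>x. f x / complex_of_real (fst x))"
    if f: "continuous_on UNIV f" "\<And>x. x \<notin> K \<Longrightarrow> f x = 0" for f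
  proof -
    have q: "open quadrant" unfolding quadrant_def by (intro open_Times open_greaterThan)
    have "continuous_on quadrant (\<lambda>x. f x / complex_of_real (fst x))"
      by (intro continuous_intros continuous_on_subset[OF f(1)]) (auto simp: quadrant_def)
    moreover have "continuous_on (- K) (\<lambda>x. f x / complex_of_real (fst x))"
      by (rule continuous_on_eq[OF continuous_on_const[of _ 0]]) (use f in auto)
    ultimately have "continuous_on (quadrant \<union> - K) (\<lambda>x. f x / complex_of_real (fst x))"
      using q K by (intro continuous_on_open_Un) auto
    moreover have "quadrant \<union> - K = UNIV" using K by auto
    ultimately show ?thesis by simp
  qed
  {
    case 0
    then show ?case using cont by simp
  next
    case (Suc k)
    note f = Ck_SucD[OF Suc.prems(1)]
    note pz = partial_zero_off_closed[OF K(1) Suc.prems(2)]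
    have A: "Ck k (\<lambda>x. partial_r f x / of_real (fst x))"
      "Ck k (\<lambda>x. partial_s f x / of_real (fst x))"
      using f(4,5) pz by (auto intro!: Suc.IH)
    have B: "Ck k (\<lambda>x. f x / of_real (fst x) / of_real (fst x))"
      by (rule Suc.IH[OF Suc.IH[OF Ck_Suc_imp_Ck[OF Suc.prems(1)] Suc.prems(2)]])
        (use Suc.prems(2) in auto)
    show ?case
    proof (rule Ck_SucI[where fr = "\<lambda>x. partial_r f x / of_real (fst x)
          + (-1) * (f x / of_real (fst x) / of_real (fst x))"
          and fs = "\<lambda>x. partial_s f x / of_real (fst x)"])
      show "continuous_on UNIV (\<lambda>x. f x / complex_of_real (fst x))"
        using cont[OF f(1) Suc.prems(2)] .
      show "Ck k (\<lambda>x. partial_r f x / of_real (fst x)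
          + (-1) * (f x / of_real (fst x) / of_real (fst x)))"
        by (intro Ck_add Ck_mult Ck_const A B)
      show "Ck k (\<lambda>x. partial_s f x / of_real (fst x))" by (rule A)
      fix r s :: real
      show "((\<lambda>t. f (r, t) / of_real (fst (r, t))) has_vector_derivative
          partial_s f (r, s) / of_real (fst (r, s))) (at s)"
        using has_vector_derivative_mult_left[OF f(3)[of r s], of "inverse (of_real r)"]
        by (simp add: divide_inverse)
      show "((\<lambda>t. f (t, s) / of_real (fst (t, s))) has_vector_derivative
          partial_r f (r, s) / of_real (fst (r, s))
          + (-1) * (f (r, s) / of_real (fst (r, s)) / of_real (fst (r, s)))) (at r)"
      proof (cases "r = 0")
        case False
        have i: "((\<lambda>t. complex_of_real (inverse t)) has_vector_derivative
            of_real (- (inverse r * inverse r))) (at r)"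
          using DERIV_inverse[OF False] 
          by (intro has_vector_derivative_of_real)
            (simp add: has_real_derivative_iff_has_vector_derivative[symmetric] numeral_2_eq_2)
        show ?thesis
          using has_vector_derivative_mult[OF f(2)[of s r] i]
          by (simp add: divide_inverse algebra_simps)
      next
        case True
        have z: "(t, s) \<notin> K" if "t \<le> 0" for t
          using K that by (auto simp: quadrant_def)
        have op: "open {t. (t, s) \<notin> K}"
          using K(1) by (auto intro!: open_Collect_neg closed_vimage continuous_intros
              simp: vimage_def[symmetric])
        have "((\<lambda>t. f (t, s) / of_real (fst (t, s))) has_vector_derivative 0) (at r)"
          by (rule has_vector_derivative_transform_within_open[OF has_vector_derivative_const op])
            (use z True Suc.prems(2) in auto)
        then show ?thesis using True by simp
      qed
    qed
  }
qed

section \<open>Test functions\<close>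

lemma open_quadrant: "open quadrant"
  unfolding quadrant_def by (intro open_Times open_greaterThan)

lemma test_functionsI:
  assumes "\<And>k. Ck k f" "compact K" "K \<subseteq> quadrant" "\<And>x. x \<notin> K \<Longrightarrow> f x = 0"
  shows "f \<in> test_functions"
proof -
  have "closure {x. f x \<noteq> 0} \<subseteq> K"
    by (rule closure_minimal) (use assms in \<open>auto simp: compact_imp_closed\<close>)
  moreover from this have "compact (closure {x. f x \<noteq> 0})"
    using assms(2) by (metis closed_closure compact_Int_closed inf.absorb2)
  ultimately show ?thesis
    using assms by (auto simp: test_functions_def)
qed

lemma test_functionsE:
  assumes "f \<in> test_functions"
  obtains K where "\<And>k. Ck k f" "compact K" "K \<subseteq> quadrant" "\<And>x. x \<notin> K \<Longrightarrow> f x = 0"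
  using assms closure_subset[of "{x. f x \<noteq> 0}"]
  by (intro that[of "closure {x. f x \<noteq> 0}"]) (auto simp: test_functions_def)

lemma test_functions_Ck: "f \<in> test_functions \<Longrightarrow> Ck k f"
  by (simp add: test_functions_def)

lemma test_functions_zero: "(\<lambda>x. 0) \<in> test_functions"
  by (rule test_functionsI[of _ "{}"]) (auto intro: Ck_const)

lemma test_functions_add:
  assumes "f \<in> test_functions" "g \<in> test_functions"
  shows "(\<lambda>x. f x + g x) \<in> test_functions"
proof -
  obtain K where K: "compact K" "K \<subseteq> quadrant" "\<And>x. x \<notin> K \<Longrightarrow> f x = 0"
    using test_functionsE[OF assms(1)] by metis
  obtain L where L: "compact L" "L \<subseteq> quadrant" "\<And>x. x \<notin> L \<Longrightarrow> g x = 0"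
    using test_functionsE[OF assms(2)] by metis
  show ?thesis
  proof (rule test_functionsI[of _ "K \<union> L"])
    show "Ck k (\<lambda>x. f x + g x)" for k
      using assms by (intro Ck_add test_functions_Ck)
  qed (use K L in auto)
qed

lemma test_functions_smooth_mult:
  assumes "\<And>k. Ck k w" "f \<in> test_functions"
  shows "(\<lambda>x. w x * f x) \<in> test_functions"
proof -
  obtain K where K: "compact K" "K \<subseteq> quadrant" "\<And>x. x \<notin> K \<Longrightarrow> f x = 0"
    using test_functionsE[OF assms(2)] by metis
  show ?thesis
  proof (rule test_functionsI[of _ K])
    show "Ck k (\<lambda>x. w x * f x)" for k
      by (rule Ck_mult[OF assms(1) test_functions_Ck[OF assms(2)]])
  qed (use K in auto)
qed

lemma test_functions_scale: "f \<in> test_functions \<Longrightarrow> (\<lambda>x. c * f x) \<in> test_functions"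
  by (rule test_functions_smooth_mult[OF Ck_const])

lemma test_functions_diff:
  assumes "f \<in> test_functions" "g \<in> test_functions"
  shows "(\<lambda>x. f x - g x) \<in> test_functions"
  using test_functions_add[OF assms(1) test_functions_scale[OF assms(2), of "-1"]] by simp

lemma test_functions_mult_r:
  "f \<in> test_functions \<Longrightarrow> (\<lambda>x. of_real (fst x) * f x) \<in> test_functions"
  by (rule test_functions_smooth_mult[OF Ck_coordinate_r])

lemma test_functions_partial:
  assumes "f \<in> test_functions"
  shows "partial_r f \<in> test_functions" "partial_s f \<in> test_functions"
proof -
  obtain K where K: "compact K" "K \<subseteq> quadrant" "\<And>x. x \<notin> K \<Longrightarrow> f x = 0"
    using test_functionsE[OF assms] by metis
  have "Ck k (partial_r f)" "Ck k (partial_s f)" for k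
    using Ck_SucD(4,5)[OF test_functions_Ck[OF assms]] by auto
  then show "partial_r f \<in> test_functions" "partial_s f \<in> test_functions"
    using K partial_zero_off_closed[OF compact_imp_closed[OF K(1)] K(3)]
    by (auto intro!: test_functionsI[of _ K])
qed

lemma test_functions_div_r:
  assumes "f \<in> test_functions"
  shows "(\<lambda>x. f x / of_real (fst x)) \<in> test_functions"
proof -
  obtain K where K: "compact K" "K \<subseteq> quadrant" "\<And>x. x \<notin> K \<Longrightarrow> f x = 0"
    using test_functionsE[OF assms] by metis
  show ?thesis
  proof (rule test_functionsI[of _ K])
    show "Ck k (\<lambda>x. f x / of_real (fst x))" for k
      using Ck_div_r[OF compact_imp_closed[OF K(1)] K(2) test_functions_Ck[OF assms] K(3)] .
  qed (use K in auto)
qed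

lemma test_functions_swap:
  assumes "f \<in> test_functions"
  shows "(\<lambda>x. f (prod.swap x)) \<in> test_functions"
proof -
  obtain K where K: "compact K" "K \<subseteq> quadrant" "\<And>x. x \<notin> K \<Longrightarrow> f x = 0"
    using test_functionsE[OF assms] by metis
  show ?thesis
  proof (rule test_functionsI[of _ "prod.swap ` K"])
    show "compact (prod.swap ` K)"
      using K(1) by (intro compact_continuous_image continuous_on_swap)
    show "prod.swap ` K \<subseteq> quadrant" using K(2) by (auto simp: quadrant_def)
    show "f (prod.swap x) = 0" if "x \<notin> prod.swap ` K" for x
      using that by (intro K(3)) (metis image_eqI swap_swap)
  qed (intro Ck_swap test_functions_Ck assms)
qed

lemma test_functions_div_s:
  assumes "f \<in> test_functions"
  shows "(\<lambda>x. f x / of_real (snd x)) \<in> test_functions"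
  using test_functions_swap[OF test_functions_div_r[OF test_functions_swap[OF assms]]] by simp

section \<open>Integration of compactly supported functions\<close>

lemma quadrant_sets [measurable]: "quadrant \<in> sets borel"
  using open_quadrant by simp

lemma integral_quadrant_measure:
  fixes f :: "real \<times> real \<Rightarrow> 'b::{banach, second_countable_topology}"
  shows "(\<integral>x. f x \<partial>quadrant_measure) = (\<integral>x. indicator quadrant x *\<^sub>R f x \<partial>lborel)"
  unfolding quadrant_measure_def by (rule integral_restrict_space) simp

lemma integrable_quadrant_measure:
  fixes f :: "real \<times> real \<Rightarrow> 'b::{banach, second_countable_topology}"
  shows "integrable quadrant_measure f \<longleftrightarrow> integrable lborel (\<lambda>x. indicator quadrant x *\<^sub>R f x)"
  unfolding quadrant_measure_def by (rule integrable_restrict_space) simp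

lemma compact_support_integrable:
  fixes f :: "real \<times> real \<Rightarrow> 'b::{banach, second_countable_topology}"
  assumes "continuous_on UNIV f" "compact K" "\<And>x. x \<notin> K \<Longrightarrow> f x = 0"
  shows "integrable lborel f"
proof -
  have "integrable lborel (\<lambda>x. indicator K x *\<^sub>R f x)"
    using assms(1,2) by (intro borel_integrable_compact) (auto intro: continuous_on_subset)
  moreover have "(\<lambda>x. indicator K x *\<^sub>R f x) = f"
    using assms(3) by (auto simp: indicator_def fun_eq_iff)
  ultimately show ?thesis by simp
qed

lemma continuous_measurable_quadrant:
  assumes "continuous_on UNIV f"
  shows "f \<in> borel_measurable quadrant_measure"
  unfolding quadrant_measure_def
  using borel_measurable_continuous_onI[OF assms] by (intro measurable_restrict_space1) simp

lemma test_function_square_integrable: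
  assumes "f \<in> test_functions"
  shows "square_integrable f"
proof -
  obtain K where K: "compact K" "K \<subseteq> quadrant" "\<And>x. x \<notin> K \<Longrightarrow> f x = 0"
    using test_functionsE[OF assms] by metis
  have c: "continuous_on UNIV f"
    using Ck_continuous[OF test_functions_Ck[OF assms, of 0]] .
  have "integrable lborel (\<lambda>x. (cmod (f x))\<^sup>2)"
    by (rule compact_support_integrable[OF _ K(1)]) (use c K in \<open>auto intro!: continuous_intros\<close>)
  then have "integrable quadrant_measure (\<lambda>x. (cmod (f x))\<^sup>2)"
    unfolding integrable_quadrant_measure
    by (rule integrable_mult_indicator[rotated]) simp
  then show ?thesis
    using continuous_measurable_quadrant[OF c] by (simp add: square_integrable_def)
qed

section \<open>Smooth bumps on boxes\<close>

text \<open>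
  The factors \<open>t\<^sup>-\<^sup>m\<close> make the linear span of the family closed under differentiation, so that it
  contains \<open>exp (- 1 / t)\<close>, extended by zero to \<open>t \<le> 0\<close>, together with all its derivatives.
\<close>

definition flat_exp :: "nat \<Rightarrow> real \<Rightarrow> real" where
  "flat_exp m t = (if t > 0 then inverse t ^ m * exp (- inverse t) else 0)"

lemma flat_exp_tendsto_0: "(flat_exp m \<longlongrightarrow> 0) (at 0)"
proof (rule filterlim_split_at)
  show "(flat_exp m \<longlongrightarrow> 0) (at_left 0)"
    by (rule tendsto_eventually)
      (auto simp: eventually_at_filter flat_exp_def intro!: always_eventually)
  have "((\<lambda>t. inverse t ^ m / exp (inverse t)) \<longlongrightarrow> (0::real)) (at_right 0)"
    by (rule filterlim_compose[OF tendsto_power_div_exp_0 filterlim_inverse_at_top_right])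
  then show "(flat_exp m \<longlongrightarrow> 0) (at_right 0)"
    by (rule Lim_transform_eventually)
      (auto simp: eventually_at_filter flat_exp_def exp_minus field_simps intro!: always_eventually)
qed

lemma DERIV_flat_exp:
  "(flat_exp m has_real_derivative flat_exp (m + 2) t - real m * flat_exp (m + 1) t) (at t)"
proof -
  consider "t > 0" | "t < 0" | "t = 0" by linarith
  then show ?thesis
  proof cases
    case 1
    have "((\<lambda>t. inverse t ^ m * exp (- inverse t)) has_real_derivative
        real m * inverse t ^ (m - 1) * (- (inverse t ^ 2)) * exp (- inverse t)
        + inverse t ^ m * (exp (- inverse t) * inverse t ^ 2)) (at t)"
      using 1 by (auto intro!: derivative_eq_intros simp: power2_eq_square)
    also have "real m * inverse t ^ (m - 1) * (- (inverse t ^ 2)) * exp (- inverse t)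
        + inverse t ^ m * (exp (- inverse t) * inverse t ^ 2)
        = flat_exp (m + 2) t - real m * flat_exp (m + 1) t"
      using 1 by (cases m) (simp_all add: flat_exp_def power_add power2_eq_square algebra_simps)
    finally show ?thesis
      by (rule has_field_derivative_transform_within_open[of _ _ _ "{0<..}"])
        (use 1 in \<open>auto simp: flat_exp_def\<close>)
  next
    case 2
    have "((\<lambda>t. 0) has_real_derivative flat_exp (m + 2) t - real m * flat_exp (m + 1) t) (at t)"
      using 2 by (simp add: flat_exp_def)
    then show ?thesis
      by (rule has_field_derivative_transform_within_open[of _ _ _ "{..<0}"])
        (use 2 in \<open>auto simp: flat_exp_def\<close>)
  next
    case 3
    \<comment> \<open>The difference quotient at \<open>0\<close> is the next member of the family, which tends to \<open>0\<close>.\<close>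
    have "(\<lambda>y. (flat_exp m y - flat_exp m 0) / (y - 0)) = flat_exp (m + 1)"
      by (auto simp: flat_exp_def fun_eq_iff field_simps)
    then show ?thesis
      using flat_exp_tendsto_0[of "m + 1"] 3
      by (simp add: has_field_derivative_iff flat_exp_def)
  qed
qed

lemma Ck_flat_exp: "Ck k (\<lambda>x. complex_of_real (flat_exp m (a + b * fst x + c * snd x)))"
proof (induction k arbitrary: m)
  have cont: "continuous_on UNIV (\<lambda>x. complex_of_real (flat_exp m (a + b * fst x + c * snd x)))" for m
  proof (intro continuous_on_of_real)
    have "continuous_on UNIV (flat_exp m)"
      using DERIV_flat_exp DERIV_isCont continuous_at_imp_continuous_on by blast
    then show "continuous_on UNIV (\<lambda>x. flat_exp m (a + b * fst x + c * snd x))"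
      by (rule continuous_on_compose2) (auto intro!: continuous_intros)
  qed
  {
    case 0
    show ?case using cont by (simp only: Ck.simps)
  next
    case (Suc k)
    let ?L = "\<lambda>x. a + b * fst x + c * snd x"
    let ?D = "\<lambda>z x. complex_of_real z * (complex_of_real (flat_exp (m + 2) (?L x))
      + (- of_nat m) * complex_of_real (flat_exp (m + 1) (?L x)))"
    have chain: "((\<lambda>t. complex_of_real (flat_exp m (u + z * t))) has_vector_derivative
        complex_of_real z * (complex_of_real (flat_exp (m + 2) (u + z * t))
        + (- of_nat m) * complex_of_real (flat_exp (m + 1) (u + z * t)))) (at t)" for u z t
    proof -
      have "((\<lambda>t. u + z * t) has_real_derivative z) (at t)"
        by (auto intro!: derivative_eq_intros)
      from DERIV_chain2[OF DERIV_flat_exp this, of m]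
      have "((\<lambda>t. flat_exp m (u + z * t)) has_real_derivative
        (flat_exp (m + 2) (u + z * t) - real m * flat_exp (m + 1) (u + z * t)) * z) (at t)" .
      then have "((\<lambda>t. complex_of_real (flat_exp m (u + z * t))) has_vector_derivative
        of_real ((flat_exp (m + 2) (u + z * t) - real m * flat_exp (m + 1) (u + z * t)) * z)) (at t)"
        by (intro has_vector_derivative_of_real)
          (simp add: has_real_derivative_iff_has_vector_derivative)
      then show ?thesis by (simp add: algebra_simps)
    qed
    have smooth: "Ck k (?D z)" for z
      by (intro Ck_mult Ck_add Ck_const Suc.IH)
    show ?case
    proof (rule Ck_SucI[OF cont _ _ smooth[of b] smooth[of c]])
      fix r s
      show "((\<lambda>t. complex_of_real (flat_exp m (?L (t, s)))) has_vector_derivative ?D b (r, s)) (at r)"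
        using chain[of "a + c * s" b r] by (simp add: ac_simps)
      show "((\<lambda>t. complex_of_real (flat_exp m (?L (r, t)))) has_vector_derivative ?D c (r, s)) (at s)"
        using chain[of "a + b * r" c s] by simp
    qed
  }
qed

lemma flat_exp_0_bounds: "0 \<le> flat_exp 0 t" "flat_exp 0 t \<le> 1"
  by (auto simp: flat_exp_def)

lemma flat_exp_0_tendsto:
  "(\<lambda>n. flat_exp 0 (real n * t)) \<longlonglongrightarrow> (if t > 0 then 1 else 0)"
proof (cases "t > 0")
  case True
  have "(\<lambda>n. exp (- (inverse (real n) * inverse t))) \<longlonglongrightarrow> exp (- (0 * inverse t))"
    by (intro tendsto_intros lim_inverse_n)
  moreover have "\<forall>\<^sub>F n in sequentially.
      exp (- (inverse (real n) * inverse t)) = flat_exp 0 (real n * t)"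
    using eventually_gt_at_top[of 0]
    by eventually_elim (use True in \<open>auto simp: flat_exp_def\<close>)
  ultimately show ?thesis
    using True by (auto intro: Lim_transform_eventually)
next
  case False
  then have "flat_exp 0 (real n * t) = 0" for n
    by (simp add: flat_exp_def not_less mult_nonneg_nonpos)
  then show ?thesis using False by simp
qed

text \<open>
  Since \<open>exp (- 1 / (n t)) \<longrightarrow> 1\<close> for \<open>t > 0\<close>, rescaling alone makes these products converge to the
  indicator of the open box.
\<close>

definition box_bump :: "nat \<Rightarrow> real \<Rightarrow> real \<Rightarrow> real \<Rightarrow> real \<Rightarrow> real \<times> real \<Rightarrow> real" where
  "box_bump n a b c d x =
     flat_exp 0 (real n * (fst x - a)) * flat_exp 0 (real n * (b - fst x)) *
     (flat_exp 0 (real n * (snd x - c)) * flat_exp 0 (real n * (d - snd x)))"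

lemma box_bump_zero:
  assumes "x \<notin> {a<..<b} \<times> {c<..<d}"
  shows "box_bump n a b c d x = 0"
proof -
  have "flat_exp 0 (real n * t) = 0" if "t \<le> 0" for t
    using that by (simp add: flat_exp_def not_less mult_nonneg_nonpos)
  moreover have "fst x - a \<le> 0 \<or> b - fst x \<le> 0 \<or> snd x - c \<le> 0 \<or> d - snd x \<le> 0"
    using assms by (cases x) auto
  ultimately show ?thesis by (auto simp: box_bump_def)
qed

lemma box_bump_bounds: "0 \<le> box_bump n a b c d x" "box_bump n a b c d x \<le> 1"
  unfolding box_bump_def by (auto intro!: mult_nonneg_nonneg mult_le_one flat_exp_0_bounds)

lemma box_bump_tendsto:
  "(\<lambda>n. box_bump n a b c d x) \<longlonglongrightarrow> indicator ({a<..<b} \<times> {c<..<d}) x"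
proof -
  have "(\<lambda>n. box_bump n a b c d x) \<longlonglongrightarrow>
      (if fst x - a > 0 then 1 else 0) * (if b - fst x > 0 then 1 else 0) *
      ((if snd x - c > 0 then 1 else 0) * (if d - snd x > 0 then 1 else 0))"
    unfolding box_bump_def by (intro tendsto_mult flat_exp_0_tendsto)
  then show ?thesis by (cases x) (auto simp: indicator_def split: if_splits)
qed

lemma box_bump_test:
  assumes "0 < a" "0 < c"
  shows "(\<lambda>x. complex_of_real (box_bump n a b c d x)) \<in> test_functions"
proof (rule test_functionsI[of _ "{a..b} \<times> {c..d}"])
  have eq: "complex_of_real (box_bump n a b c d x) =
      (complex_of_real (flat_exp 0 (- real n * a + real n * fst x + 0 * snd x)) *
       complex_of_real (flat_exp 0 (real n * b + (- real n) * fst x + 0 * snd x))) *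
      (complex_of_real (flat_exp 0 (- real n * c + 0 * fst x + real n * snd x)) *
       complex_of_real (flat_exp 0 (real n * d + 0 * fst x + (- real n) * snd x)))" for x
    unfolding box_bump_def of_real_mult by (simp add: algebra_simps)
  show "Ck k (\<lambda>x. complex_of_real (box_bump n a b c d x))" for k
    unfolding eq by (rule Ck_mult[OF Ck_mult[OF Ck_flat_exp Ck_flat_exp]
          Ck_mult[OF Ck_flat_exp Ck_flat_exp]])
  show "compact ({a..b} \<times> {c..d})" by (intro compact_Times compact_Icc)
  show "{a..b} \<times> {c..d} \<subseteq> quadrant" using assms by (auto simp: quadrant_def)
  show "complex_of_real (box_bump n a b c d x) = 0" if "x \<notin> {a..b} \<times> {c..d}" for x
  proof -
    have "x \<notin> {a<..<b} \<times> {c<..<d}" using that by auto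
    then show ?thesis using box_bump_zero by simp
  qed
qed

section \<open>Density of the test functions\<close>

lemma square_integrable_indicator_box:
  assumes "0 < a" "0 < c"
  shows "square_integrable (indicator ({a<..<b} \<times> {c<..<d}))"
proof -
  let ?B = "{a<..<b} \<times> {c<..<d}"
  have B: "?B \<in> sets borel" by (intro borel_open open_Times open_greaterThanLessThan)
  have "?B = box (a, c) (b, d)" by (auto simp: box_prod)
  then have "integrable lborel (indicator ?B :: _ \<Rightarrow> real)"
    using B emeasure_lborel_box_finite[of "(a, c)" "(b, d)"] by (simp add: integrable_real_indicator)
  moreover have "(\<lambda>x. indicator quadrant x *\<^sub>R (cmod (indicator ?B x))\<^sup>2) = indicator ?B"
    using assms by (auto simp: indicator_def quadrant_def fun_eq_iff)
  ultimately have "integrable quadrant_measure (\<lambda>x. (cmod (indicator ?B x))\<^sup>2)"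
    by (simp add: integrable_quadrant_measure)
  moreover have "indicator ?B \<in> borel_measurable quadrant_measure"
    unfolding quadrant_measure_def using B
    by (intro measurable_restrict_space1) simp
  ultimately show ?thesis by (simp add: square_integrable_def)
qed

text \<open>
  The bumps converge to the indicator of the box from below, so that \<open>f\<close> cut off to the box is an
  integrable majorant; it is integrable because the box has finite measure.
\<close>

lemma integral_box_zero:
  assumes f: "square_integrable f"
    and orth: "\<And>\<phi>. \<phi> \<in> test_functions \<Longrightarrow> (\<integral>x. f x * cnj (\<phi> x) \<partial>quadrant_measure) = 0"
    and "0 < a" "0 < c"
  shows "(\<integral>x. indicator ({a<..<b} \<times> {c<..<d}) x *\<^sub>R f x \<partial>quadrant_measure) = 0"
proof -
  let ?B = "{a<..<b} \<times> {c<..<d}"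
  let ?M = quadrant_measure
  have [measurable]: "f \<in> borel_measurable ?M" using f by (rule square_integrable_measurable)
  have int: "integrable ?M (\<lambda>x. f x * cnj (indicator ?B x))"
    by (rule square_integrable_mult_cnj[OF f square_integrable_indicator_box[OF assms(3,4)]])
  have eq: "indicator ?B x *\<^sub>R f x = f x * cnj (indicator ?B x)" for x
    by (simp add: indicator_def)
  have "(\<lambda>n. \<integral>x. f x * cnj (complex_of_real (box_bump n a b c d x)) \<partial>?M)
      \<longlonglongrightarrow> (\<integral>x. f x * cnj (indicator ?B x) \<partial>?M)"
  proof (rule integral_dominated_convergence)
    show "(\<lambda>x. f x * cnj (indicator ?B x)) \<in> borel_measurable ?M"
      using int by auto
    show "(\<lambda>x. f x * cnj (complex_of_real (box_bump n a b c d x))) \<in> borel_measurable ?M" for n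
      using square_integrable_mult_cnj[OF f test_function_square_integrable[OF box_bump_test]] assms(3,4)
      by auto
    show "integrable ?M (\<lambda>x. cmod (f x * cnj (indicator ?B x)))"
      using int by (rule integrable_norm)
    show "AE x in ?M. (\<lambda>n. f x * cnj (complex_of_real (box_bump n a b c d x)))
        \<longlonglongrightarrow> f x * cnj (indicator ?B x)"
    proof (rule AE_I2)
      fix x
      have "(\<lambda>n. f x * cnj (complex_of_real (box_bump n a b c d x)))
        \<longlonglongrightarrow> f x * cnj (complex_of_real (indicator ?B x))"
        by (intro tendsto_intros box_bump_tendsto)
      then show "(\<lambda>n. f x * cnj (complex_of_real (box_bump n a b c d x)))
        \<longlonglongrightarrow> f x * cnj (indicator ?B x)"
        by (cases "x \<in> ?B") simp_all
    qed
    show "AE x in ?M. norm (f x * cnj (complex_of_real (box_bump n a b c d x)))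
        \<le> cmod (f x * cnj (indicator ?B x))" for n
    proof (rule AE_I2)
      fix x
      show "norm (f x * cnj (complex_of_real (box_bump n a b c d x)))
        \<le> cmod (f x * cnj (indicator ?B x))"
      proof (cases "x \<in> ?B")
        case True
        then show ?thesis
          using box_bump_bounds[of n a b c d x] by (simp add: norm_mult mult_left_le)
      next
        case False
        then show ?thesis using box_bump_zero[OF False] by simp
      qed
    qed
  qed
  moreover have "(\<integral>x. f x * cnj (complex_of_real (box_bump n a b c d x)) \<partial>?M) = 0" for n
    by (rule orth[OF box_bump_test[OF assms(3,4)]])
  ultimately have "(\<integral>x. f x * cnj (indicator ?B x) \<partial>?M) = 0"
    by (simp add: LIMSEQ_const_iff)
  then show ?thesis by (simp only: eq)
qed

text \<open>
  The sets over which \<open>f\<close> integrates to zero form a Dynkin system; it contains the \<open>\<inter>\<close>-stable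
  generator of boxes. Since \<open>f\<close> itself need not be integrable near the axes and at infinity, this
  is done on the squares \<open>Q N\<close>, which stay away from the axes and exhaust the quadrant.
\<close>

lemma AE_zero_if_integral_box_zero:
  assumes f: "square_integrable f"
    and box: "\<And>a b c d. 0 < a \<Longrightarrow> 0 < c \<Longrightarrow>
      (\<integral>x. indicator ({a<..<b} \<times> {c<..<d}) x *\<^sub>R f x \<partial>quadrant_measure) = 0"
  shows "AE x in quadrant_measure. f x = 0"
proof -
  define Q :: "nat \<Rightarrow> (real \<times> real) set" where
    "Q N = {1 / real (Suc N)<..<real (Suc N)} \<times> {1 / real (Suc N)<..<real (Suc N)}" for N
  have "AE x in lborel. indicator (Q N) x *\<^sub>R f x = 0" for N
  proof -
    define F where "F x = indicator (Q N) x *\<^sub>R f x" for x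
    have pos: "0 < 1 / real (Suc N)" by simp
    have Qq: "indicator quadrant x *\<^sub>R (indicator (A \<inter> Q N) x *\<^sub>R f x) = indicator A x *\<^sub>R F x" for A x
      by (auto simp: F_def Q_def quadrant_def indicator_def intro: order.strict_trans[OF pos])
    have "integrable quadrant_measure (\<lambda>x. f x * cnj (indicator (Q N) x))"
      unfolding Q_def
      by (rule square_integrable_mult_cnj[OF f square_integrable_indicator_box[OF pos pos]])
    moreover have "(\<lambda>x. f x * cnj (indicator (Q N) x)) = (\<lambda>x. indicator (UNIV \<inter> Q N) x *\<^sub>R f x)"
      by (auto simp: fun_eq_iff indicator_def)
    ultimately have F: "integrable lborel F"
      using Qq[of _ UNIV] by (simp add: integrable_quadrant_measure)
    have mp: "0 < max z (1 / real (Suc N))" for z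
      using pos by (simp only: less_max_iff_disj simp_thms)
    have box_zero: "(\<integral>x. indicator (box p q) x *\<^sub>R F x \<partial>lborel) = 0" for p q
    proof -
      obtain a c b d where pq: "p = (a, c)" "q = (b, d)" by fastforce
      have "box p q \<inter> Q N = {max a (1 / real (Suc N))<..<min b (real (Suc N))} \<times>
          {max c (1 / real (Suc N))<..<min d (real (Suc N))}"
        by (auto simp: pq box_prod Q_def)
      then have "(\<integral>x. indicator (box p q \<inter> Q N) x *\<^sub>R f x \<partial>quadrant_measure) = 0"
        using box[OF mp mp] by (simp only:)
      then show ?thesis by (simp only: integral_quadrant_measure Qq)
    qed
    have total: "(\<integral>x. F x \<partial>lborel) = 0"
    proof -
      have "indicator (box (1 / real (Suc N), 1 / real (Suc N)) (real (Suc N), real (Suc N))) x *\<^sub>R F x = F x" for x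
        by (auto simp: box_prod F_def Q_def indicator_def)
      then show ?thesis using box_zero[of "(1 / real (Suc N), 1 / real (Suc N))" "(real (Suc N), real (Suc N))"]
        by (simp del: of_nat_Suc)
    qed
    have "(LINT x:A|lborel. F x) = 0" if "A \<in> sets lborel" for A
    proof -
      have "Int_stable (range (\<lambda>(p, q). box p q :: (real \<times> real) set))"
        by (auto simp: Int_stable_def box_Int_box)
      moreover have "range (\<lambda>(p, q). box p q :: (real \<times> real) set) \<subseteq> Pow UNIV" by simp
      moreover have "A \<in> sigma_sets UNIV (range (\<lambda>(p, q). box p q))"
        using that unfolding sets_lborel borel_eq_box by simp
      ultimately show ?thesis
      proof (induction rule: sigma_sets_induct_disjoint)
        case (basic A)
        then show ?case
          using box_zero by (auto simp: set_lebesgue_integral_def)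
      next
        case empty
        then show ?case by (simp add: set_lebesgue_integral_def)
      next
        case (compl A)
        then have A: "A \<in> sets lborel" by (simp add: borel_eq_box)
        have "(\<integral>x. indicator (UNIV - A) x *\<^sub>R F x \<partial>lborel)
            = (\<integral>x. F x - indicator A x *\<^sub>R F x \<partial>lborel)"
          by (rule Bochner_Integration.integral_cong) (auto simp: indicator_def)
        also have "\<dots> = (\<integral>x. F x \<partial>lborel) - (\<integral>x. indicator A x *\<^sub>R F x \<partial>lborel)"
          by (intro Bochner_Integration.integral_diff F integrable_mult_indicator A)
        finally show ?case
          using compl total by (simp add: set_lebesgue_integral_def)
      next
        case (union A)
        then have A: "A i \<in> sets lborel" for i by (auto simp: borel_eq_box)
        then have "(\<Union>i. A i) \<in> sets lborel" by blast
        then have "(LINT x:(\<Union>i. A i)|lborel. F x) = (\<Sum>i. LINT x:A i|lborel. F x)"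
          using A union F
          by (intro lebesgue_integral_countable_add)
            (auto simp: disjoint_family_on_def set_integrable_def intro!: integrable_mult_indicator)
        then show ?case using union by simp
      qed
    qed
    then have "AE x in lborel. F x = 0"
      by (rule sigma_finite_measure.density_zero[OF sigma_finite_lborel F])
    then show ?thesis by (simp add: F_def)
  qed
  then have "AE x in lborel. \<forall>N. indicator (Q N) x *\<^sub>R f x = 0"
    by (simp only: AE_all_countable) blast
  then have "AE x in lborel. x \<in> quadrant \<longrightarrow> f x = 0"
  proof eventually_elim
    case (elim x)
    show ?case
    proof
      assume "x \<in> quadrant"
      then obtain r s where x: "x = (r, s)" "r > 0" "s > 0" by (auto simp: quadrant_def)
      obtain N where N: "real N > max (max r s) (max (1 / r) (1 / s))"
        using reals_Archimedean2 by blast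
      have "1 / real (Suc N) < r" "1 / real (Suc N) < s"
        using N x by (auto simp: field_simps)
      then have "x \<in> Q N" using N x by (auto simp: Q_def)
      then show "f x = 0" using elim[rule_format, of N] by simp
    qed
  qed
  then show ?thesis
    unfolding quadrant_measure_def by (subst AE_restrict_space_iff) auto
qed

lemma abs_l2_zero: "abs_l2 (\<lambda>x. 0) = 0"
  by (simp add: zero_l2_def)

lemma abs_test_functions_subspace:
  shows "0 \<in> abs_l2 ` test_functions"
    and "x \<in> abs_l2 ` test_functions \<Longrightarrow> y \<in> abs_l2 ` test_functions \<Longrightarrow>
      x + y \<in> abs_l2 ` test_functions"
    and "x \<in> abs_l2 ` test_functions \<Longrightarrow> c *\<^sub>C x \<in> abs_l2 ` test_functions"
proof -
  note sq = test_function_square_integrable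
  show "0 \<in> abs_l2 ` test_functions"
    using test_functions_zero abs_l2_zero by (metis image_eqI)
  show "x + y \<in> abs_l2 ` test_functions"
    if "x \<in> abs_l2 ` test_functions" "y \<in> abs_l2 ` test_functions"
    using that by (auto simp: abs_l2_add sq intro!: imageI test_functions_add)
  show "c *\<^sub>C x \<in> abs_l2 ` test_functions" if "x \<in> abs_l2 ` test_functions"
    using that by (auto simp: abs_l2_scaleC sq intro!: imageI test_functions_scale)
qed

theorem dense_test_functions: "closure (abs_l2 ` test_functions) = UNIV"
proof (rule dense_if_orthogonal_zero)
  note sq = test_function_square_integrable
  fix x assume orth: "\<And>m. m \<in> abs_l2 ` test_functions \<Longrightarrow> cinner x m = 0"
  have "(\<integral>y. rep_l2 x y * cnj (\<phi> y) \<partial>quadrant_measure) = 0" if "\<phi> \<in> test_functions" for \<phi>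
    using orth[of "abs_l2 \<phi>"] that cinner_abs_l2[OF square_integrable_rep[of x] sq[OF that]] by simp
  then have "AE y in quadrant_measure. rep_l2 x y = 0"
    by (intro AE_zero_if_integral_box_zero integral_box_zero) auto
  then have "abs_l2 (rep_l2 x) = abs_l2 (\<lambda>x. 0)"
    by (intro abs_l2_eqI) (auto simp: square_integrable_zero)
  then show "x = 0" by (simp add: abs_l2_zero)
qed (rule abs_test_functions_subspace; assumption)+

section \<open>Integration by parts\<close>

lemma integral_derivative_compact_support:
  fixes f :: "real \<Rightarrow> complex"
  assumes "\<And>t. (f has_vector_derivative f' t) (at t)" "continuous_on UNIV f'"
    and "\<And>t. B \<le> \<bar>t\<bar> \<Longrightarrow> f t = 0" "\<And>t. B \<le> \<bar>t\<bar> \<Longrightarrow> f' t = 0" and "B > 0"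
  shows "(\<integral>t. f' t \<partial>lborel) = 0"
proof -
  have "(\<integral>t. indicator {-B .. B} t *\<^sub>R f' t \<partial>lborel) = f B - f (- B)"
    using assms by (intro integral_FTC_Icc)
      (auto intro: has_vector_derivative_at_within continuous_on_subset)
  moreover have "(\<lambda>t. indicator {-B .. B} t *\<^sub>R f' t) = f'"
    using assms(4) by (auto simp: indicator_def fun_eq_iff)
  ultimately show ?thesis using assms(3,5) by simp
qed

lemma integral_partial_zero:
  assumes F: "Ck (Suc 0) F" and K: "compact K" "\<And>x. x \<notin> K \<Longrightarrow> F x = 0"
  shows "(\<integral>x. partial_r F x \<partial>lborel) = 0" "(\<integral>x. partial_s F x \<partial>lborel) = 0"
proof -
  note d = Ck_SucD[OF F]
  note pz = partial_zero_off_closed[OF compact_imp_closed[OF K(1)] K(2)]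
  have c: "continuous_on UNIV (partial_r F)" "continuous_on UNIV (partial_s F)"
    using d(4,5) by simp_all
  have int: "integrable (lborel \<Otimes>\<^sub>M lborel) (partial_r F)" "integrable (lborel \<Otimes>\<^sub>M lborel) (partial_s F)"
    unfolding lborel_prod using compact_support_integrable[OF c(1) K(1) pz(1)]
      compact_support_integrable[OF c(2) K(1) pz(2)] by auto
  obtain B where B: "B > 0" "\<And>x. x \<in> K \<Longrightarrow> norm x < B"
    using compact_imp_bounded[OF K(1)] by (auto simp: bounded_pos_less)
  have off: "(r, s) \<notin> K" if "B \<le> \<bar>r\<bar> \<or> B \<le> \<bar>s\<bar>" for r s
    using B(2)[of "(r, s)"] that norm_fst_le[of r s] norm_snd_le[of s r] by auto
  have "(\<integral>x. partial_r F x \<partial>lborel) = (\<integral>s. \<integral>r. partial_r F (r, s) \<partial>lborel \<partial>lborel)"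
    using lborel_pair.integral_snd[of "\<lambda>r s. partial_r F (r, s)"] int(1) by (simp add: lborel_prod)
  moreover have "(\<integral>r. partial_r F (r, s) \<partial>lborel) = 0" for s
    by (rule integral_derivative_compact_support[OF d(2) _ _ _ B(1)])
      (use off K(2) pz in \<open>auto intro!: continuous_on_compose2[OF c(1)] continuous_intros\<close>)
  ultimately show "(\<integral>x. partial_r F x \<partial>lborel) = 0" by simp
  have "(\<integral>x. partial_s F x \<partial>lborel) = (\<integral>r. \<integral>s. partial_s F (r, s) \<partial>lborel \<partial>lborel)"
    using lborel_pair.integral_fst'[OF int(2)] by (simp add: lborel_prod)
  moreover have "(\<integral>s. partial_s F (r, s) \<partial>lborel) = 0" for r
    by (rule integral_derivative_compact_support[OF d(3) _ _ _ B(1)])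
      (use off K(2) pz in \<open>auto intro!: continuous_on_compose2[OF c(2)] continuous_intros\<close>)
  ultimately show "(\<integral>x. partial_s F x \<partial>lborel) = 0" by simp
qed

lemma test_functions_cnj:
  assumes "f \<in> test_functions"
  shows "(\<lambda>x. cnj (f x)) \<in> test_functions"
proof -
  obtain K where K: "compact K" "K \<subseteq> quadrant" "\<And>x. x \<notin> K \<Longrightarrow> f x = 0"
    using test_functionsE[OF assms] by metis
  show ?thesis
    by (rule test_functionsI[OF Ck_cnj[OF test_functions_Ck[OF assms]] K(1,2)]) (simp add: K(3))
qed

lemma test_function_zero_off_quadrant:
  assumes "f \<in> test_functions" "x \<notin> quadrant"
  shows "f x = 0"
proof -
  obtain K where "K \<subseteq> quadrant" "\<And>x. x \<notin> K \<Longrightarrow> f x = 0"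
    using test_functionsE[OF assms(1)] by metis
  then show ?thesis using assms(2) by blast
qed

lemma integral_test_function:
  assumes "f \<in> test_functions"
  shows "(\<integral>x. f x \<partial>quadrant_measure) = (\<integral>x. f x \<partial>lborel)"
  unfolding integral_quadrant_measure
  using test_function_zero_off_quadrant[OF assms]
  by (intro Bochner_Integration.integral_cong) (auto simp: indicator_def)

lemma test_functions_mult:
  assumes "f \<in> test_functions" "g \<in> test_functions"
  shows "(\<lambda>x. f x * g x) \<in> test_functions"
  using test_functions_smooth_mult[OF test_functions_Ck[OF assms(1)] assms(2)] .

lemma cinner_test_functions:
  assumes "f \<in> test_functions" "g \<in> test_functions"
  shows "cinner (abs_l2 f) (abs_l2 g) = (\<integral>x. f x * cnj (g x) \<partial>lborel)"
  using assms integral_test_function[OF test_functions_mult[OF assms(1) test_functions_cnj[OF assms(2)]]]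
  by (simp add: cinner_abs_l2 test_function_square_integrable)

lemma test_function_integrable:
  assumes "f \<in> test_functions"
  shows "integrable lborel f"
proof -
  obtain K where "compact K" "\<And>x. x \<notin> K \<Longrightarrow> f x = 0"
    using test_functionsE[OF assms] by metis
  then show ?thesis
    by (rule compact_support_integrable[OF Ck_continuous[OF test_functions_Ck[OF assms, of 0]]])
qed

lemma partial_mult_cnj:
  assumes "f \<in> test_functions" "g \<in> test_functions"
  shows "partial_r (\<lambda>x. f x * cnj (g x)) x = f x * cnj (partial_r g x) + partial_r f x * cnj (g x)"
    and "partial_s (\<lambda>x. f x * cnj (g x)) x = f x * cnj (partial_s g x) + partial_s f x * cnj (g x)"
proof -
  obtain r s where x: "x = (r, s)" by fastforce
  note f = Ck_SucD[OF test_functions_Ck[OF assms(1), of "Suc 0"]]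
  note g = Ck_SucD[OF test_functions_Ck[OF assms(2), of "Suc 0"]]
  show "partial_r (\<lambda>x. f x * cnj (g x)) x = f x * cnj (partial_r g x) + partial_r f x * cnj (g x)"
    using has_vector_derivative_mult[OF f(2)[where r=r and s=s] has_vector_derivative_cnj[OF g(2)[where r=r and s=s]]]
    by (simp add: partial_r_def x vector_derivative_at)
  show "partial_s (\<lambda>x. f x * cnj (g x)) x = f x * cnj (partial_s g x) + partial_s f x * cnj (g x)"
    using has_vector_derivative_mult[OF f(3)[where r=r and s=s] has_vector_derivative_cnj[OF g(3)[where r=r and s=s]]]
    by (simp add: partial_s_def x vector_derivative_at)
qed

lemma integration_by_parts:
  assumes f: "f \<in> test_functions" and g: "g \<in> test_functions"
  shows "cinner (abs_l2 (partial_r f)) (abs_l2 g) = - cinner (abs_l2 f) (abs_l2 (partial_r g))"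
    and "cinner (abs_l2 (partial_s f)) (abs_l2 g) = - cinner (abs_l2 f) (abs_l2 (partial_s g))"
proof -
  have fg: "(\<lambda>x. f x * cnj (g x)) \<in> test_functions"
    by (intro test_functions_mult test_functions_cnj f g)
  obtain K where K: "compact K" "\<And>x. x \<notin> K \<Longrightarrow> f x = 0"
    using test_functionsE[OF f] by metis
  then have "\<And>x. x \<notin> K \<Longrightarrow> f x * cnj (g x) = 0" by simp
  note z = integral_partial_zero[OF test_functions_Ck[OF fg] K(1) this]
  note p = test_functions_partial[OF f] test_functions_partial[OF g]
  note i = test_functions_mult[OF f test_functions_cnj[OF p(3)], THEN test_function_integrable]
    test_functions_mult[OF p(1) test_functions_cnj[OF g], THEN test_function_integrable]
    test_functions_mult[OF f test_functions_cnj[OF p(4)], THEN test_function_integrable]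
    test_functions_mult[OF p(2) test_functions_cnj[OF g], THEN test_function_integrable]
  show "cinner (abs_l2 (partial_r f)) (abs_l2 g) = - cinner (abs_l2 f) (abs_l2 (partial_r g))"
    using z(1) i(1,2) unfolding partial_mult_cnj[OF f g]
    by (simp add: cinner_test_functions f g p eq_neg_iff_add_eq_0 add.commute)
  show "cinner (abs_l2 (partial_s f)) (abs_l2 g) = - cinner (abs_l2 f) (abs_l2 (partial_s g))"
    using z(2) i(3,4) unfolding partial_mult_cnj[OF f g]
    by (simp add: cinner_test_functions f g p eq_neg_iff_add_eq_0 add.commute)
qed

section \<open>The first-order operators and their weak versions\<close>

definition delta ::
  "real \<Rightarrow> real \<Rightarrow> nat \<Rightarrow> (real \<times> real \<Rightarrow> complex) \<Rightarrow> real \<times> real \<Rightarrow> complex" where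
  "delta \<alpha> \<beta> j \<phi> = (\<lambda>(r, s).
     if j = 1 then partial_r \<phi> (r, s) - of_real ((\<alpha> + 1/2) / r) * \<phi> (r, s)
     else of_real r * (partial_s \<phi> (r, s) - of_real ((\<beta> + 1/2) / s) * \<phi> (r, s)))"

lemma of_real_weight_mult: "complex_of_real (c / t) * z = of_real c * (z / of_real t)"
  by simp

lemma delta_alt:
  "delta \<alpha> \<beta> j \<phi> = (if j = 1
     then (\<lambda>x. partial_r \<phi> x - of_real (\<alpha> + 1/2) * (\<phi> x / of_real (fst x)))
     else (\<lambda>x. of_real (fst x) * partial_s \<phi> x
       - of_real (\<beta> + 1/2) * (of_real (fst x) * (\<phi> x / of_real (snd x)))))"
  unfolding delta_def case_prod_beta prod.collapse of_real_weight_mult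
  by (simp add: fun_eq_iff right_diff_distrib mult.left_commute del: of_real_add)

lemma delta_dagger_alt:
  "delta_dagger \<alpha> \<beta> j \<phi> = (if j = 1
     then (\<lambda>x. (-1) * partial_r \<phi> x - of_real (\<alpha> + 1/2) * (\<phi> x / of_real (fst x)))
     else (\<lambda>x. (-1) * (of_real (fst x) * partial_s \<phi> x)
       - of_real (\<beta> + 1/2) * (of_real (fst x) * (\<phi> x / of_real (snd x)))))"
  unfolding delta_dagger_def case_prod_beta prod.collapse of_real_weight_mult
  by (simp add: fun_eq_iff right_diff_distrib mult.left_commute del: of_real_add)

lemma test_functions_delta: "\<phi> \<in> test_functions \<Longrightarrow> delta \<alpha> \<beta> j \<phi> \<in> test_functions"
  unfolding delta_alt
  by (auto intro!: test_functions_diff test_functions_scale test_functions_mult_r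
      test_functions_div_r test_functions_div_s test_functions_partial)

lemma test_functions_delta_dagger:
  assumes "\<phi> \<in> test_functions" shows "delta_dagger \<alpha> \<beta> j \<phi> \<in> test_functions"
proof -
  have "(\<lambda>x. (-1) * partial_r \<phi> x - of_real (\<alpha> + 1/2) * (\<phi> x / of_real (fst x))) \<in> test_functions"
    by (intro test_functions_diff test_functions_scale test_functions_mult_r
      test_functions_div_r test_functions_div_s test_functions_partial assms)
  moreover have "(\<lambda>x. (-1) * (of_real (fst x) * partial_s \<phi> x)
       - of_real (\<beta> + 1/2) * (of_real (fst x) * (\<phi> x / of_real (snd x)))) \<in> test_functions"
    by (intro test_functions_diff test_functions_scale test_functions_mult_r
      test_functions_div_r test_functions_div_s test_functions_partial assms)
  ultimately show ?thesis unfolding delta_dagger_alt by presburger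
qed

lemma cinner_mult_real:
  assumes "f \<in> test_functions" "g \<in> test_functions"
    "(\<lambda>x. of_real (w x) * f x) \<in> test_functions" "(\<lambda>x. of_real (w x) * g x) \<in> test_functions"
  shows "cinner (abs_l2 (\<lambda>x. of_real (w x) * f x)) (abs_l2 g)
    = cinner (abs_l2 f) (abs_l2 (\<lambda>x. of_real (w x) * g x))"
  using assms by (simp add: cinner_test_functions ac_simps)

lemma partial_s_mult_r:
  assumes "f \<in> test_functions"
  shows "partial_s (\<lambda>x. of_real (fst x) * f x) = (\<lambda>x. of_real (fst x) * partial_s f x)"
proof
  fix x :: "real \<times> real"
  obtain r s where x: "x = (r, s)" by fastforce
  note f = Ck_SucD(3)[OF test_functions_Ck[OF assms, of "Suc 0"], where r=r and s=s]
  show "partial_s (\<lambda>x. of_real (fst x) * f x) x = of_real (fst x) * partial_s f x"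
    using has_vector_derivative_mult_right[OF f, of "of_real r"]
    by (simp add: partial_s_def x vector_derivative_at)
qed

text \<open>
  Besides integration by parts, this uses that real weights are symmetric and that \<open>r\<close> commutes
  with \<open>\<partial>/\<partial>s\<close>.
\<close>

lemma cinner_delta_dagger:
  assumes f: "f \<in> test_functions" and g: "g \<in> test_functions"
  shows "cinner (abs_l2 (delta_dagger \<alpha> \<beta> j f)) (abs_l2 g)
    = cinner (abs_l2 f) (abs_l2 (delta \<alpha> \<beta> j g))"
proof -
  note sq = test_function_square_integrable
  note t = test_functions_diff test_functions_scale test_functions_mult_r
    test_functions_div_r test_functions_div_s test_functions_partial f g
  have linear: "cinner (abs_l2 (\<lambda>x. (-1) * u x - of_real c * v x)) (abs_l2 g)
      = - cinner (abs_l2 u) (abs_l2 g) - of_real c * cinner (abs_l2 v) (abs_l2 g)"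
    if "u \<in> test_functions" "v \<in> test_functions" for u v and c :: real
    using that sq[OF test_functions_scale[OF that(1), of "-1"]]
      sq[OF test_functions_scale[OF that(2), of "of_real c"]]
      abs_l2_scaleC[OF sq[OF that(1)], of "-1", symmetric]
      abs_l2_scaleC[OF sq[OF that(2)], of "of_real c", symmetric]
    by (simp add: abs_l2_diff[symmetric] cinner_diff_left cinner_scaleC_left)
  have linear': "cinner (abs_l2 f) (abs_l2 (\<lambda>x. u x - of_real c * v x))
      = cinner (abs_l2 f) (abs_l2 u) - of_real c * cinner (abs_l2 f) (abs_l2 v)"
    if "u \<in> test_functions" "v \<in> test_functions" for u v and c :: real
    using that sq[OF that(1)]
      sq[OF test_functions_scale[OF that(2), of "of_real c"]]
      abs_l2_scaleC[OF sq[OF that(2)], of "of_real c", symmetric]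
    by (simp add: abs_l2_diff[symmetric] cinner_diff_right cinner_scaleC_right)
  show ?thesis
  proof (cases "j = 1")
    case True
    have "cinner (abs_l2 (\<lambda>x. f x / of_real (fst x))) (abs_l2 g)
        = cinner (abs_l2 f) (abs_l2 (\<lambda>x. g x / of_real (fst x)))"
      using cinner_mult_real[OF f g, of "\<lambda>x. inverse (fst x)"] test_functions_div_r[OF f]
        test_functions_div_r[OF g] by (simp add: divide_inverse mult.commute)
    moreover have "delta_dagger \<alpha> \<beta> j f =
        (\<lambda>x. (-1) * partial_r f x - of_real (\<alpha> + 1/2) * (f x / of_real (fst x)))"
      "delta \<alpha> \<beta> j g = (\<lambda>x. partial_r g x - of_real (\<alpha> + 1/2) * (g x / of_real (fst x)))"
      by (simp_all only: delta_alt delta_dagger_alt if_P[OF True])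
    ultimately show ?thesis
      using linear[OF test_functions_partial(1)[OF f] test_functions_div_r[OF f], of "\<alpha> + 1/2"]
        linear'[OF test_functions_partial(1)[OF g] test_functions_div_r[OF g], of "\<alpha> + 1/2"]
        integration_by_parts(1)[OF f g] by (simp only: minus_minus)
  next
    case False
    have "(\<lambda>x. complex_of_real (fst x) * (h x / of_real (snd x)))
        = (\<lambda>x. complex_of_real (fst x * inverse (snd x)) * h x)" for h :: "real \<times> real \<Rightarrow> complex"
      by (simp add: fun_eq_iff divide_inverse)
    then have "cinner (abs_l2 (\<lambda>x. of_real (fst x) * (f x / of_real (snd x)))) (abs_l2 g)
        = cinner (abs_l2 f) (abs_l2 (\<lambda>x. of_real (fst x) * (g x / of_real (snd x))))"
      using cinner_mult_real[OF f g, of "\<lambda>x. fst x * inverse (snd x)"]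
        test_functions_mult_r[OF test_functions_div_s[OF f]]
        test_functions_mult_r[OF test_functions_div_s[OF g]] by (simp only:)
    moreover have "cinner (abs_l2 (\<lambda>x. of_real (fst x) * partial_s f x)) (abs_l2 g)
        = - cinner (abs_l2 f) (abs_l2 (\<lambda>x. of_real (fst x) * partial_s g x))"
      using cinner_mult_real[of "partial_s f" g fst]
        integration_by_parts(2)[OF f test_functions_mult_r[OF g]]
      by (simp add: t partial_s_mult_r)
    moreover have "delta_dagger \<alpha> \<beta> j f = (\<lambda>x. (-1) * (of_real (fst x) * partial_s f x)
       - of_real (\<beta> + 1/2) * (of_real (fst x) * (f x / of_real (snd x))))"
      "delta \<alpha> \<beta> j g = (\<lambda>x. of_real (fst x) * partial_s g x
       - of_real (\<beta> + 1/2) * (of_real (fst x) * (g x / of_real (snd x))))"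
      by (simp_all only: delta_alt delta_dagger_alt if_not_P[OF False])
    ultimately show ?thesis
      using linear[OF test_functions_mult_r[OF test_functions_partial(2)[OF f]]
          test_functions_mult_r[OF test_functions_div_s[OF f]], of "\<beta> + 1/2"]
        linear'[OF test_functions_mult_r[OF test_functions_partial(2)[OF g]]
          test_functions_mult_r[OF test_functions_div_s[OF g]], of "\<beta> + 1/2"]
      by (simp only: minus_minus)
  qed
qed

text \<open>
  The weak derivative is the Hilbert space adjoint of the formal adjoint on test functions, and
  as such a closed operator.
\<close>

definition weak_graph :: "real \<Rightarrow> real \<Rightarrow> nat \<Rightarrow> (l2 \<times> l2) set" where
  "weak_graph \<alpha> \<beta> j = {(f, g). \<forall>\<phi>\<in>test_functions.
     cinner (abs_l2 (delta_dagger \<alpha> \<beta> j \<phi>)) f = cinner (abs_l2 \<phi>) g}"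

lemma square_integrable_locally_integrable:
  assumes f: "square_integrable f"
  shows "locally_integrable f"
  unfolding locally_integrable_def
proof (intro conjI allI impI)
  show "f \<in> borel_measurable quadrant_measure" using f by (rule square_integrable_measurable)
  fix K assume K: "compact K \<and> K \<subseteq> quadrant"
  then have sets: "K \<in> sets borel" by (simp add: compact_imp_closed)
  have "integrable lborel (\<lambda>x. indicator K x *\<^sub>R (1::real))"
    using K by (intro borel_integrable_compact) auto
  moreover have "(\<lambda>x. indicator quadrant x *\<^sub>R (cmod (indicator K x))\<^sup>2) = (\<lambda>x. indicator K x *\<^sub>R (1::real))"
    using K by (auto simp: indicator_def fun_eq_iff)
  ultimately have "integrable quadrant_measure (\<lambda>x. (cmod (indicator K x))\<^sup>2)"
    by (simp only: integrable_quadrant_measure)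
  moreover have "(indicator K :: _ \<Rightarrow> complex) \<in> borel_measurable quadrant_measure"
    unfolding quadrant_measure_def using sets by (intro measurable_restrict_space1) simp
  ultimately have "square_integrable (indicator K)" by (simp add: square_integrable_def)
  from square_integrable_mult_cnj[OF f this]
  have "integrable quadrant_measure (\<lambda>x. f x * cnj (indicator K x))" .
  moreover have "(\<lambda>x. f x * cnj (indicator K x)) = (\<lambda>x. indicator K x *\<^sub>R f x)"
    by (auto simp: indicator_def fun_eq_iff)
  ultimately show "set_integrable quadrant_measure K f" by (simp add: set_integrable_def)
qed

lemma has_weak_delta_iff:
  assumes "square_integrable g"
  shows "has_weak_delta \<alpha> \<beta> j (rep_l2 f) g \<longleftrightarrow> (f, abs_l2 g) \<in> weak_graph \<alpha> \<beta> j"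
proof -
  have "cinner (abs_l2 \<phi>) f = (\<integral>x. \<phi> x * cnj (rep_l2 f x) \<partial>quadrant_measure)"
    if "\<phi> \<in> test_functions" for \<phi>
    using cinner_abs_l2[OF test_function_square_integrable[OF that] square_integrable_rep, of f] by simp
  moreover have "cinner (abs_l2 \<phi>) (abs_l2 g) = (\<integral>x. \<phi> x * cnj (g x) \<partial>quadrant_measure)"
    if "\<phi> \<in> test_functions" for \<phi>
    using cinner_abs_l2[OF test_function_square_integrable[OF that] assms] .
  ultimately show ?thesis
    unfolding has_weak_delta_def weak_graph_def
    by (simp add: square_integrable_locally_integrable assms test_functions_delta_dagger)
qed

lemma weak_graph_unique:
  assumes "(f, g) \<in> weak_graph \<alpha> \<beta> j" "(f, g') \<in> weak_graph \<alpha> \<beta> j"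
  shows "g = g'"
proof -
  have "cinner (g - g') m = 0" if "m \<in> abs_l2 ` test_functions" for m
  proof -
    have "cinner m g = cinner m g'" using assms that by (auto simp: weak_graph_def)
    then have "cinner m (g - g') = 0" by (simp add: cinner_diff_right)
    then show ?thesis by (metis cinner_commute complex_cnj_zero)
  qed
  then have "g - g' = 0" by (rule orthogonal_dense_zero[OF dense_test_functions])
  then show ?thesis by simp
qed

lemma weak_delta_eq:
  assumes "(f, g) \<in> weak_graph \<alpha> \<beta> j" shows "weak_delta \<alpha> \<beta> j f = g"
  unfolding weak_delta_def
proof (rule the_equality)
  show "has_weak_delta \<alpha> \<beta> j (rep_l2 f) (rep_l2 g)"
    using assms by (simp add: has_weak_delta_iff)
  show "g' = g" if "has_weak_delta \<alpha> \<beta> j (rep_l2 f) (rep_l2 g')" for g'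
    using that weak_graph_unique[OF _ assms] by (simp add: has_weak_delta_iff)
qed

lemma Sobolev_W_iff:
  "f \<in> Sobolev_W \<alpha> \<beta> \<longleftrightarrow> (\<forall>j\<in>{1, 2}. (f, weak_delta \<alpha> \<beta> j f) \<in> weak_graph \<alpha> \<beta> j)"
proof
  assume f: "f \<in> Sobolev_W \<alpha> \<beta>"
  show "\<forall>j\<in>{1, 2}. (f, weak_delta \<alpha> \<beta> j f) \<in> weak_graph \<alpha> \<beta> j"
  proof
    fix j :: nat assume "j \<in> {1, 2}"
    then obtain g where "has_weak_delta \<alpha> \<beta> j (rep_l2 f) g" "square_integrable g"
      using f by (auto simp: Sobolev_W_def)
    then have "(f, abs_l2 g) \<in> weak_graph \<alpha> \<beta> j" by (simp add: has_weak_delta_iff)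
    then show "(f, weak_delta \<alpha> \<beta> j f) \<in> weak_graph \<alpha> \<beta> j" using weak_delta_eq by metis
  qed
next
  assume f: "\<forall>j\<in>{1, 2}. (f, weak_delta \<alpha> \<beta> j f) \<in> weak_graph \<alpha> \<beta> j"
  have "has_weak_delta \<alpha> \<beta> j (rep_l2 f) (rep_l2 (weak_delta \<alpha> \<beta> j f))" if "j \<in> {1, 2}" for j
    using f that by (simp only: has_weak_delta_iff[OF square_integrable_rep] abs_rep_l2)
  then show "f \<in> Sobolev_W \<alpha> \<beta>"
    unfolding Sobolev_W_def using square_integrable_rep by blast
qed

lemma Sobolev_WI:
  assumes "\<And>j. j \<in> {1, 2} \<Longrightarrow> (f, g j) \<in> weak_graph \<alpha> \<beta> j"
  shows "f \<in> Sobolev_W \<alpha> \<beta>" and "\<And>j. j \<in> {1, 2} \<Longrightarrow> weak_delta \<alpha> \<beta> j f = g j"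
proof -
  show eq: "weak_delta \<alpha> \<beta> j f = g j" if "j \<in> {1, 2}" for j
    using weak_delta_eq[OF assms[OF that]] .
  show "f \<in> Sobolev_W \<alpha> \<beta>" unfolding Sobolev_W_iff using assms eq by metis
qed

lemma weak_graph_add:
  "(f, g) \<in> weak_graph \<alpha> \<beta> j \<Longrightarrow> (f', g') \<in> weak_graph \<alpha> \<beta> j \<Longrightarrow> (f + f', g + g') \<in> weak_graph \<alpha> \<beta> j"
  by (simp add: weak_graph_def cinner_add_right)

lemma weak_graph_scaleC:
  "(f, g) \<in> weak_graph \<alpha> \<beta> j \<Longrightarrow> (c *\<^sub>C f, c *\<^sub>C g) \<in> weak_graph \<alpha> \<beta> j"
  by (simp add: weak_graph_def cinner_scaleC_right)

lemma weak_graph_zero: "(0, 0) \<in> weak_graph \<alpha> \<beta> j"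
  by (simp add: weak_graph_def)

lemma weak_graph_closed:
  assumes "\<And>n. (X n, Y n) \<in> weak_graph \<alpha> \<beta> j" "X \<longlonglongrightarrow> f" "Y \<longlonglongrightarrow> g"
  shows "(f, g) \<in> weak_graph \<alpha> \<beta> j"
proof -
  have "cinner (abs_l2 (delta_dagger \<alpha> \<beta> j \<phi>)) f = cinner (abs_l2 \<phi>) g" if "\<phi> \<in> test_functions" for \<phi>
  proof (rule LIMSEQ_unique)
    show "(\<lambda>n. cinner (abs_l2 \<phi>) (Y n)) \<longlonglongrightarrow> cinner (abs_l2 \<phi>) g"
      by (intro tendsto_cinner tendsto_const assms)
    have "(\<lambda>n. cinner (abs_l2 (delta_dagger \<alpha> \<beta> j \<phi>)) (X n))
        \<longlonglongrightarrow> cinner (abs_l2 (delta_dagger \<alpha> \<beta> j \<phi>)) f"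
      by (intro tendsto_cinner tendsto_const assms)
    moreover have "cinner (abs_l2 (delta_dagger \<alpha> \<beta> j \<phi>)) (X n) = cinner (abs_l2 \<phi>) (Y n)" for n
      using assms(1)[of n] that by (simp add: weak_graph_def)
    ultimately show "(\<lambda>n. cinner (abs_l2 \<phi>) (Y n)) \<longlonglongrightarrow> cinner (abs_l2 (delta_dagger \<alpha> \<beta> j \<phi>)) f"
      by simp
  qed
  then show ?thesis by (simp add: weak_graph_def)
qed

lemma weak_delta_linear:
  assumes "j \<in> {1, 2}" "f \<in> Sobolev_W \<alpha> \<beta>" "g \<in> Sobolev_W \<alpha> \<beta>"
  shows "weak_delta \<alpha> \<beta> j (f + g) = weak_delta \<alpha> \<beta> j f + weak_delta \<alpha> \<beta> j g"
    and "weak_delta \<alpha> \<beta> j (c *\<^sub>C f) = c *\<^sub>C weak_delta \<alpha> \<beta> j f"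
    and "weak_delta \<alpha> \<beta> j (f - g) = weak_delta \<alpha> \<beta> j f - weak_delta \<alpha> \<beta> j g"
proof -
  have fg: "(f, weak_delta \<alpha> \<beta> j f) \<in> weak_graph \<alpha> \<beta> j" "(g, weak_delta \<alpha> \<beta> j g) \<in> weak_graph \<alpha> \<beta> j"
    using assms Sobolev_W_iff by blast+
  show "weak_delta \<alpha> \<beta> j (f + g) = weak_delta \<alpha> \<beta> j f + weak_delta \<alpha> \<beta> j g"
    by (intro weak_delta_eq weak_graph_add fg)
  show "weak_delta \<alpha> \<beta> j (c *\<^sub>C f) = c *\<^sub>C weak_delta \<alpha> \<beta> j f"
    by (intro weak_delta_eq weak_graph_scaleC fg)
  have "(f + (-1) *\<^sub>C g, weak_delta \<alpha> \<beta> j f + (-1) *\<^sub>C weak_delta \<alpha> \<beta> j g) \<in> weak_graph \<alpha> \<beta> j"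
    by (intro weak_graph_add weak_graph_scaleC fg)
  then show "weak_delta \<alpha> \<beta> j (f - g) = weak_delta \<alpha> \<beta> j f - weak_delta \<alpha> \<beta> j g"
    by (intro weak_delta_eq) (simp add: uminus_eq_scaleC[symmetric])
qed

section \<open>The form and the second-order operator\<close>

lemma t_form_cinner:
  "t_form \<alpha> \<beta> f g = (\<Sum>j\<in>{1, 2}. cinner (weak_delta \<alpha> \<beta> j f) (weak_delta \<alpha> \<beta> j g))"
  unfolding t_form_def cinner_rep_l2
  by (intro Bochner_Integration.integral_sum square_integrable_mult_cnj square_integrable_rep)

lemma t_form_self:
  "t_form \<alpha> \<beta> f f = of_real ((norm (weak_delta \<alpha> \<beta> 1 f))\<^sup>2 + (norm (weak_delta \<alpha> \<beta> 2 f))\<^sup>2)"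
  by (simp add: t_form_cinner cinner_self)

text \<open>
  Along a sequence that is Cauchy for the form, both weak derivatives are Cauchy in \<open>L\<^sup>2\<close>; their
  limits are the weak derivatives of the limit because the graphs are closed.
\<close>

theorem closed_form_t_form: "closed_form (Sobolev_W \<alpha> \<beta>) (t_form \<alpha> \<beta>)"
proof
  let ?W = "Sobolev_W \<alpha> \<beta>"
  let ?d = "weak_delta \<alpha> \<beta>"
  show "0 \<in> ?W" by (rule Sobolev_WI(1)[of _ "\<lambda>_. 0"]) (rule weak_graph_zero)
  show "x + y \<in> ?W" if "x \<in> ?W" "y \<in> ?W" for x y
    by (rule Sobolev_WI(1)[of _ "\<lambda>j. ?d j x + ?d j y"], rule weak_graph_add)
      (use that Sobolev_W_iff in blast)+
  show "c *\<^sub>C x \<in> ?W" if "x \<in> ?W" for c x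
    by (rule Sobolev_WI(1)[of _ "\<lambda>j. c *\<^sub>C ?d j x"], rule weak_graph_scaleC)
      (use that Sobolev_W_iff in blast)
  show "t_form \<alpha> \<beta> (x + y) z = t_form \<alpha> \<beta> x z + t_form \<alpha> \<beta> y z"
    if "x \<in> ?W" "y \<in> ?W" "z \<in> ?W" for x y z
    using that by (simp add: t_form_cinner weak_delta_linear cinner_add_left)
  show "t_form \<alpha> \<beta> (c *\<^sub>C x) y = c * t_form \<alpha> \<beta> x y" if "x \<in> ?W" "y \<in> ?W" for c x y
    using weak_delta_linear(2)[OF _ that]
    by (simp add: t_form_cinner cinner_scaleC_left distrib_left)
  show "t_form \<alpha> \<beta> x y = cnj (t_form \<alpha> \<beta> y x)" for x y
    using cinner_commute[of "?d 1 x" "?d 1 y"] cinner_commute[of "?d 2 x" "?d 2 y"]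
    by (simp add: t_form_cinner)
  show "0 \<le> Re (t_form \<alpha> \<beta> x x)" for x
    unfolding t_form_self Re_complex_of_real by simp
  fix X h assume X: "form_converges ?W (t_form \<alpha> \<beta>) X h"
  then have XW: "X n \<in> ?W" for n by (simp add: form_converges_def)
  have "\<exists>g. (\<lambda>n. ?d j (X n)) \<longlonglongrightarrow> g" if j: "j \<in> {1, 2}" for j
  proof -
    have "Cauchy (\<lambda>n. ?d j (X n))"
    proof (rule metric_CauchyI)
      fix e :: real assume e: "e > 0"
      then have "e\<^sup>2 > 0" by simp
      then obtain N where N: "\<forall>m\<ge>N. \<forall>n\<ge>N. cmod (t_form \<alpha> \<beta> (X m - X n) (X m - X n)) < e\<^sup>2"
        using X unfolding form_converges_def by metis
      have "dist (?d j (X m)) (?d j (X n)) < e" if mn: "m \<ge> N" "n \<ge> N" for m n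
      proof -
        have "(norm (?d j (X m - X n)))\<^sup>2 \<le>
            (norm (?d 1 (X m - X n)))\<^sup>2 + (norm (?d 2 (X m - X n)))\<^sup>2"
          using j by auto
        also have "\<dots> = cmod (t_form \<alpha> \<beta> (X m - X n) (X m - X n))"
          unfolding t_form_self norm_of_real by simp
        also have "\<dots> < e\<^sup>2" using N mn by blast
        finally show ?thesis
          using e weak_delta_linear(3)[OF j XW XW]
          by (simp add: dist_norm norm_less_if_square_less)
      qed
      then show "\<exists>M. \<forall>m\<ge>M. \<forall>n\<ge>M. dist (?d j (X m)) (?d j (X n)) < e" by blast
    qed
    then show ?thesis using Cauchy_convergent convergentD by blast
  qed
  then obtain g where g: "\<And>j. j \<in> {1, 2} \<Longrightarrow> (\<lambda>n. ?d j (X n)) \<longlonglongrightarrow> g j" by metis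
  have graph: "(h, g j) \<in> weak_graph \<alpha> \<beta> j" if j: "j \<in> {1, 2}" for j
  proof (rule weak_graph_closed[OF _ _ g[OF j]])
    show "(X n, ?d j (X n)) \<in> weak_graph \<alpha> \<beta> j" for n using XW[of n] j Sobolev_W_iff by blast
    show "X \<longlonglongrightarrow> h" using X by (simp add: form_converges_def)
  qed
  have hW: "h \<in> ?W" using Sobolev_WI(1)[of h g] graph by blast
  have dh: "?d j h = g j" if "j \<in> {1, 2}" for j using Sobolev_WI(2)[of h g] graph that by blast
  have "(\<lambda>n. (norm (?d j (X n) - ?d j h))\<^sup>2) \<longlonglongrightarrow> 0" if j: "j \<in> {1, 2}" for j
  proof -
    have "(\<lambda>n. (norm (?d j (X n) - ?d j h))\<^sup>2) \<longlonglongrightarrow> (norm (?d j h - ?d j h))\<^sup>2"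
      using g[OF j] dh[OF j] by (intro tendsto_intros) simp
    then show ?thesis by simp
  qed
  from tendsto_add[OF this[of 1] this[of 2]]
  have "(\<lambda>n. (norm (?d 1 (X n) - ?d 1 h))\<^sup>2 + (norm (?d 2 (X n) - ?d 2 h))\<^sup>2) \<longlonglongrightarrow> 0" by simp
  moreover have "Re (t_form \<alpha> \<beta> (X n - h) (X n - h))
      = (norm (?d 1 (X n) - ?d 1 h))\<^sup>2 + (norm (?d 2 (X n) - ?d 2 h))\<^sup>2" for n
    unfolding t_form_self Re_complex_of_real using weak_delta_linear(3)[OF _ XW hW] by simp
  ultimately show "h \<in> ?W \<and> (\<lambda>n. Re (t_form \<alpha> \<beta> (X n - h) (X n - h))) \<longlonglongrightarrow> 0"
    using hW by simp
qed

lemma test_function_weak_graph: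
  assumes "\<phi> \<in> test_functions"
  shows "(abs_l2 \<phi>, abs_l2 (delta \<alpha> \<beta> j \<phi>)) \<in> weak_graph \<alpha> \<beta> j"
  using assms by (simp add: weak_graph_def cinner_delta_dagger)

lemma test_functions_Sobolev_W: "abs_l2 ` test_functions \<subseteq> Sobolev_W \<alpha> \<beta>"
  using Sobolev_WI(1)[OF test_function_weak_graph] by blast

lemma test_functions_G_diff:
  assumes "\<phi> \<in> test_functions" shows "G_diff \<alpha> \<beta> \<phi> \<in> test_functions"
proof -
  \<comment> \<open>By \<open>z / 0 = 0\<close> these identities hold in the whole plane, not only on the quadrant.\<close>
  have weight1: "complex_of_real (c / t\<^sup>2) * z = of_real c * (z / of_real t / of_real t)"
    and weight2: "complex_of_real (t\<^sup>2) * z = of_real t * (of_real t * z)" for c t z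
    by (simp_all add: power2_eq_square)
  have "G_diff \<alpha> \<beta> \<phi> = (\<lambda>x. ((-1) * partial_r (partial_r \<phi>) x
      + of_real (\<alpha>\<^sup>2 - 1/4) * (\<phi> x / of_real (fst x) / of_real (fst x)))
      + of_real (fst x) * (of_real (fst x) * ((-1) * partial_s (partial_s \<phi>) x
      + of_real (\<beta>\<^sup>2 - 1/4) * (\<phi> x / of_real (snd x) / of_real (snd x)))))"
    unfolding G_diff_def case_prod_beta prod.collapse weight1 weight2 by simp
  also have "\<dots> \<in> test_functions"
    by (intro test_functions_add test_functions_scale test_functions_mult_r
        test_functions_div_r test_functions_div_s test_functions_partial assms)
  finally show ?thesis .
qed

text \<open>The factorisation rests on \<open>a\<^sup>2 - a = \<alpha>\<^sup>2 - 1/4\<close> for \<open>a = \<alpha> + 1/2\<close>.\<close>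

lemma G_diff_factorisation:
  assumes \<phi>: "\<phi> \<in> test_functions" and x: "x \<in> quadrant"
  shows "G_diff \<alpha> \<beta> \<phi> x =
    delta_dagger \<alpha> \<beta> 1 (delta \<alpha> \<beta> 1 \<phi>) x + delta_dagger \<alpha> \<beta> 2 (delta \<alpha> \<beta> 2 \<phi>) x"
proof -
  obtain r s where rs: "x = (r, s)" "r > 0" "s > 0" using x by (auto simp: quadrant_def)
  note d = Ck_SucD[OF test_functions_Ck[OF \<phi>, of "Suc 0"]]
  note dr = Ck_SucD[OF test_functions_Ck[OF test_functions_partial(1)[OF \<phi>], of "Suc 0"]]
  note ds = Ck_SucD[OF test_functions_Ck[OF test_functions_partial(2)[OF \<phi>], of "Suc 0"]]
  have weight: "((\<lambda>t. complex_of_real (c / t)) has_vector_derivative of_real (- c / u\<^sup>2)) (at u)"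
    if "u \<noteq> 0" for c u :: real
  proof -
    have "((\<lambda>t. c / t) has_real_derivative - c / u\<^sup>2) (at u)"
      using that by (auto intro!: derivative_eq_intros simp: power2_eq_square)
    then show ?thesis
      by (intro has_vector_derivative_of_real) (simp add: has_real_derivative_iff_has_vector_derivative)
  qed
  define a where "a = \<alpha> + 1/2"
  define b where "b = \<beta> + 1/2"
  have delta1: "delta \<alpha> \<beta> 1 \<phi> (u, v) = partial_r \<phi> (u, v) - of_real (a / u) * \<phi> (u, v)" for u v
    by (simp add: delta_def a_def)
  have delta2: "delta \<alpha> \<beta> 2 \<phi> (u, v) =
      of_real u * (partial_s \<phi> (u, v) - of_real (b / v) * \<phi> (u, v))" for u v
    by (simp add: delta_def b_def)
  have "((\<lambda>t. partial_r \<phi> (t, s) - of_real (a / t) * \<phi> (t, s)) has_vector_derivative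
      partial_r (partial_r \<phi>) (r, s)
      - (of_real (a / r) * partial_r \<phi> (r, s) + of_real (- a / r\<^sup>2) * \<phi> (r, s))) (at r)"
    using rs by (intro has_vector_derivative_diff has_vector_derivative_mult dr d weight) auto
  then have 1: "partial_r (delta \<alpha> \<beta> 1 \<phi>) (r, s) = partial_r (partial_r \<phi>) (r, s)
      - (of_real (a / r) * partial_r \<phi> (r, s) + of_real (- a / r\<^sup>2) * \<phi> (r, s))"
    unfolding partial_r_def[of "delta \<alpha> \<beta> 1 \<phi>"] prod.case delta1
    by (rule vector_derivative_at)
  have "((\<lambda>t. of_real r * (partial_s \<phi> (r, t) - of_real (b / t) * \<phi> (r, t))) has_vector_derivative
      of_real r * (partial_s (partial_s \<phi>) (r, s)
      - (of_real (b / s) * partial_s \<phi> (r, s) + of_real (- b / s\<^sup>2) * \<phi> (r, s)))) (at s)"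
    using rs by (intro has_vector_derivative_mult_right has_vector_derivative_diff
        has_vector_derivative_mult ds d weight) auto
  then have 2: "partial_s (delta \<alpha> \<beta> 2 \<phi>) (r, s) = of_real r * (partial_s (partial_s \<phi>) (r, s)
      - (of_real (b / s) * partial_s \<phi> (r, s) + of_real (- b / s\<^sup>2) * \<phi> (r, s)))"
    unfolding partial_s_def[of "delta \<alpha> \<beta> 2 \<phi>"] prod.case delta2
    by (rule vector_derivative_at)
  have ab: "\<alpha>\<^sup>2 - 1/4 = a\<^sup>2 - a" "\<beta>\<^sup>2 - 1/4 = b\<^sup>2 - b"
    by (simp_all add: a_def b_def power2_eq_square field_simps)
  have D1: "delta_dagger \<alpha> \<beta> 1 (delta \<alpha> \<beta> 1 \<phi>) x =
      - partial_r (partial_r \<phi>) (r, s) + of_real ((a\<^sup>2 - a) / r\<^sup>2) * \<phi> (r, s)"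
    using rs(2) unfolding rs(1) delta_dagger_def prod.case 1 delta1 a_def[symmetric]
    by (simp add: field_simps power2_eq_square)
  have D2: "delta_dagger \<alpha> \<beta> 2 (delta \<alpha> \<beta> 2 \<phi>) x =
      of_real (r\<^sup>2) * (- partial_s (partial_s \<phi>) (r, s) + of_real ((b\<^sup>2 - b) / s\<^sup>2) * \<phi> (r, s))"
    using rs(3) unfolding rs(1) delta_dagger_def prod.case 2 delta2 b_def[symmetric]
    by (simp add: field_simps power2_eq_square)
  show ?thesis unfolding D1 D2 unfolding rs(1) G_diff_def ab by simp
qed

lemma abs_G_diff:
  assumes "\<phi> \<in> test_functions"
  shows "abs_l2 (G_diff \<alpha> \<beta> \<phi>) =
    abs_l2 (delta_dagger \<alpha> \<beta> 1 (delta \<alpha> \<beta> 1 \<phi>)) + abs_l2 (delta_dagger \<alpha> \<beta> 2 (delta \<alpha> \<beta> 2 \<phi>))"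
proof -
  note t = test_functions_delta_dagger[OF test_functions_delta[OF assms]]
  note sq = test_function_square_integrable
  show ?thesis
    unfolding abs_l2_add[OF sq[OF t] sq[OF t]]
  proof (rule abs_l2_eqI[OF sq[OF test_functions_G_diff[OF assms]] sq[OF test_functions_add[OF t t]]])
    show "AE x in quadrant_measure. G_diff \<alpha> \<beta> \<phi> x =
        delta_dagger \<alpha> \<beta> 1 (delta \<alpha> \<beta> 1 \<phi>) x + delta_dagger \<alpha> \<beta> 2 (delta \<alpha> \<beta> 2 \<phi>) x"
      by (rule AE_I2) (simp add: quadrant_measure_def space_restrict_space G_diff_factorisation assms)
  qed
qed

text \<open>
  Since \<open>\<delta>\<^sub>j \<phi>\<close> is again a test function, it may be inserted into the definition of the weak
  derivative of \<open>g\<close>; in this way both derivatives are moved onto \<open>\<phi>\<close>.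
\<close>

lemma G_op_subset_D_op: "G_op \<alpha> \<beta> \<subseteq> D_op \<alpha> \<beta>"
proof -
  have "(abs_l2 \<phi>, abs_l2 (G_diff \<alpha> \<beta> \<phi>)) \<in> D_op \<alpha> \<beta>" if \<phi>: "\<phi> \<in> test_functions" for \<phi>
  proof -
    have "t_form \<alpha> \<beta> (abs_l2 \<phi>) g = cinner (abs_l2 (G_diff \<alpha> \<beta> \<phi>)) g" if g: "g \<in> Sobolev_W \<alpha> \<beta>" for g
    proof -
      have "cinner (weak_delta \<alpha> \<beta> j (abs_l2 \<phi>)) (weak_delta \<alpha> \<beta> j g)
          = cinner (abs_l2 (delta_dagger \<alpha> \<beta> j (delta \<alpha> \<beta> j \<phi>))) g" if j: "j \<in> {1, 2}" for j
      proof -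
        have "(g, weak_delta \<alpha> \<beta> j g) \<in> weak_graph \<alpha> \<beta> j" using g j Sobolev_W_iff by blast
        then show ?thesis
          using test_functions_delta[OF \<phi>]
          unfolding weak_delta_eq[OF test_function_weak_graph[OF \<phi>]]
          by (simp add: weak_graph_def)
      qed
      then show ?thesis by (simp add: t_form_cinner abs_G_diff[OF \<phi>] cinner_add_left)
    qed
    moreover have "abs_l2 \<phi> \<in> Sobolev_W \<alpha> \<beta>" using \<phi> test_functions_Sobolev_W by blast
    ultimately show ?thesis by (simp add: D_op_def form_operator_def)
  qed
  then show ?thesis by (auto simp: G_op_def)
qed

lemma Domain_G_op: "Domain (G_op \<alpha> \<beta>) = abs_l2 ` test_functions"
  by (auto simp: G_op_def)

lemma Sobolev_W0_eq:
  "Sobolev_W0 \<alpha> \<beta> = closed_form.form_norm_closure (Sobolev_W \<alpha> \<beta>) (t_form \<alpha> \<beta>) (abs_l2 ` test_functions)"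
proof -
  interpret closed_form "Sobolev_W \<alpha> \<beta>" "t_form \<alpha> \<beta>" by (rule closed_form_t_form)
  have W: "W_norm \<alpha> \<beta> u = sqrt ((norm u)\<^sup>2 + Re (t_form \<alpha> \<beta> u u))" for u
    unfolding W_norm_def W_inner_def t_form_cinner[symmetric]
    by (simp only: cinner_self plus_complex.sel Re_complex_of_real)
  have "(\<forall>e>0. \<exists>\<phi>\<in>test_functions. W_norm \<alpha> \<beta> (f - abs_l2 \<phi>) < e) \<longleftrightarrow>
      (\<forall>e>0. \<exists>c\<in>abs_l2 ` test_functions. (norm (f - c))\<^sup>2 + Re (t_form \<alpha> \<beta> (f - c) (f - c)) < e)" for f
  proof (intro iffI allI impI)
    fix e :: real assume "e > 0" and
      *: "\<forall>e>0. \<exists>\<phi>\<in>test_functions. W_norm \<alpha> \<beta> (f - abs_l2 \<phi>) < e"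
    then have "sqrt e > 0" by simp
    with * obtain \<phi> where "\<phi> \<in> test_functions" "W_norm \<alpha> \<beta> (f - abs_l2 \<phi>) < sqrt e" by blast
    then show "\<exists>c\<in>abs_l2 ` test_functions. (norm (f - c))\<^sup>2 + Re (t_form \<alpha> \<beta> (f - c) (f - c)) < e"
      unfolding W real_sqrt_less_iff by blast
  next
    fix e :: real assume e: "e > 0" and
      *: "\<forall>e>0. \<exists>c\<in>abs_l2 ` test_functions. (norm (f - c))\<^sup>2 + Re (t_form \<alpha> \<beta> (f - c) (f - c)) < e"
    then have "e\<^sup>2 > 0" by simp
    with * obtain \<phi> where \<phi>: "\<phi> \<in> test_functions"
      "(norm (f - abs_l2 \<phi>))\<^sup>2 + Re (t_form \<alpha> \<beta> (f - abs_l2 \<phi>) (f - abs_l2 \<phi>)) < e\<^sup>2" by blast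
    then have "W_norm \<alpha> \<beta> (f - abs_l2 \<phi>) < e"
      unfolding W using e real_less_lsqrt by (metis less_imp_le)
    then show "\<exists>\<phi>\<in>test_functions. W_norm \<alpha> \<beta> (f - abs_l2 \<phi>) < e" using \<phi> by blast
  qed
  then show ?thesis unfolding Sobolev_W0_def form_norm_closure_def by simp
qed

theorem theorem5p5:
  fixes \<alpha> \<beta> :: real
  assumes "\<alpha> > -1" and "\<beta> > -1"
  shows "self_adjoint_op (D_op \<alpha> \<beta>) \<and> nonnegative_op (D_op \<alpha> \<beta>) \<and> G_op \<alpha> \<beta> \<subseteq> D_op \<alpha> \<beta> \<and>
         self_adjoint_op (D0_op \<alpha> \<beta>) \<and> nonnegative_op (D0_op \<alpha> \<beta>) \<and> G_op \<alpha> \<beta> \<subseteq> D0_op \<alpha> \<beta> \<and>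
         is_friedrichs_extension (G_op \<alpha> \<beta>) (D0_op \<alpha> \<beta>)"
proof -
  let ?C = "abs_l2 ` test_functions"
  interpret W: closed_form "Sobolev_W \<alpha> \<beta>" "t_form \<alpha> \<beta>" by (rule closed_form_t_form)
  have C: "?C \<subseteq> Sobolev_W \<alpha> \<beta>" by (rule test_functions_Sobolev_W)
  note zero = abs_test_functions_subspace(1) and add = abs_test_functions_subspace(2)
    and scale = abs_test_functions_subspace(3)
  have W0: "Sobolev_W0 \<alpha> \<beta> = W.form_norm_closure ?C" by (rule Sobolev_W0_eq)
  interpret W0: closed_form "Sobolev_W0 \<alpha> \<beta>" "t_form \<alpha> \<beta>"
    unfolding W0 by (rule W.closed_form_form_norm_closure[OF C zero add scale])
  have C0: "?C \<subseteq> Sobolev_W0 \<alpha> \<beta>"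
    unfolding W0 by (rule W.subset_form_norm_closure[OF C zero add scale])
  have dense: "closure (Sobolev_W \<alpha> \<beta>) = UNIV" "closure (Sobolev_W0 \<alpha> \<beta>) = UNIV"
    using closure_mono[OF C] closure_mono[OF C0] dense_test_functions by auto
  have sa: "self_adjoint_op (D_op \<alpha> \<beta>)"
    unfolding D_op_def by (rule W.self_adjoint_form_operator[OF dense(1)])
  then have op: "is_operator (D_op \<alpha> \<beta>)" by (simp add: self_adjoint_op_def)
  have GD: "G_op \<alpha> \<beta> \<subseteq> D_op \<alpha> \<beta>" by (rule G_op_subset_D_op)
  have W0_sub: "Sobolev_W0 \<alpha> \<beta> \<subseteq> Sobolev_W \<alpha> \<beta>" by (auto simp: Sobolev_W0_def)
  have GD0: "G_op \<alpha> \<beta> \<subseteq> D0_op \<alpha> \<beta>"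
  proof clarify
    fix x y assume "(x, y) \<in> G_op \<alpha> \<beta>"
    then have "(x, y) \<in> D_op \<alpha> \<beta>" "x \<in> Sobolev_W0 \<alpha> \<beta>" using GD C0 Domain_G_op by blast+
    then show "(x, y) \<in> D0_op \<alpha> \<beta>"
      using W0_sub unfolding D_op_def D0_op_def form_operator_def by blast
  qed
  \<comment> \<open>\<open>G\<close> is the restriction of the operator \<open>D\<close> to a subspace; this makes it single-valued and
    linear without any computation with \<open>G_diff\<close>.\<close>
  have in_G: "(x, y) \<in> G_op \<alpha> \<beta>" if x: "x \<in> ?C" and y: "(x, y) \<in> D_op \<alpha> \<beta>" for x y
  proof -
    obtain z where z: "(x, z) \<in> G_op \<alpha> \<beta>" using x Domain_G_op by blast
    then have "z = y" using y GD op unfolding is_operator_def by (meson single_valuedD subsetD)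
    then show ?thesis using z by simp
  qed
  have mem: "x \<in> ?C" "(x, y) \<in> D_op \<alpha> \<beta>" if "(x, y) \<in> G_op \<alpha> \<beta>" for x y
    using that GD Domain_G_op by blast+
  have G: "is_operator (G_op \<alpha> \<beta>)"
    unfolding is_operator_def
  proof (intro conjI allI impI)
    show "(0, 0) \<in> G_op \<alpha> \<beta>"
      using op zero by (intro in_G) (auto simp: is_operator_def)
    show "(x + x', y + y') \<in> G_op \<alpha> \<beta>" if "(x, y) \<in> G_op \<alpha> \<beta>" "(x', y') \<in> G_op \<alpha> \<beta>" for x y x' y'
      using op mem[OF that(1)] mem[OF that(2)] unfolding is_operator_def by (intro in_G add) blast+
    show "(c *\<^sub>C x, c *\<^sub>C y) \<in> G_op \<alpha> \<beta>" if "(x, y) \<in> G_op \<alpha> \<beta>" for c x y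
      using op mem[OF that] unfolding is_operator_def by (intro in_G scale) blast+
    show "single_valued (G_op \<alpha> \<beta>)"
      using op GD single_valued_subset unfolding is_operator_def by blast
  qed
  have "densely_defined (G_op \<alpha> \<beta>)"
    unfolding densely_defined_def Domain_G_op by (rule dense_test_functions)
  then have "is_friedrichs_extension (G_op \<alpha> \<beta>) (D0_op \<alpha> \<beta>)"
    using W.friedrichs_extension_of_restriction[OF G] GD
    unfolding D_op_def D0_op_def Domain_G_op W0 by blast
  moreover have "self_adjoint_op (D0_op \<alpha> \<beta>)" "nonnegative_op (D0_op \<alpha> \<beta>)"
    unfolding D0_op_def
    by (rule W0.self_adjoint_form_operator[OF dense(2)], rule W0.nonnegative_form_operator)
  moreover have "nonnegative_op (D_op \<alpha> \<beta>)"
    unfolding D_op_def by (rule W.nonnegative_form_operator)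
  ultimately show ?thesis using sa GD GD0 by blast
qed

end
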